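(* Let $\Omega\subset\mathbb{R}^2$ be an open set and let $f\in C^\infty(\Omega)$ be real valued. Let $A,B\subset\mathbb{R}$ be compact sets with $\dim_H A,\dim_H B>0$ and $A\times B\subset\Omega\setminus\mathcal{Z}_{2,f}$, where $\mathcal{Z}_{2,f}$ is defined in the context. Let $\Delta_f(A,B)=f(A\times B)$. (i) For $u\in(0,1)$, if $\dim_H A+\dim_H B>\frac23+u$, then $\dim_H\Delta_f(A,B)\ge u$. (ii) If $\dim_H A+\dim_H B>\frac53$, then $\mathcal{L}^1(\Delta_f(A,B))>0$.
   Context: $\dim_H$ is Hausdorff dimension and $\mathcal{L}^1$ is Lebesgue measure on $\mathbb{R}$. On the set where $\partial_{xy}f\ne0$ define $$\rho=\frac{\partial_xf\,\partial_yf}{\partial_{xy}f},\qquad \kappa=\nabla f\wedge\nabla\rho=\partial_xf\,\partial_y\rho-\partial_yf\,\partial_x\rho .$$ The bad set is $$\mathcal{Z}_{2,f}=\{\partial_xf=0\}\cup\{\partial_yf=0\}\cup\{\partial_{xy}f=0\}\cup\{\kappa=0\}\subset\Omega.$$ *)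

theory Defs
  imports "HOL-Analysis.Analysis"
begin

section \<open>Hausdorff dimension\<close>

text \<open>
  The weight of a covering set is \<open>diam(U)\<^sup>s\<close>, with the usual conventions that the empty set
  weighs nothing and that a nonempty set has weight 1 for \<open>s = 0\<close>.  The latter is spelled out
  because \<open>0 powr 0 = 0\<close> for \<^const>\<open>powr\<close>.
\<close>

definition hausdorff_weight :: "real \<Rightarrow> 'a::metric_space set \<Rightarrow> ennreal" where
  "hausdorff_weight s U =
     (if U = {} then 0 else if s = 0 then 1 else ennreal (diameter U powr s))"

text \<open>
  Boundedness of the covering sets is required explicitly because \<^const>\<open>diameter\<close> is real-valued
  and meaningless on unbounded sets.  Finite covers are included, since the \<open>U i\<close> may be empty.
\<close>

definition hausdorff_premeasure :: "real \<Rightarrow> real \<Rightarrow> 'a::metric_space set \<Rightarrow> ennreal" where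
  "hausdorff_premeasure s \<delta> A =
     (INF U \<in> {U :: nat \<Rightarrow> 'a set. A \<subseteq> (\<Union>i. U i) \<and> (\<forall>i. bounded (U i) \<and> diameter (U i) \<le> \<delta>)}.
        (\<Sum>i. hausdorff_weight s (U i)))"

definition hausdorff_measure :: "real \<Rightarrow> 'a::metric_space set \<Rightarrow> ennreal" where
  "hausdorff_measure s A = (SUP \<delta> \<in> {0<..}. hausdorff_premeasure s \<delta> A)"

definition hausdorff_dim :: "'a::metric_space set \<Rightarrow> ennreal" where
  "hausdorff_dim A = (INF s \<in> {s. 0 \<le> s \<and> hausdorff_measure s A = 0}. ennreal s)"


section \<open>Partial derivatives and smooth functions on the plane\<close>

definition pd_x :: "(real \<times> real \<Rightarrow> real) \<Rightarrow> real \<times> real \<Rightarrow> real" where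
  "pd_x f p = deriv (\<lambda>s. f (s, snd p)) (fst p)"

definition pd_y :: "(real \<times> real \<Rightarrow> real) \<Rightarrow> real \<times> real \<Rightarrow> real" where
  "pd_y f p = deriv (\<lambda>t. f (fst p, t)) (snd p)"

text \<open>
  All partial derivatives of order at most \<open>k\<close>, taken in any order, exist and are continuous.
  This is meant for open \<open>S\<close>, where the values of \<open>f\<close> outside \<open>S\<close> play no role.
\<close>

primrec C_k_on :: "nat \<Rightarrow> (real \<times> real) set \<Rightarrow> (real \<times> real \<Rightarrow> real) \<Rightarrow> bool" where
  "C_k_on 0 S f \<longleftrightarrow> continuous_on S f"
| "C_k_on (Suc k) S f \<longleftrightarrow>
     continuous_on S f \<and>
     (\<forall>(x, y) \<in> S. (\<lambda>s. f (s, y)) differentiable (at x) \<and> (\<lambda>t. f (x, t)) differentiable (at y)) \<and>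
     C_k_on k S (pd_x f) \<and> C_k_on k S (pd_y f)"

definition C_infinity_on :: "(real \<times> real) set \<Rightarrow> (real \<times> real \<Rightarrow> real) \<Rightarrow> bool" where
  "C_infinity_on S f \<longleftrightarrow> (\<forall>k. C_k_on k S f)"


section \<open>The bad set\<close>

definition pd_xy :: "(real \<times> real \<Rightarrow> real) \<Rightarrow> real \<times> real \<Rightarrow> real" where
  "pd_xy f = pd_x (pd_y f)"

text \<open>
  The functions \<open>rho f\<close> and \<open>kappa f\<close> are meaningful only where \<open>pd_xy f\<close> does not vanish.
  Their values elsewhere do not affect \<open>bad_set\<close>, which contains the zeros of \<open>pd_xy f\<close> anyway.
\<close>

definition rho :: "(real \<times> real \<Rightarrow> real) \<Rightarrow> real \<times> real \<Rightarrow> real" where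
  "rho f p = pd_x f p * pd_y f p / pd_xy f p"

definition kappa :: "(real \<times> real \<Rightarrow> real) \<Rightarrow> real \<times> real \<Rightarrow> real" where
  "kappa f p = pd_x f p * pd_y (rho f) p - pd_y f p * pd_x (rho f) p"

definition bad_set :: "(real \<times> real) set \<Rightarrow> (real \<times> real \<Rightarrow> real) \<Rightarrow> (real \<times> real) set" where
  "bad_set \<Omega> f =
     {p \<in> \<Omega>. pd_x f p = 0} \<union> {p \<in> \<Omega>. pd_y f p = 0} \<union> {p \<in> \<Omega>. pd_xy f p = 0} \<union>
     {p \<in> \<Omega>. pd_xy f p \<noteq> 0 \<and> kappa f p = 0}"

definition Delta :: "(real \<times> real \<Rightarrow> real) \<Rightarrow> real set \<Rightarrow> real set \<Rightarrow> real set" where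
  "Delta f A B = f ` (A \<times> B)"

end

theory Submission
  imports Defs
begin

text \<open>
  Let \<open>m\<close> and \<open>n\<close> be discrete Frostman weights on \<open>A\<close> and \<open>B\<close>, and count the weighted quadruples with
  \<open>\<bar>f x y - f x' y'\<bar> \<le> r\<close>.  If their weight is at most a constant times \<open>r powr w\<close> for every dyadic \<open>r\<close>,
  then the values of \<open>f\<close> cannot be covered by few small intervals, which gives dimension at least \<open>w\<close>
  and, for \<open>w = 1\<close>, positive measure.

  For the count, the bump at scale \<open>r\<close> is a telescoping sum of differences of bumps at consecutive
  dyadic scales.  In each difference the weight on \<open>B\<close> is mollified, and the Cauchy-Schwarz
  inequality in \<open>(y, y')\<close> leaves a double sum over \<open>(x, x')\<close> and \<open>(z, z')\<close> of integrals of products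
  \<open>psi r x x' * psi r z z'\<close>.  The two factors live near curves \<open>f x y = f x' y'\<close> and \<open>f z y = f z' y'\<close> and
  have mean zero across them.  Since \<open>kappa\<close> does not vanish, the curves are transversal with an angle
  comparable to \<open>\<bar>x - x'\<bar> * \<bar>x - z\<bar>\<close>, so one integration by parts gains a factor
  \<open>r / (\<bar>x - x'\<bar>^2 * \<bar>x - z\<bar>)\<close>.
\<close>

section \<open>A smooth bump\<close>

text \<open>Put \<open>eta = fxy / (fx * fy)\<close>. At fixed \<open>y\<close> this is the
  derivative of \<open>ln \<bar>fy\<bar>\<close> with respect to the value of \<open>f\<close>,
  while the curve \<open>f x y = f x' y'\<close> has slope \<open>fy x y / fy x' y'\<close>. If
  \<open>x\<close> and \<open>x'\<close> move so that a point \<open>(y, y')\<close> stays on the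
  curve, the logarithm of the slope changes at the rate \<open>eta x y - eta x' y'\<close>. Since
  \<open>eta = 1 / rho\<close>, \<open>kappa / rho^2\<close> is the determinant of the gradients of
  \<open>eta\<close> and \<open>f\<close>: its nonvanishing makes that rate comparable to
  \<open>\<bar>x - x'\<bar>\<close>, and the values of \<open>f\<close> move by about
  \<open>\<bar>x - z\<bar>\<close>. This is the product in the angle. The gain is not symmetric in
  the two factors because the integration by parts also differentiates the reciprocal of the angle.
  The angle then enters squared, but its derivative is of size \<open>\<bar>x - z\<bar>\<close> and
  restores one of the factors \<open>\<bar>x - z\<bar>\<close>. The estimate degenerates at
  \<open>x = x'\<close>, so pairs closer than a threshold \<open>d\<close> are counted trivially,
  and \<open>d\<close> and the mollification scale are balanced as powers of \<open>r\<close>.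
  Measures appear only as finite weights with constants independent of the resolution: a compact set
  has finite coverings, so no limit measure has to be constructed.\<close>

lemma has_real_derivative_max_power:
  "((\<lambda>s::real. (max 0 s) ^ (n + 2)) has_real_derivative real (n + 2) * (max 0 s) ^ (n + 1)) (at s)"
proof -
  consider "s > 0" | "s < 0" | "s = 0" by linarith
  then show ?thesis
  proof cases
    case 1
    have "((\<lambda>s::real. s ^ (n + 2)) has_real_derivative real (n + 2) * s ^ (n + 1)) (at s)"
      by (rule derivative_eq_intros refl | simp)+
    then have "((\<lambda>s::real. (max 0 s) ^ (n + 2)) has_real_derivative real (n + 2) * s ^ (n + 1)) (at s)"
      by (rule has_field_derivative_transform_within_open[where S="{0<..}"]) (use 1 in auto)
    then show ?thesis using 1 by simp
  next
    case 2
    have "((\<lambda>s::real. 0) has_real_derivative 0) (at s)" by simp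
    then have "((\<lambda>s::real. (max 0 s) ^ (n + 2)) has_real_derivative 0) (at s)"
      by (rule has_field_derivative_transform_within_open[where S="{..<0}"]) (use 2 in auto)
    then show ?thesis using 2 by simp
  next
    case 3
    have "((\<lambda>h::real. max 0 h ^ (n + 1)) \<longlongrightarrow> max 0 0 ^ (n+1)) (at 0)"
      by (intro tendsto_intros)
    then have l: "((\<lambda>h::real. max 0 h ^ (n + 1)) \<longlongrightarrow> 0) (at 0)" by simp
    have "((\<lambda>h::real. max 0 h ^ (n + 2) / h) \<longlongrightarrow> 0) (at 0)"
    proof (rule Lim_transform_eventually[OF l])
      show "\<forall>\<^sub>F h in at 0. max 0 h ^ (n + 1) = max 0 (h::real) ^ (n + 2) / h"
        unfolding eventually_at_filter by (auto simp: max_def)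
    qed
    then show ?thesis using 3 by (simp add: DERIV_def)
  qed
qed

lemma DERIV_max_square:
  assumes "(g has_real_derivative d) (at x)"
  shows "((\<lambda>x. (max 0 (g x))\<^sup>2) has_real_derivative 2 * max 0 (g x) * d) (at x)"
proof -
  have "((\<lambda>s::real. (max 0 s)\<^sup>2) has_real_derivative 2 * max 0 (g x)) (at (g x))"
    using has_real_derivative_max_power[of 0 "g x"] by (simp only: add_0 of_nat_numeral power_one_right)
  from DERIV_chain2[OF this assms] show ?thesis .
qed

lemma DERIV_max_cube:
  assumes "(g has_real_derivative d) (at x)"
  shows "((\<lambda>x. (max 0 (g x)) ^ 3) has_real_derivative 3 * (max 0 (g x))\<^sup>2 * d) (at x)"
proof -
  have [simp]: "(1::nat) + 2 = 3" "(1::nat) + 1 = 2" by simp_all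
  have "((\<lambda>s::real. (max 0 s) ^ 3) has_real_derivative 3 * (max 0 (g x))\<^sup>2) (at (g x))"
    using has_real_derivative_max_power[of 1 "g x"] by (simp only: \<open>(1::nat) + 2 = 3\<close> \<open>(1::nat) + 1 = 2\<close> of_nat_numeral)
  from DERIV_chain2[OF this assms] show ?thesis .
qed

text \<open>A third difference of the truncated square: the quadratic B-spline with knots -3, -1, 1,
  3. It is continuously differentiable, nonnegative, supported in \<open>[-3, 3]\<close> and of
  total mass 1, and its antiderivative \<open>bump_int\<close> is again an explicit spline.\<close>

definition bump :: "real \<Rightarrow> real" where
  "bump s = ((max 0 (s + 3))\<^sup>2 - 3 * (max 0 (s + 1))\<^sup>2 + 3 * (max 0 (s - 1))\<^sup>2 - (max 0 (s - 3))\<^sup>2) / 16"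

definition bump_deriv :: "real \<Rightarrow> real" where
  "bump_deriv s = (max 0 (s + 3) - 3 * max 0 (s + 1) + 3 * max 0 (s - 1) - max 0 (s - 3)) / 8"

definition bump_int :: "real \<Rightarrow> real" where
  "bump_int s = ((max 0 (s + 3)) ^ 3 - 3 * (max 0 (s + 1)) ^ 3 + 3 * (max 0 (s - 1)) ^ 3
     - (max 0 (s - 3)) ^ 3) / 48"

lemma DERIV_bump [derivative_intros]:
  assumes "(g has_real_derivative g') (at x)"
  shows "((\<lambda>x. bump (g x)) has_real_derivative bump_deriv (g x) * g') (at x)"
proof -
  have "(bump has_real_derivative bump_deriv s) (at s)" for s
    unfolding bump_def[abs_def] bump_deriv_def
    by (rule DERIV_max_square[THEN DERIV_cong] derivative_eq_intros refl)+ (simp_all add: field_simps)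
  then show ?thesis using DERIV_chain2 assms by blast
qed

lemma DERIV_bump_int [derivative_intros]:
  assumes "(g has_real_derivative g') (at x)"
  shows "((\<lambda>x. bump_int (g x)) has_real_derivative bump (g x) * g') (at x)"
proof -
  have "(bump_int has_real_derivative bump s) (at s)" for s
    unfolding bump_int_def[abs_def] bump_def
    by (rule DERIV_max_cube[THEN DERIV_cong] derivative_eq_intros refl)+ (simp_all add: field_simps)
  then show ?thesis using DERIV_chain2 assms by blast
qed

lemma continuous_on_bump [continuous_intros]:
  "continuous_on S g \<Longrightarrow> continuous_on S (\<lambda>x. bump (g x))"
  unfolding bump_def by (intro continuous_intros) auto

lemma continuous_on_bump_deriv [continuous_intros]:
  "continuous_on S g \<Longrightarrow> continuous_on S (\<lambda>x. bump_deriv (g x))"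
  unfolding bump_deriv_def by (intro continuous_intros) auto

lemma continuous_on_bump_int [continuous_intros]:
  "continuous_on S g \<Longrightarrow> continuous_on S (\<lambda>x. bump_int (g x))"
  unfolding bump_int_def by (intro continuous_intros) auto

lemma bump_cases:
  "s \<le> -3 \<Longrightarrow> bump s = 0"
  "-3 \<le> s \<Longrightarrow> s \<le> -1 \<Longrightarrow> bump s = (s + 3)\<^sup>2 / 16"
  "-1 \<le> s \<Longrightarrow> s \<le> 1 \<Longrightarrow> bump s = (6 - 2 * s\<^sup>2) / 16"
  "1 \<le> s \<Longrightarrow> s \<le> 3 \<Longrightarrow> bump s = (3 - s)\<^sup>2 / 16"
  "3 \<le> s \<Longrightarrow> bump s = 0"
  by (auto simp: bump_def max_def power2_eq_square field_simps)

lemma bump_nonneg: "0 \<le> bump s" and bump_le_one: "bump s \<le> 1"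
proof -
  consider "s \<le> -3" | "-3 \<le> s" "s \<le> -1" | "-1 \<le> s" "s \<le> 1" | "1 \<le> s" "s \<le> 3" | "3 \<le> s"
    by linarith
  then have "0 \<le> bump s \<and> bump s \<le> 1"
  proof cases
    case 2
    have "(s + 3)\<^sup>2 \<le> 2\<^sup>2" using 2 by (intro power_mono) auto
    then show ?thesis using 2 by (simp add: bump_cases)
  next
    case 3
    have "s\<^sup>2 \<le> 1" using 3 by (simp add: abs_square_le_1)
    moreover have "0 \<le> s\<^sup>2" by simp
    ultimately have "0 \<le> 6 - 2 * s\<^sup>2" "6 - 2 * s\<^sup>2 \<le> 16" by linarith+
    then show ?thesis using bump_cases(3)[OF 3] by simp
  next
    case 4
    have "(3 - s)\<^sup>2 \<le> 2\<^sup>2" using 4 by (intro power_mono) auto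
    then show ?thesis using 4 by (simp add: bump_cases)
  qed (simp_all add: bump_cases)
  then show "0 \<le> bump s" "bump s \<le> 1" by auto
qed

lemma bump_eq_0: "3 \<le> \<bar>s\<bar> \<Longrightarrow> bump s = 0"
  by (cases "s \<ge> 0") (auto simp: bump_cases)

lemma bump_ge: "\<bar>s\<bar> \<le> 1 \<Longrightarrow> 1 / 4 \<le> bump s"
  using abs_square_le_1[of s] by (simp add: bump_cases abs_le_iff)

lemma bump_int_low: "s \<le> -3 \<Longrightarrow> bump_int s = 0"
  by (simp add: bump_int_def max_def)

lemma bump_int_high: "3 \<le> s \<Longrightarrow> bump_int s = 1"
  by (auto simp: bump_int_def max_def power3_eq_cube algebra_simps)

lemma bump_int_bounds: "0 \<le> bump_int s" "bump_int s \<le> 1"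
proof -
  have mono: "bump_int a \<le> bump_int b" if "a \<le> b" for a b
    using that by (rule DERIV_nonneg_imp_nondecreasing)
      (use DERIV_bump_int[OF DERIV_ident] bump_nonneg in fastforce)
  show "0 \<le> bump_int s" using mono[of "min s (-3)" s] bump_int_low[of "min s (-3)"] by simp
  show "bump_int s \<le> 1" using mono[of s "max s 3"] bump_int_high[of "max s 3"] by simp
qed

lemma abs_bump_deriv_le: "\<bar>bump_deriv s\<bar> \<le> 1"
  by (auto simp: bump_deriv_def max_def abs_le_iff)

lemma lipschitz_real:
  fixes g :: "real \<Rightarrow> real"
  assumes "convex S" "x \<in> S" "y \<in> S" "\<And>t. t \<in> S \<Longrightarrow> (g has_real_derivative g' t) (at t)"
    and "\<And>t. t \<in> S \<Longrightarrow> \<bar>g' t\<bar> \<le> B"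
  shows "\<bar>g x - g y\<bar> \<le> B * \<bar>x - y\<bar>"
proof -
  have "norm (g x - g y) \<le> B * norm (x - y)"
    by (rule field_differentiable_bound[OF assms(1) _ _ assms(2,3), where f' = g'])
      (use assms in \<open>auto intro: has_field_derivative_at_within\<close>)
  then show ?thesis by simp
qed

lemma bump_lipschitz: "\<bar>bump s - bump t\<bar> \<le> \<bar>s - t\<bar>"
  using lipschitz_real[of UNIV s t bump bump_deriv 1] DERIV_bump[OF DERIV_ident] abs_bump_deriv_le
  by auto

text \<open>One term of the telescoping sum over dyadic scales, built from the mass-one kernels
  \<open>bump (t / r) / r\<close>. Since the two masses agree, the antiderivative
  \<open>bump_diff_int\<close> also vanishes for \<open>\<bar>t\<bar> \<ge> 6 * r\<close>. It is
  bounded by 1 where \<open>bump_diff\<close> is bounded by \<open>1 / r\<close>, and this factor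
  \<open>r\<close> is what an integration by parts gains.\<close>

definition bump_diff :: "real \<Rightarrow> real \<Rightarrow> real" where
  "bump_diff r t = bump (t / r) / r - bump (t / (2 * r)) / (2 * r)"

definition bump_diff_int :: "real \<Rightarrow> real \<Rightarrow> real" where
  "bump_diff_int r t = bump_int (t / r) - bump_int (t / (2 * r))"

lemma DERIV_bump_diff_int [derivative_intros]:
  assumes "(g has_real_derivative g') (at x)" "r > 0"
  shows "((\<lambda>x. bump_diff_int r (g x)) has_real_derivative bump_diff r (g x) * g') (at x)"
proof -
  have "((\<lambda>x. bump_int (g x / r) - bump_int (g x / (2 * r))) has_real_derivative
      bump (g x / r) * (g' / r) - bump (g x / (2 * r)) * (g' / (2 * r))) (at x)"
    by (intro DERIV_diff DERIV_cdivide DERIV_bump_int assms)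
  then show ?thesis
    unfolding bump_diff_def bump_diff_int_def by (simp add: left_diff_distrib)
qed

definition bump_diff_deriv :: "real \<Rightarrow> real \<Rightarrow> real" where
  "bump_diff_deriv r t = bump_deriv (t / r) / r\<^sup>2 - bump_deriv (t / (2 * r)) / (2 * r)\<^sup>2"

lemma DERIV_bump_diff [derivative_intros]:
  assumes "(g has_real_derivative g') (at x)" "r > 0"
  shows "((\<lambda>x. bump_diff r (g x)) has_real_derivative bump_diff_deriv r (g x) * g') (at x)"
proof -
  have "((\<lambda>x. bump (g x / r) / r - bump (g x / (2 * r)) / (2 * r)) has_real_derivative
      bump_deriv (g x / r) * (g' / r) / r - bump_deriv (g x / (2 * r)) * (g' / (2 * r)) / (2 * r)) (at x)"
    by (intro DERIV_diff DERIV_cdivide DERIV_bump assms)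
  then show ?thesis
    unfolding bump_diff_def bump_diff_deriv_def by (simp add: power2_eq_square left_diff_distrib)
qed

lemma continuous_on_bump_diff [continuous_intros]:
  "r > 0 \<Longrightarrow> continuous_on S g \<Longrightarrow> continuous_on S (\<lambda>x. bump_diff r (g x))"
  "r > 0 \<Longrightarrow> continuous_on S g \<Longrightarrow> continuous_on S (\<lambda>x. bump_diff_deriv r (g x))"
  "r > 0 \<Longrightarrow> continuous_on S g \<Longrightarrow> continuous_on S (\<lambda>x. bump_diff_int r (g x))"
  unfolding bump_diff_def bump_diff_deriv_def bump_diff_int_def
  by (intro continuous_intros; simp)+

lemma bump_diff_eq_0: "r > 0 \<Longrightarrow> 6 * r \<le> \<bar>t\<bar> \<Longrightarrow> bump_diff r t = 0"
  by (simp add: bump_diff_def bump_eq_0 field_simps)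

lemma bump_diff_int_eq_0: 
  assumes "r > 0" "6 * r \<le> \<bar>t\<bar>" shows "bump_diff_int r t = 0"
proof (cases "t \<ge> 0")
  case True
  then show ?thesis using assms by (simp add: bump_diff_int_def bump_int_high field_simps)
next
  case False
  then show ?thesis using assms by (simp add: bump_diff_int_def bump_int_low field_simps)
qed

lemma abs_bump_diff_le: "r > 0 \<Longrightarrow> \<bar>bump_diff r t\<bar> \<le> 1 / r"
  using bump_nonneg[of "t / r"] bump_le_one[of "t / r"] bump_nonneg[of "t / (2 * r)"]
    bump_le_one[of "t / (2*r)"]
  by (auto simp: bump_diff_def abs_le_iff field_simps)

lemma abs_bump_diff_int_le: "\<bar>bump_diff_int r t\<bar> \<le> 1"
  using bump_int_bounds[of "t / r"] bump_int_bounds[of "t / (2 * r)"]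
  by (auto simp: bump_diff_int_def abs_le_iff)

lemma bump_diff_lipschitz: 
  assumes "r > 0" shows "\<bar>bump_diff r s - bump_diff r t\<bar> \<le> 2 / r\<^sup>2 * \<bar>s - t\<bar>"
proof -
  have "\<bar>bump_diff r s - bump_diff r t\<bar> \<le> \<bar>bump (s / r) - bump (t / r)\<bar> / r
      + \<bar>bump (s / (2 * r)) - bump (t / (2 * r))\<bar> / (2 * r)"
  proof -
    have "bump_diff r s - bump_diff r t = (bump (s / r) - bump (t / r)) / r
        - (bump (s / (2 * r)) - bump (t / (2 * r))) / (2 * r)"
      unfolding bump_diff_def diff_divide_distrib by simp
    then have "\<bar>bump_diff r s - bump_diff r t\<bar> \<le> \<bar>(bump (s / r) - bump (t / r)) / r\<bar>
        + \<bar>(bump (s / (2 * r)) - bump (t / (2 * r))) / (2 * r)\<bar>"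
      by (simp only: abs_triangle_ineq4)
    then show ?thesis using assms by (simp only: abs_divide abs_of_pos)
  qed
  also have "\<dots> \<le> \<bar>s / r - t / r\<bar> / r + \<bar>s / (2 * r) - t / (2 * r)\<bar> / (2 * r)"
    using assms by (intro add_mono divide_right_mono bump_lipschitz) auto
  also have "\<dots> = (1 + 1 / 4) / r\<^sup>2 * \<bar>s - t\<bar>"
    using assms by (simp add: diff_divide_distrib[symmetric] abs_divide power2_eq_square field_simps)
  also have "\<dots> \<le> 2 / r\<^sup>2 * \<bar>s - t\<bar>"
    by (intro mult_right_mono divide_right_mono) auto
  finally show ?thesis .
qed

section \<open>A nonstationary phase estimate in the plane\<close>

text \<open>Each partial derivative is integrated first in its own variable, where the fundamental
  theorem of calculus leaves only values on two opposite sides of the square, and these are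
  zero.\<close>

lemma integral_divergence_eq_0:
  fixes F G F' G' :: "real \<Rightarrow> real \<Rightarrow> real"
  assumes "a \<le> b"
    and F: "\<And>x y. x \<in> {a..b} \<Longrightarrow> y \<in> {a..b} \<Longrightarrow> ((\<lambda>x. F x y) has_real_derivative F' x y) (at x)"
    and G: "\<And>x y. x \<in> {a..b} \<Longrightarrow> y \<in> {a..b} \<Longrightarrow> ((\<lambda>y. G x y) has_real_derivative G' x y) (at y)"
    and cF: "continuous_on (cbox (a, a) (b, b)) (\<lambda>(x, y). F' x y)"
    and cG: "continuous_on (cbox (a, a) (b, b)) (\<lambda>(x, y). G' x y)"
    and F0: "\<And>y. F a y = 0" "\<And>y. F b y = 0" and G0: "\<And>x. G x a = 0" "\<And>x. G x b = 0"
  shows "integral (cbox (a, a) (b, b)) (\<lambda>(x, y). F' x y + G' x y) = 0"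
proof -
  have "integral {a..b} (\<lambda>x. F' x y) = 0" if "y \<in> {a..b}" for y
  proof -
    have "((\<lambda>x. F' x y) has_integral (F b y - F a y)) {a..b}"
      by (rule fundamental_theorem_of_calculus[OF \<open>a \<le> b\<close>])
        (use F that in \<open>auto simp: has_real_derivative_iff_has_vector_derivative[symmetric]
          intro: has_field_derivative_at_within\<close>)
    then show ?thesis using F0 by (simp add: integral_unique)
  qed
  then have 1: "integral (cbox (a, a) (b, b)) (\<lambda>(x, y). F' x y) = 0"
    using integral_prod_continuous[OF cF] integral_swap_continuous[OF cF]
      integral_cong[of "cbox a b" "\<lambda>y. integral (cbox a b) (\<lambda>x. F' x y)" "\<lambda>y. 0"]
    by simp
  have "integral {a..b} (\<lambda>y. G' x y) = 0" if "x \<in> {a..b}" for x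
  proof -
    have "((\<lambda>y. G' x y) has_integral (G x b - G x a)) {a..b}"
      by (rule fundamental_theorem_of_calculus[OF \<open>a \<le> b\<close>])
        (use G that in \<open>auto simp: has_real_derivative_iff_has_vector_derivative[symmetric]
          intro: has_field_derivative_at_within\<close>)
    then show ?thesis using G0 by (simp add: integral_unique)
  qed
  then have 2: "integral (cbox (a, a) (b, b)) (\<lambda>(x, y). G' x y) = 0"
    using integral_prod_continuous[OF cG]
      integral_cong[of "cbox a b" "\<lambda>x. integral (cbox a b) (\<lambda>y. G' x y)" "\<lambda>y. 0"]
    by simp
  have "integral (cbox (a, a) (b, b)) (\<lambda>p. (case p of (x, y) \<Rightarrow> F' x y) + (case p of (x, y) \<Rightarrow> G' x y)) = 0"
    using 1 2 integral_add[OF integrable_continuous[OF cF] integrable_continuous[OF cG]] by simp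
  then show ?thesis by (simp add: case_prod_unfold)
qed

text \<open>
  A continuously differentiable function which agrees with \<open>1 / s\<close> for \<open>\<bar>s\<bar> \<ge> 1\<close>.
\<close>

definition recip :: "real \<Rightarrow> real" where
  "recip s = s / (s\<^sup>2 + (max 0 (1 - s\<^sup>2))\<^sup>2)"

definition recip_deriv :: "real \<Rightarrow> real" where
  "recip_deriv s = ((s\<^sup>2 + (max 0 (1 - s\<^sup>2))\<^sup>2) - s * (2 * s - 4 * s * max 0 (1 - s\<^sup>2)))
     / (s\<^sup>2 + (max 0 (1 - s\<^sup>2))\<^sup>2)\<^sup>2"

text \<open>With \<open>z = s^2 \<le> 1\<close> the denominator is
  \<open>z + (1 - z)^2 = (z - 1 / 2)^2 + 3 / 4\<close>.\<close>

lemma recip_denominator_ge: "3 / 4 \<le> (s::real)\<^sup>2 + (max 0 (1 - s\<^sup>2))\<^sup>2"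
proof (cases "s\<^sup>2 \<le> 1")
  case True
  have "0 \<le> (s\<^sup>2 - 1 / 2)\<^sup>2" by simp
  then show ?thesis using True by (simp add: max_def power2_eq_square algebra_simps)
next
  case False
  have "0 \<le> (max 0 (1 - s\<^sup>2))\<^sup>2" by simp
  then show ?thesis using False by linarith
qed

lemma DERIV_recip:
  assumes "(g has_real_derivative d) (at x)"
  shows "((\<lambda>x. recip (g x)) has_real_derivative recip_deriv (g x) * d) (at x)"
proof -
  have nz: "s\<^sup>2 + (max 0 (1 - s\<^sup>2))\<^sup>2 \<noteq> 0" for s :: real
    using recip_denominator_ge[of s] by linarith
  have "(recip has_real_derivative recip_deriv s) (at s)" for s
  proof -
    have "((\<lambda>s. s\<^sup>2 + (max 0 (1 - s\<^sup>2))\<^sup>2) has_real_derivative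
        2 * s - 4 * s * max 0 (1 - s\<^sup>2)) (at s)"
      by (rule DERIV_max_square[THEN DERIV_cong] derivative_eq_intros refl)+ simp
    from DERIV_divide[OF DERIV_ident this nz] show ?thesis
      unfolding recip_def[abs_def] recip_deriv_def by (simp add: power2_eq_square)
  qed
  then show ?thesis using DERIV_chain2 assms by blast
qed

lemma continuous_on_recip_deriv:
  "continuous_on S g \<Longrightarrow> continuous_on S (\<lambda>x. recip_deriv (g x))"
proof -
  have nz: "s\<^sup>2 + (max 0 (1 - s\<^sup>2))\<^sup>2 \<noteq> 0" for s :: real
    using recip_denominator_ge[of s] by linarith
  show "continuous_on S g \<Longrightarrow> continuous_on S (\<lambda>x. recip_deriv (g x))"
    unfolding recip_deriv_def by (intro continuous_intros) (use nz in auto)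
qed

lemma continuous_on_recip:
  "continuous_on S g \<Longrightarrow> continuous_on S (\<lambda>x. recip (g x))"
proof -
  have nz: "s\<^sup>2 + (max 0 (1 - s\<^sup>2))\<^sup>2 \<noteq> 0" for s :: real
    using recip_denominator_ge[of s] by linarith
  show "continuous_on S g \<Longrightarrow> continuous_on S (\<lambda>x. recip (g x))"
    unfolding recip_def by (intro continuous_intros) (use nz in auto)
qed

lemma recip_mult: "1 \<le> \<bar>s\<bar> \<Longrightarrow> recip s * s = 1"
proof -
  assume "1 \<le> \<bar>s\<bar>"
  then have "1 \<le> s\<^sup>2" by (metis abs_ge_zero one_le_power power2_abs)
  then have "s \<noteq> 0" "max 0 (1 - s\<^sup>2) = 0" by auto
  then show ?thesis unfolding recip_def by (simp add: power2_eq_square)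
qed

lemma abs_recip_le: "\<bar>recip s\<bar> \<le> 2"
proof (cases "\<bar>s\<bar> \<le> 1")
  case True
  have "\<bar>s\<bar> \<le> 2 * (s\<^sup>2 + (max 0 (1 - s\<^sup>2))\<^sup>2)"
  proof -
    have "\<bar>s\<bar> \<le> 2 * N" if "3 / 4 \<le> N" for N :: real using True that by linarith
    then show ?thesis using recip_denominator_ge by blast
  qed
  moreover have "\<bar>s / N\<bar> \<le> 2" if "\<bar>s\<bar> \<le> 2 * N" "3 / 4 \<le> N" for N
    using that by (simp add: abs_divide divide_le_eq)
  ultimately show ?thesis using recip_denominator_ge[of s] unfolding recip_def by blast
next
  case False
  then have "\<bar>recip s\<bar> * \<bar>s\<bar> = 1" using recip_mult[of s] by (simp add: abs_mult[symmetric])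
  then have "\<bar>recip s\<bar> * 1 \<le> 1" 
    using mult_left_mono[of 1 "\<bar>s\<bar>" "\<bar>recip s\<bar>"] False by simp
  then show ?thesis by simp
qed

lemma abs_recip_deriv_le: "\<bar>recip_deriv s\<bar> \<le> 6"
proof -
  define z where "z = s\<^sup>2"
  define N where "N = z + (max 0 (1 - z))\<^sup>2"
  have N: "3 / 4 \<le> N" using recip_denominator_ge[of s] by (simp add: N_def z_def)
  have z: "0 \<le> z" by (simp add: z_def)
  have N2: "(3 / 4)\<^sup>2 \<le> N\<^sup>2" using N by (intro power_mono) auto
  have r: "recip_deriv s = (N - (2 * z - 4 * z * max 0 (1 - z))) / N\<^sup>2"
    by (simp add: recip_deriv_def N_def z_def power2_eq_square algebra_simps)
  have "\<bar>N - (2 * z - 4 * z * max 0 (1 - z))\<bar> \<le> 6 * N\<^sup>2"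
  proof (cases "z \<le> 1")
    case True
    have "N = 1 - z + z * z" using True by (simp add: N_def power2_eq_square algebra_simps)
    moreover have "z * z \<le> z" using True z by (simp add: mult_left_le)
    moreover have "(2 * z - 4 * z * max 0 (1 - z)) = 4 * (z * z) - 2 * z" 
      using True by (simp add: algebra_simps)
    moreover have "0 \<le> z * z" by simp
    moreover have "0 \<le> (z-1)*(z-1)" by simp
    then have "0 \<le> z * z - 2 * z + 1" by (simp add: algebra_simps)
    ultimately have "\<bar>N - (2 * z - 4 * z * max 0 (1 - z))\<bar> \<le> 3"
      using True z by (simp only: abs_le_iff) linarith
    then show ?thesis using N2 by (simp add: power2_eq_square)
  next
    case False
    then have "N = z" by (simp add: N_def)
    moreover have "z \<le> z * z" using False by simp
    ultimately show ?thesis using False by (simp add: power2_eq_square)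
  qed
  then show ?thesis using N N2 unfolding r
    by (simp add: abs_divide divide_le_eq)
qed

text \<open>The vector field \<open>(b' z, a' y)\<close> is divergence free and tangent to the level
  curves of \<open>a y - b z\<close>. Along it the first factor is constant, and
  \<open>p y - q z\<close> changes at the rate \<open>W = b' z * p' y - q' z * a' y\<close>. Hence
  the second factor is the derivative along the field of \<open>bump_diff_int r (p y - q z)\<close>,
  divided by \<open>W\<close>. Integrating by parts moves the derivative to the cutoff, which gives
  \<open>4 * L / w0\<close>, and to \<open>1 / W\<close>, which gives \<open>6 * G / w0^2\<close>;
  \<open>G\<close> bounds the derivative of \<open>W\<close> along the field.\<close>

lemma nonstationary_phase:
  fixes a b p q a' b' p' q' a'' b'' p'' q'' :: "real \<Rightarrow> real"
  assumes j: "j0 \<le> j1" "j1 - j0 \<le> 1" and r: "r > 0" and w0: "w0 > 0"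
    and d: "\<And>y. y \<in> {j0..j1} \<Longrightarrow> (a has_real_derivative a' y) (at y)"
      "\<And>y. y \<in> {j0..j1} \<Longrightarrow> (b has_real_derivative b' y) (at y)"
      "\<And>y. y \<in> {j0..j1} \<Longrightarrow> (p has_real_derivative p' y) (at y)"
      "\<And>y. y \<in> {j0..j1} \<Longrightarrow> (q has_real_derivative q' y) (at y)"
    and dd: "\<And>y. y \<in> {j0..j1} \<Longrightarrow> (a' has_real_derivative a'' y) (at y)"
      "\<And>y. y \<in> {j0..j1} \<Longrightarrow> (b' has_real_derivative b'' y) (at y)"
      "\<And>y. y \<in> {j0..j1} \<Longrightarrow> (p' has_real_derivative p'' y) (at y)"
      "\<And>y. y \<in> {j0..j1} \<Longrightarrow> (q' has_real_derivative q'' y) (at y)"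
    and c: "continuous_on {j0..j1} a''" "continuous_on {j0..j1} b''"
      "continuous_on {j0..j1} p''" "continuous_on {j0..j1} q''"
    and L: "\<And>y. y \<in> {j0..j1} \<Longrightarrow> \<bar>a' y\<bar> \<le> L" "\<And>y. y \<in> {j0..j1} \<Longrightarrow> \<bar>b' y\<bar> \<le> L"
    and W: "\<And>y z. y \<in> {j0..j1} \<Longrightarrow> z \<in> {j0..j1} \<Longrightarrow> \<bar>a y - b z\<bar> < 6 * r \<Longrightarrow> \<bar>p y - q z\<bar> < 6 * r
      \<Longrightarrow> w0 \<le> \<bar>b' z * p' y - q' z * a' y\<bar>"
    and G: "\<And>y z. y \<in> {j0..j1} \<Longrightarrow> z \<in> {j0..j1} \<Longrightarrow>
      \<bar>b' z * (b' z * p'' y - q' z * a'' y) + a' y * (b'' z * p' y - q'' z * a' y)\<bar> \<le> G"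
  shows "\<bar>integral (cbox (j0, j0) (j1, j1)) (\<lambda>(y, z). (y - j0) * (j1 - y) * ((z - j0) * (j1 - z)) *
        (bump_diff r (a y - b z) * bump_diff r (p y - q z)))\<bar>
      \<le> (4 * L / w0 + 6 * G / w0\<^sup>2) * integral (cbox (j0, j0) (j1, j1))
        (\<lambda>(y, z). \<bar>bump_diff r (a y - b z)\<bar> * \<bar>bump_diff_int r (p y - q z)\<bar>)"
proof -
  let ?Q = "cbox (j0, j0) (j1, j1)"
  define X where "X y = (y - j0) * (j1 - y)" for y
  define X' where "X' y = j0 + j1 - 2 * y" for y
  define W where "W y z = b' z * p' y - q' z * a' y" for y z
  define Wy where "Wy y z = b' z * p'' y - q' z * a'' y" for y z
  define Wz where "Wz y z = b'' z * p' y - q'' z * a' y" for y z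
  \<comment> \<open>The Jacobian is bounded below only where both factors can be nonzero, while
    \<open>F\<close> has to be differentiable on the whole square; so \<open>recip\<close> stands in
    for the reciprocal.\<close>
  define R where "R w = recip (w / w0) / w0" for w
  define R' where "R' w = recip_deriv (w / w0) / w0\<^sup>2" for w
  define F where "F y z = X y * X z * bump_diff r (a y - b z) * bump_diff_int r (p y - q z) * R (W y z)" for y z
  define Fy where "Fy y z = X' y * X z * bump_diff r (a y - b z) * bump_diff_int r (p y - q z) * R (W y z)
     + X y * X z * (bump_diff_deriv r (a y - b z) * a' y) * bump_diff_int r (p y - q z) * R (W y z)
     + X y * X z * bump_diff r (a y - b z) * (bump_diff r (p y - q z) * p' y) * R (W y z)
     + X y * X z * bump_diff r (a y - b z) * bump_diff_int r (p y - q z) * (R' (W y z) * Wy y z)" for y z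
  define Fz where "Fz y z = X y * X' z * bump_diff r (a y - b z) * bump_diff_int r (p y - q z) * R (W y z)
     + X y * X z * (bump_diff_deriv r (a y - b z) * (- b' z)) * bump_diff_int r (p y - q z) * R (W y z)
     + X y * X z * bump_diff r (a y - b z) * (bump_diff r (p y - q z) * (- q' z)) * R (W y z)
     + X y * X z * bump_diff r (a y - b z) * bump_diff_int r (p y - q z) * (R' (W y z) * Wz y z)" for y z
  define E where "E y z = bump_diff r (a y - b z) * bump_diff_int r (p y - q z) *
     ((b' z * (X' y * X z) + a' y * (X y * X' z)) * R (W y z)
       + X y * X z * (R' (W y z) * (b' z * Wy y z + a' y * Wz y z)))" for y z
  define U where "U y z = X y * X z * (bump_diff r (a y - b z) * bump_diff r (p y - q z))" for y z
  have DX: "(X has_real_derivative X' y) (at y)" for y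
    unfolding X_def[abs_def] X'_def by (auto intro!: derivative_eq_intros simp: algebra_simps)
  have DR: "((\<lambda>y. R (g y)) has_real_derivative R' (g y) * g') (at y)"
    if "(g has_real_derivative g') (at y)" for g g' y
  proof -
    have "((\<lambda>y. recip (g y / w0) / w0) has_real_derivative recip_deriv (g y / w0) * (g' / w0) / w0) (at y)"
      by (intro DERIV_cdivide DERIV_recip that)
    then show ?thesis unfolding R_def[abs_def] R'_def by (simp add: power2_eq_square)
  qed
  have DFy: "((\<lambda>y. F y z) has_real_derivative Fy y z) (at y)" if y: "y \<in> {j0..j1}" "z \<in> {j0..j1}" for y z
  proof -
    have DW: "((\<lambda>y. W y z) has_real_derivative Wy y z) (at y)"
      unfolding W_def Wy_def using dd[OF y(1)] by (auto intro!: derivative_eq_intros)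
    have 1: "((\<lambda>y. bump_diff r (a y - b z)) has_real_derivative bump_diff_deriv r (a y - b z) * a' y) (at y)"
      using d[OF y(1)] r by (auto intro!: derivative_eq_intros)
    have 2: "((\<lambda>y. bump_diff_int r (p y - q z)) has_real_derivative bump_diff r (p y - q z) * p' y) (at y)"
      using d[OF y(1)] r by (auto intro!: derivative_eq_intros)
    note DERIV_mult[OF DERIV_mult[OF DERIV_mult[OF DERIV_mult[OF DX[of y] DERIV_const[of "X z"]] 1] 2] DR[OF DW]]
    then show ?thesis unfolding F_def Fy_def by (rule DERIV_cong) (simp add: algebra_simps)
  qed
  have DFz: "((\<lambda>z. F y z) has_real_derivative Fz y z) (at z)" if y: "y \<in> {j0..j1}" "z \<in> {j0..j1}" for y z
  proof -
    have DW: "((\<lambda>z. W y z) has_real_derivative Wz y z) (at z)"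
      unfolding W_def Wz_def using dd[OF y(2)] by (auto intro!: derivative_eq_intros)
    have 1: "((\<lambda>z. bump_diff r (a y - b z)) has_real_derivative bump_diff_deriv r (a y - b z) * (- b' z)) (at z)"
      using d[OF y(2)] r by (auto intro!: derivative_eq_intros)
    have 2: "((\<lambda>z. bump_diff_int r (p y - q z)) has_real_derivative bump_diff r (p y - q z) * (- q' z)) (at z)"
      using d[OF y(2)] r by (auto intro!: derivative_eq_intros)
    note DERIV_mult[OF DERIV_mult[OF DERIV_mult[OF DERIV_mult[OF DERIV_const[of "X y"] DX[of z]] 1] 2] DR[OF DW]]
    then show ?thesis unfolding F_def Fz_def by (rule DERIV_cong) (simp add: algebra_simps)
  qed
  have ca: "continuous_on {j0..j1} h" if "\<And>y. y \<in> {j0..j1} \<Longrightarrow> (h has_real_derivative h' y) (at y)" for h h'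
    by (intro continuous_at_imp_continuous_on ballI DERIV_isCont[OF that])
  have C: "continuous_on ?Q (\<lambda>t. h (fst t))" "continuous_on ?Q (\<lambda>t. h (snd t))" 
    if "continuous_on {j0..j1} h" for h :: "real \<Rightarrow> real"
    by (rule continuous_on_compose2[OF that]; auto intro!: continuous_intros simp: cbox_Pair_eq)+
  have cc: "continuous_on {j0..j1} a" "continuous_on {j0..j1} b" "continuous_on {j0..j1} p"
    "continuous_on {j0..j1} q" "continuous_on {j0..j1} a'" "continuous_on {j0..j1} b'"
    "continuous_on {j0..j1} p'" "continuous_on {j0..j1} q'"
    by (rule ca, erule d dd)+
  note CC = cc[THEN C(1)] cc[THEN C(2)] c[THEN C(1)] c[THEN C(2)]
  have cX: "continuous_on S g \<Longrightarrow> continuous_on S (\<lambda>t. X (g t))" 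
       "continuous_on S g \<Longrightarrow> continuous_on S (\<lambda>t. X' (g t))" 
       "continuous_on S g \<Longrightarrow> continuous_on S (\<lambda>t. R (g t))"
       "continuous_on S g \<Longrightarrow> continuous_on S (\<lambda>t. R' (g t))" for g :: "real \<times> real \<Rightarrow> real" and S
    unfolding X_def X'_def R_def R'_def
    using w0 by (auto intro!: continuous_intros continuous_on_recip continuous_on_recip_deriv)
  have cW: "continuous_on ?Q (\<lambda>t. W (fst t) (snd t))" "continuous_on ?Q (\<lambda>t. Wy (fst t) (snd t))"
     "continuous_on ?Q (\<lambda>t. Wz (fst t) (snd t))"
    unfolding W_def Wy_def Wz_def 
    by (rule continuous_on_diff continuous_on_mult CC)+
  have cF: "continuous_on ?Q (\<lambda>(y, z). b' z * Fy y z)" "continuous_on ?Q (\<lambda>(y, z). a' y * Fz y z)"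
    unfolding Fy_def Fz_def case_prod_unfold by (intro continuous_intros CC cX cW r)+
  have cU: "continuous_on ?Q (\<lambda>(y, z). U y z)" and cE: "continuous_on ?Q (\<lambda>(y, z). E y z)"
    and cB: "continuous_on ?Q (\<lambda>(y, z). \<bar>bump_diff r (a y - b z)\<bar> * \<bar>bump_diff_int r (p y - q z)\<bar>)"
    unfolding U_def E_def case_prod_unfold by (intro continuous_intros CC cX cW r)+
  have "integral ?Q (\<lambda>(y, z). b' z * Fy y z + a' y * Fz y z) = 0"
  proof (rule integral_divergence_eq_0[OF j(1), where F = "\<lambda>y z. b' z * F y z" and G = "\<lambda>y z. a' y * F y z"])
    show "((\<lambda>y. b' z * F y z) has_real_derivative b' z * Fy y z) (at y)" if "y \<in> {j0..j1}" "z \<in> {j0..j1}" for y z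
      by (rule DERIV_cmult[OF DFy[OF that]])
    show "((\<lambda>z. a' y * F y z) has_real_derivative a' y * Fz y z) (at z)" if "y \<in> {j0..j1}" "z \<in> {j0..j1}" for y z
      by (rule DERIV_cmult[OF DFz[OF that]])
  qed (use cF in \<open>auto simp: F_def X_def\<close>)
  moreover have "b' z * Fy y z + a' y * Fz y z = E y z + U y z" if y: "y \<in> {j0..j1}" "z \<in> {j0..j1}" for y z
  proof -
    \<comment> \<open>The two terms with \<open>bump_diff_deriv\<close> cancel because the field is
      tangent to the level curves of \<open>a y - b z\<close>.\<close>
    have "b' z * Fy y z + a' y * Fz y z = E y z + U y z * (R (W y z) * W y z)"
      unfolding Fy_def Fz_def E_def U_def W_def by (simp only: algebra_simps)
    moreover have "U y z * (R (W y z) * W y z) = U y z"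
    proof (cases "\<bar>a y - b z\<bar> < 6 * r \<and> \<bar>p y - q z\<bar> < 6 * r")
      case True
      then have "w0 \<le> \<bar>W y z\<bar>" using W[OF y] by (simp add: W_def)
      then have "1 \<le> \<bar>W y z / w0\<bar>" using w0 by simp
      from recip_mult[OF this] show ?thesis using w0 by (simp add: R_def)
    next
      case False
      then have "U y z = 0" using bump_diff_eq_0[OF r] by (auto simp: U_def not_less)
      then show ?thesis by simp
    qed
    ultimately show ?thesis by simp
  qed
  ultimately have "integral ?Q (\<lambda>(y, z). E y z + U y z) = 0"
    using integral_cong[of ?Q "\<lambda>(y, z). b' z * Fy y z + a' y * Fz y z" "\<lambda>(y, z). E y z + U y z"]
    by (force simp: cbox_Pair_eq)
  then have "integral ?Q (\<lambda>(y, z). U y z) = - integral ?Q (\<lambda>(y, z). E y z)"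
    using integral_add[OF integrable_continuous[OF cE] integrable_continuous[OF cU]]
    by (simp add: case_prod_unfold)
  then have "\<bar>integral ?Q (\<lambda>(y, z). U y z)\<bar> = \<bar>integral ?Q (\<lambda>(y, z). E y z)\<bar>" by simp
  also have "\<dots> \<le> integral ?Q (\<lambda>t. (4 * L / w0 + 6 * G / w0\<^sup>2) *
     (case t of (y, z) \<Rightarrow> \<bar>bump_diff r (a y - b z)\<bar> * \<bar>bump_diff_int r (p y - q z)\<bar>))"
  proof (rule integral_norm_bound_integral[OF integrable_continuous[OF cE], unfolded real_norm_def])
    show "(\<lambda>t. (4 * L / w0 + 6 * G / w0\<^sup>2) *
     (case t of (y, z) \<Rightarrow> \<bar>bump_diff r (a y - b z)\<bar> * \<bar>bump_diff_int r (p y - q z)\<bar>)) integrable_on ?Q"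
      by (intro integrable_continuous continuous_intros cB)
    fix t assume "t \<in> ?Q"
    then obtain y z where t: "t = (y, z)" and y: "y \<in> {j0..j1}" "z \<in> {j0..j1}"
      by (cases t) (auto simp: cbox_Pair_eq)
    have X: "\<bar>X y\<bar> \<le> 1" "\<bar>X' y\<bar> \<le> 1" if "y \<in> {j0..j1}" for y
    proof -
      have "(y - j0) * (j1 - y) \<le> 1 * 1" using that j by (intro mult_mono) auto
      then show "\<bar>X y\<bar> \<le> 1" using that by (simp add: X_def)
      show "\<bar>X' y\<bar> \<le> 1" using that j by (auto simp: X'_def abs_le_iff)
    qed
    have L0: "0 \<le> L" using L(1)[OF y(1)] by linarith
    have 1: "\<bar>b' z * (X' y * X z) + a' y * (X y * X' z)\<bar> \<le> L * (1 * 1) + L * (1 * 1)"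
      by (rule order_trans[OF abs_triangle_ineq]) 
        (unfold abs_mult, intro add_mono mult_mono X L y; use L0 in auto)
    have 2: "\<bar>R (W y z)\<bar> \<le> 2 / w0" using abs_recip_le w0 by (simp add: R_def abs_divide divide_right_mono)
    have 3: "\<bar>R' (W y z)\<bar> \<le> 6 / w0\<^sup>2" using abs_recip_deriv_le w0 by (simp add: R'_def abs_divide divide_right_mono)
    have 4: "\<bar>b' z * Wy y z + a' y * Wz y z\<bar> \<le> G" using G[OF y] by (simp add: Wy_def Wz_def)
    have G0: "0 \<le> G" using 4 by linarith
    have "\<bar>(b' z * (X' y * X z) + a' y * (X y * X' z)) * R (W y z)
       + X y * X z * (R' (W y z) * (b' z * Wy y z + a' y * Wz y z))\<bar>
       \<le> (L * (1 * 1) + L * (1 * 1)) * (2 / w0) + 1 * 1 * (6 / w0\<^sup>2 * G)"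
      by (rule order_trans[OF abs_triangle_ineq]) 
        (unfold abs_mult[of "b' z * (X' y * X z) + a' y * (X y * X' z)"] abs_mult[of "X y * X z"]
          abs_mult[of "X y"] abs_mult[of "R' (W y z)"], intro add_mono mult_mono X 1 2 3 4 y; use L0 G0 w0 in auto)
    also have "\<dots> = 4 * L / w0 + 6 * G / w0\<^sup>2" by simp
    finally have 5: "\<bar>(b' z * (X' y * X z) + a' y * (X y * X' z)) * R (W y z)
       + X y * X z * (R' (W y z) * (b' z * Wy y z + a' y * Wz y z))\<bar> \<le> 4 * L / w0 + 6 * G / w0\<^sup>2" .
    have "\<bar>E y z\<bar> \<le> \<bar>bump_diff r (a y - b z)\<bar> * \<bar>bump_diff_int r (p y - q z)\<bar> * (4 * L / w0 + 6 * G / w0\<^sup>2)"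
      unfolding E_def abs_mult[of "bump_diff r (a y - b z) * bump_diff_int r (p y - q z)"]
        abs_mult[of "bump_diff r (a y - b z)"]
      by (intro mult_left_mono 5) auto
    then show "\<bar>case t of (y, z) \<Rightarrow> E y z\<bar> \<le> (4 * L / w0 + 6 * G / w0\<^sup>2) *
     (case t of (y, z) \<Rightarrow> \<bar>bump_diff r (a y - b z)\<bar> * \<bar>bump_diff_int r (p y - q z)\<bar>)"
      by (simp add: t mult.commute)
  qed
  finally show ?thesis by (simp add: U_def X_def)
qed

section \<open>Local webs\<close>

lemma MVT_lower:
  fixes g :: "real \<Rightarrow> real"
  assumes "x \<in> {a..b}" "x' \<in> {a..b}" "\<And>x. x \<in> {a..b} \<Longrightarrow> (g has_real_derivative g' x) (at x)"
    "\<And>x. x \<in> {a..b} \<Longrightarrow> c \<le> \<bar>g' x\<bar>"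
  shows "c * \<bar>x - x'\<bar> \<le> \<bar>g x - g x'\<bar>"
proof -
  have *: "c * \<bar>x - x'\<bar> \<le> \<bar>g x - g x'\<bar>" if "x < x'" "x \<in> {a..b}" "x' \<in> {a..b}" for x x'
  proof -
    have "\<exists>t>x. t < x' \<and> g x' - g x = (x' - x) * g' t"
      by (rule MVT2[OF \<open>x < x'\<close>]) (use assms(3) that in auto)
    then obtain t where "x < t" "t < x'" "g x' - g x = (x' - x) * g' t" by blast
    moreover from this have "c \<le> \<bar>g' t\<bar>" using that assms(4) by auto
    ultimately have "\<bar>g x - g x'\<bar> = \<bar>x - x'\<bar> * \<bar>g' t\<bar>" by (metis abs_minus_commute abs_mult)
    then show ?thesis using \<open>c \<le> \<bar>g' t\<bar>\<close> by (simp add: mult.commute mult_right_mono)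
  qed
  show ?thesis
    using *[of x x'] *[of x' x] assms(1,2) by (cases x x' rule: linorder_cases) (auto simp: abs_minus_commute)
qed

lemma segment_mem:
  fixes x z t :: real
  assumes "x \<in> {a..b}" "z \<in> {a..b}" "t \<in> {0..1}"
  shows "x + t * (z - x) \<in> {a..b}"
proof -
  have "x + t * (z - x) = (1 - t) *\<^sub>R x + t *\<^sub>R z" by (simp add: algebra_simps)
  also have "\<dots> \<in> {a..b}"
    using assms convexD_alt[OF convex_real_interval(5), of x a b z t] by simp
  finally show ?thesis .
qed

text \<open>
  A local form of the hypothesis: \<open>fxy / (fx * fy)\<close> is the reciprocal of \<open>rho f\<close>, and the assumption
  on the curvature says that it changes at a linear rate along the level curves of \<open>f\<close>, which is
  what \<open>kappa f \<noteq> 0\<close> means.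
\<close>

locale web =
  fixes f fx fy fxy fyy :: "real \<Rightarrow> real \<Rightarrow> real" and i0 i1 j0 j1 L :: real
  assumes L: "1 \<le> L" and j01: "j0 \<le> j1" "j1 - j0 \<le> 1" and i01: "2000 * L ^ 20 * (i1 - i0) \<le> 1"
    and Dfx: "\<And>x y. x \<in> {i0..i1} \<Longrightarrow> y \<in> {j0..j1} \<Longrightarrow> ((\<lambda>x. f x y) has_real_derivative fx x y) (at x)"
    and Dfy: "\<And>x y. x \<in> {i0..i1} \<Longrightarrow> y \<in> {j0..j1} \<Longrightarrow> (f x has_real_derivative fy x y) (at y)"
    and Dfyx: "\<And>x y. x \<in> {i0..i1} \<Longrightarrow> y \<in> {j0..j1} \<Longrightarrow> ((\<lambda>x. fy x y) has_real_derivative fxy x y) (at x)"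
    and Dfyy: "\<And>x y. x \<in> {i0..i1} \<Longrightarrow> y \<in> {j0..j1} \<Longrightarrow> (fy x has_real_derivative fyy x y) (at y)"
    and cont_fyy: "\<And>x. x \<in> {i0..i1} \<Longrightarrow> continuous_on {j0..j1} (fyy x)"
    and fx_ge: "\<And>x y. x \<in> {i0..i1} \<Longrightarrow> y \<in> {j0..j1} \<Longrightarrow> 1 / L \<le> \<bar>fx x y\<bar>"
    and fx_le: "\<And>x y. x \<in> {i0..i1} \<Longrightarrow> y \<in> {j0..j1} \<Longrightarrow> \<bar>fx x y\<bar> \<le> L"
    and fy_ge: "\<And>x y. x \<in> {i0..i1} \<Longrightarrow> y \<in> {j0..j1} \<Longrightarrow> 1 / L \<le> \<bar>fy x y\<bar>"
    and fy_le: "\<And>x y. x \<in> {i0..i1} \<Longrightarrow> y \<in> {j0..j1} \<Longrightarrow> \<bar>fy x y\<bar> \<le> L"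
    and fy_sign: "\<And>x y x' y'. x \<in> {i0..i1} \<Longrightarrow> y \<in> {j0..j1} \<Longrightarrow> x' \<in> {i0..i1} \<Longrightarrow> y' \<in> {j0..j1}
      \<Longrightarrow> 0 < fy x y * fy x' y'"
    and fxy_le: "\<And>x y. x \<in> {i0..i1} \<Longrightarrow> y \<in> {j0..j1} \<Longrightarrow> \<bar>fxy x y\<bar> \<le> L"
    and fyy_le: "\<And>x y. x \<in> {i0..i1} \<Longrightarrow> y \<in> {j0..j1} \<Longrightarrow> \<bar>fyy x y\<bar> \<le> L"
    and fx_lip: "\<And>x y x' y'. x \<in> {i0..i1} \<Longrightarrow> y \<in> {j0..j1} \<Longrightarrow> x' \<in> {i0..i1} \<Longrightarrow> y' \<in> {j0..j1}
      \<Longrightarrow> \<bar>fx x y - fx x' y'\<bar> \<le> L * (\<bar>x - x'\<bar> + \<bar>y - y'\<bar>)"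
    and fyy_lip: "\<And>x x' y. x \<in> {i0..i1} \<Longrightarrow> x' \<in> {i0..i1} \<Longrightarrow> y \<in> {j0..j1}
      \<Longrightarrow> \<bar>fyy x y - fyy x' y\<bar> \<le> L * \<bar>x - x'\<bar>"
    and eta_le: "\<And>x y. x \<in> {i0..i1} \<Longrightarrow> y \<in> {j0..j1} \<Longrightarrow> \<bar>fxy x y / (fx x y * fy x y)\<bar> \<le> L"
    and eta_lip: "\<And>x x' y. x \<in> {i0..i1} \<Longrightarrow> x' \<in> {i0..i1} \<Longrightarrow> y \<in> {j0..j1}
      \<Longrightarrow> \<bar>fxy x y / (fx x y * fy x y) - fxy x' y / (fx x' y * fy x' y)\<bar> \<le> L * \<bar>x - x'\<bar>"
    and curvature: "\<And>x y x' y'. x \<in> {i0..i1} \<Longrightarrow> y \<in> {j0..j1} \<Longrightarrow> x' \<in> {i0..i1} \<Longrightarrow> y' \<in> {j0..j1}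
      \<Longrightarrow> \<bar>f x y - f x' y'\<bar> \<le> \<bar>x - x'\<bar> / L
      \<Longrightarrow> \<bar>x - x'\<bar> / L \<le> \<bar>fxy x y / (fx x y * fy x y) - fxy x' y' / (fx x' y' * fy x' y')\<bar>"
begin

text \<open>The parameter interval has length at most \<open>1 / K\<close>, and \<open>K\<close> is
  also the loss in \<open>transversality\<close>. The numbers are generous: no power of
  \<open>L\<close> beyond the 16th has to be absorbed against the length of the interval.\<close>

definition "K = 2000 * L ^ 20"

lemma L_pos: "0 < L" using L by linarith

lemma L_power_le: "m \<le> n \<Longrightarrow> L ^ m \<le> L ^ n"
  using L by (simp add: power_increasing)

lemma K_ge: "2000 \<le> K"
  unfolding K_def using one_le_power[OF L, of 20] by simp

lemma f_x_upper:
  assumes "x \<in> {i0..i1}" "x' \<in> {i0..i1}" "y \<in> {j0..j1}"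
  shows "\<bar>f x y - f x' y\<bar> \<le> L * \<bar>x - x'\<bar>"
  using lipschitz_real[of "{i0..i1}" x x' "\<lambda>x. f x y" "\<lambda>x. fx x y" L] assms Dfx fx_le by auto

lemma f_y_upper:
  assumes "x \<in> {i0..i1}" "y' \<in> {j0..j1}" "y \<in> {j0..j1}"
  shows "\<bar>f x y - f x y'\<bar> \<le> L * \<bar>y - y'\<bar>"
  using lipschitz_real[of "{j0..j1}" y y' "f x" "fy x" L] assms Dfy fy_le by auto

lemma f_x_lower:
  assumes "x \<in> {i0..i1}" "x' \<in> {i0..i1}" "y \<in> {j0..j1}"
  shows "\<bar>x - x'\<bar> \<le> L * \<bar>f x y - f x' y\<bar>"
  using MVT_lower[of x i0 i1 x' "\<lambda>x. f x y" "\<lambda>x. fx x y" "1 / L"] assms Dfx fx_ge L_pos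
  by (auto simp: field_simps)

lemma f_y_lower:
  assumes "x \<in> {i0..i1}" "y' \<in> {j0..j1}" "y \<in> {j0..j1}"
  shows "\<bar>y - y'\<bar> \<le> L * \<bar>f x y - f x y'\<bar>"
  using MVT_lower[of y j0 j1 y' "f x" "fy x" "1 / L"] assms Dfy fy_ge L_pos
  by (auto simp: field_simps)

text \<open>
  Two curves \<open>{(y, y'). f x y = f x' y'}\<close> and \<open>{(y, y'). f z y = f z' y'}\<close> cross at an angle
  comparable to \<open>\<bar>x - x'\<bar> * \<bar>x - z\<bar>\<close>.  The mean value theorem is applied to the difference of
  the logarithms of \<open>fy\<close> along the segments from \<open>x\<close> to \<open>z\<close> and from \<open>x'\<close> to \<open>z'\<close>, corrected by
  a multiple of the difference of the values of \<open>f\<close>, which is of size \<open>R\<close> at both ends.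
\<close>

lemma transversality:
  assumes x: "x \<in> {i0..i1}" "x' \<in> {i0..i1}" "z \<in> {i0..i1}" "z' \<in> {i0..i1}"
    and y: "y \<in> {j0..j1}" "y' \<in> {j0..j1}"
    and u: "\<bar>f x y - f x' y'\<bar> \<le> R" and v: "\<bar>f z y - f z' y'\<bar> \<le> R"
    and R: "K * R \<le> \<bar>x - x'\<bar> * \<bar>x - z\<bar>"
  shows "\<bar>x - x'\<bar> * \<bar>x - z\<bar> / K \<le> \<bar>fy x' y' * fy z y - fy z' y' * fy x y\<bar>"
    and "\<bar>x' - z'\<bar> \<le> K * \<bar>x - z\<bar>"
proof -
  define a where "a = z - x"
  define b where "b = z' - x'"
  define D where "D = \<bar>a\<bar>"
  define d where "d = \<bar>x - x'\<bar>"
  define eta where "eta x y = fxy x y / (fx x y * fy x y)" for x y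
  have D: "\<bar>x - z\<bar> = D" by (simp add: D_def a_def)
  have R0: "0 \<le> R" using u by linarith
  have d0: "0 \<le> d" "0 \<le> D" by (auto simp: d_def D_def)
  have diam: "K * \<bar>s - t\<bar> \<le> 1" if "s \<in> {i0..i1}" "t \<in> {i0..i1}" for s t
  proof -
    have "K * \<bar>s - t\<bar> \<le> K * (i1 - i0)" using that K_ge by (intro mult_left_mono) auto
    then show ?thesis using i01 by (simp add: K_def)
  qed
  have d1: "d \<le> 1" using diam[OF x(1,2)] K_ge mult_right_mono[of 1 K d] d0 by (simp add: d_def)
  have Dn: "2000 * (L ^ n * D) \<le> 1" if "n \<le> 20" for n
  proof -
    have "2000 * (L ^ n * D) \<le> K * D"
      unfolding K_def using L_power_le[OF that] d0 by (simp add: mult_right_mono)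
    also have "\<dots> \<le> 1" using diam[OF x(1,3)] by (simp add: D)
    finally show ?thesis .
  qed
  have dDn: "2000 * (L ^ n * (d * D)) \<le> d" if "n \<le> 20" for n
    using mult_left_mono[OF Dn[OF that] d0(1)] by (simp add: algebra_simps)
  have Rn: "2000 * (L ^ n * R) \<le> d * D" if "n \<le> 20" for n
  proof -
    have "2000 * (L ^ n * R) \<le> K * R"
      unfolding K_def using L_power_le[OF that] R0 by (simp add: mult_right_mono)
    then show ?thesis using R D by (simp add: d_def)
  qed
  have dD: "d * D \<le> d" "d * D \<le> D" using dDn[of 0] d1 d0 mult_right_mono[of d 1 D] by auto
  have Lm: "s \<le> L ^ n * s" if "0 \<le> s" for s :: real and n
    using mult_right_mono[OF one_le_power[OF L, of n] that] by simp
  have LL: "L ^ m * s \<le> L ^ n * s" if "0 \<le> s" "m \<le> n" for s :: real and m n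
    using mult_right_mono[OF L_power_le[OF that(2)] that(1)] .

  have yy: "\<bar>y - y'\<bar> \<le> 2 * (L\<^sup>2 * d)"
  proof -
    have "\<bar>y - y'\<bar> \<le> L * \<bar>f x' y - f x' y'\<bar>" using f_y_lower[OF x(2) y(2,1)] .
    also have "\<dots> \<le> L * (R + L * d)"
      using f_x_upper[OF x(1,2) y(1)] u L_pos by (intro mult_left_mono) (auto simp: d_def)
    also have "\<dots> \<le> L * (L * d + L * d)"
      using Rn[of 0] dD Lm[OF d0(1), of 1] L_pos d0 R0 by (intro mult_left_mono) auto
    finally show ?thesis by (simp add: power2_eq_square algebra_simps)
  qed
  have zz: "\<bar>z - z'\<bar> \<le> 3 * (L ^ 4 * d)"
  proof -
    have "\<bar>z - z'\<bar> \<le> L * \<bar>f z y - f z' y\<bar>" using f_x_lower[OF x(3,4) y(1)] .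
    also have "\<dots> \<le> L * (R + L * \<bar>y - y'\<bar>)"
      using f_y_upper[OF x(4) y(2,1)] v L_pos by (intro mult_left_mono) auto
    also have "\<dots> \<le> L * (L ^ 3 * d + L * (2 * (L\<^sup>2 * d)))"
      using Rn[of 0] dD Lm[OF d0(1), of 3] yy L_pos d0 R0 by (intro mult_left_mono add_mono) auto
    finally show ?thesis by (simp add: power2_eq_square power_numeral_reduce algebra_simps)
  qed
  define X where "X t = x + t * a" for t
  define X' where "X' t = x' + t * b" for t
  have mem: "X t \<in> {i0..i1}" "X' t \<in> {i0..i1}" if "t \<in> {0..1}" for t
    using segment_mem[OF x(1,3) that] segment_mem[OF x(2,4) that] by (auto simp: X_def X'_def a_def b_def)
  have XX: "\<bar>X t - X' t\<bar> \<le> 3 * (L ^ 4 * d)" if t: "t \<in> {0..1}" for t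
  proof -
    have "X t - X' t = (1 - t) * (x - x') + t * (z - z')"
      by (simp add: X_def X'_def a_def b_def algebra_simps)
    then have "\<bar>X t - X' t\<bar> \<le> \<bar>(1 - t) * (x - x')\<bar> + \<bar>t * (z - z')\<bar>"
      by (simp only: abs_triangle_ineq)
    also have "\<dots> = (1 - t) * \<bar>x - x'\<bar> + t * \<bar>z - z'\<bar>" using t by (simp add: abs_mult)
    also have "\<dots> \<le> (1 - t) * (3 * (L ^ 4 * d)) + t * (3 * (L ^ 4 * d))"
      using t zz Lm[OF d0(1), of 4] d0 by (intro add_mono mult_left_mono) (auto simp: d_def)
    finally show ?thesis by (simp add: algebra_simps)
  qed
  define gx where "gx t = fx (X t) y" for t
  define gx' where "gx' t = fx (X' t) y'" for t
  have gx: "\<bar>gx t - gx' t\<bar> \<le> 5 * (L ^ 5 * d)" if t: "t \<in> {0..1}" for t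
  proof -
    have "\<bar>gx t - gx' t\<bar> \<le> L * (\<bar>X t - X' t\<bar> + \<bar>y - y'\<bar>)"
      unfolding gx_def gx'_def by (rule fx_lip[OF mem(1)[OF t] y(1) mem(2)[OF t] y(2)])
    also have "\<dots> \<le> L * (3 * (L ^ 4 * d) + 2 * (L ^ 4 * d))"
      using XX[OF t] yy LL[OF d0(1), of 2 4] L_pos by (intro mult_left_mono add_mono) auto
    finally show ?thesis by (simp add: power_numeral_reduce algebra_simps)
  qed
  define h where "h t = f (X t) y - f (X' t) y'" for t
  have DX: "(X has_real_derivative a) (at t)" "(X' has_real_derivative b) (at t)" for t
    unfolding X_def[abs_def] X'_def[abs_def] by (auto intro!: derivative_eq_intros)
  have Dh: "(h has_real_derivative gx t * a - gx' t * b) (at t)" if "t \<in> {0..1}" for t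
    unfolding h_def[abs_def] gx_def gx'_def
    by (intro DERIV_diff DERIV_chain2[OF Dfx DX(1)] DERIV_chain2[OF Dfx DX(2)] mem that y)
  have h01: "h 0 = f x y - f x' y'" "h 1 = f z y - f z' y'"
    by (auto simp: h_def X_def X'_def a_def b_def)
  \<comment> \<open>Both \<open>h 0\<close> and \<open>h 1\<close> are at most \<open>R\<close> in
    absolute value, so the derivative of \<open>h\<close> is small somewhere. As \<open>gx\<close>
    and \<open>gx'\<close> differ by only a multiple of \<open>d\<close>, the displacements
    \<open>a\<close> and \<open>b\<close> must agree up to a multiple of
    \<open>R + d * D\<close>.\<close>
  have "\<exists>t>0. t < 1 \<and> h 1 - h 0 = (1 - 0) * (gx t * a - gx' t * b)"
    by (rule MVT2) (use Dh in auto)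
  then obtain t0 where "0 < t0" "t0 < 1" "h 1 - h 0 = (1 - 0) * (gx t0 * a - gx' t0 * b)" by blast
  then have t0: "t0 \<in> {0..1}" "h 1 - h 0 = gx t0 * a - gx' t0 * b" by auto
  have gxL: "\<bar>gx' t\<bar> \<le> L" "1 \<le> L * \<bar>gx' t\<bar>" "1 \<le> L * \<bar>gx t\<bar>" if "t \<in> {0..1}" for t
    using fx_le[OF mem(2)[OF that] y(2)] fx_ge[OF mem(2)[OF that] y(2)] fx_ge[OF mem(1)[OF that] y(1)] L_pos
    by (auto simp: gx_def gx'_def field_simps)
  have ab: "\<bar>a - b\<bar> \<le> 2 * (L * R) + 5 * (L ^ 6 * (d * D))"
  proof -
    have "\<bar>gx' t0 * (a - b)\<bar> = \<bar>(h 1 - h 0) - (gx t0 - gx' t0) * a\<bar>"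
      unfolding t0(2) by (simp add: algebra_simps)
    also have "\<dots> \<le> \<bar>h 1\<bar> + \<bar>h 0\<bar> + \<bar>(gx t0 - gx' t0) * a\<bar>" by linarith
    also have "\<dots> \<le> R + R + 5 * (L ^ 5 * d) * D"
      unfolding abs_mult h01 using u v gx[OF t0(1)] d0 by (intro add_mono mult_mono) (auto simp: D_def)
    finally have 1: "\<bar>gx' t0 * (a - b)\<bar> \<le> 2 * R + 5 * (L ^ 5 * d) * D" by simp
    have "\<bar>a - b\<bar> \<le> L * \<bar>gx' t0\<bar> * \<bar>a - b\<bar>"
      using mult_right_mono[OF gxL(2)[OF t0(1)], of "\<bar>a - b\<bar>"] by simp
    also have "\<dots> = L * \<bar>gx' t0 * (a - b)\<bar>" by (simp add: abs_mult)
    also have "\<dots> \<le> L * (2 * R + 5 * (L ^ 5 * d) * D)"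
      using 1 L_pos by (intro mult_left_mono) auto
    finally show ?thesis by (simp add: power_numeral_reduce algebra_simps)
  qed
  have ab': "\<bar>a - b\<bar> \<le> d / 100" "\<bar>a - b\<bar> \<le> 6 * (L ^ 6 * D)"
  proof -
    have "L ^ 6 * (d * D) \<le> L ^ 6 * D" using dD L_pos by (intro mult_left_mono) auto
    then show "\<bar>a - b\<bar> \<le> 6 * (L ^ 6 * D)" using ab Rn[of 1] dD Lm[OF d0(2), of 6] by simp
    show "\<bar>a - b\<bar> \<le> d / 100" using ab Rn[of 1] dDn[of 6] dDn[of 0] d0 by simp
  qed
  then have b: "\<bar>b\<bar> \<le> 7 * (L ^ 6 * D)"
    using Lm[OF d0(2), of 6] by (simp add: D_def)
  have C: "\<bar>gx t * a - gx' t * b\<bar> \<le> 10 * (L ^ 7 * (d * D)) + 2 * (L\<^sup>2 * R)" if t: "t \<in> {0..1}" for t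
  proof -
    have "gx t * a - gx' t * b = (gx t - gx' t) * a + gx' t * (a - b)" by (simp add: algebra_simps)
    then have "\<bar>gx t * a - gx' t * b\<bar> \<le> \<bar>gx t - gx' t\<bar> * \<bar>a\<bar> + \<bar>gx' t\<bar> * \<bar>a - b\<bar>"
      by (metis abs_mult abs_triangle_ineq)
    also have "\<dots> \<le> 5 * (L ^ 5 * d) * D + L * (2 * (L * R) + 5 * (L ^ 6 * (d * D)))"
      using gx[OF t] ab gxL(1)[OF t] L_pos d0 by (intro add_mono mult_mono) (auto simp: D_def)
    also have "\<dots> = 5 * (L ^ 5 * (d * D)) + 2 * (L\<^sup>2 * R) + 5 * (L ^ 7 * (d * D))"
      by (simp add: power_numeral_reduce algebra_simps)
    also have "\<dots> \<le> 10 * (L ^ 7 * (d * D)) + 2 * (L\<^sup>2 * R)"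
      using LL[of "d * D" 5 7] mult_nonneg_nonneg[OF d0] by linarith
    finally show ?thesis .
  qed
  have ht: "\<bar>h t\<bar> \<le> 10 * (L ^ 7 * (d * D)) + 3 * (L\<^sup>2 * R)" if t: "t \<in> {0..1}" for t
  proof -
    have "\<bar>h t - h 0\<bar> \<le> (10 * (L ^ 7 * (d * D)) + 2 * (L\<^sup>2 * R)) * \<bar>t - 0\<bar>"
      by (rule lipschitz_real[of "{0..1}", OF _ t _ Dh C]) auto
    also have "\<dots> \<le> (10 * (L ^ 7 * (d * D)) + 2 * (L\<^sup>2 * R)) * 1"
      using t d0 R0 L_pos by (intro mult_left_mono) auto
    finally show ?thesis using u h01(1) Lm[OF R0, of 2] by simp
  qed
  \<comment> \<open>The hypothesis on the curvature is available all along the two segments: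
    \<open>a\<close> and \<open>b\<close> are so close that \<open>X t\<close> and
    \<open>X' t\<close> stay at distance at least \<open>d / 2\<close>, and
    \<open>\<bar>h t\<bar>\<close> is bounded through \<open>d * D\<close> and \<open>R\<close>,
    both small compared with \<open>d\<close>.\<close>
  have curv: "d / (2 * L) \<le> \<bar>eta (X t) y - eta (X' t) y'\<bar>" if t: "t \<in> {0..1}" for t
  proof -
    have 1: "d / 2 \<le> \<bar>X t - X' t\<bar>"
    proof -
      have "X t - X' t = (x - x') + t * (a - b)" by (simp add: X_def X'_def algebra_simps)
      then have "d \<le> \<bar>X t - X' t\<bar> + \<bar>t * (a - b)\<bar>" by (simp add: d_def)
      moreover have "\<bar>t * (a - b)\<bar> \<le> 1 * \<bar>a - b\<bar>"
        unfolding abs_mult using t by (intro mult_right_mono) auto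
      moreover have "d / 2 \<le> A" if "d \<le> A + B" "B \<le> 1 * C" "C \<le> d / 100" for A B C
        using that d0 by linarith
      ultimately show ?thesis using ab'(1) by blast
    qed
    have "L * \<bar>h t\<bar> \<le> L * (10 * (L ^ 7 * (d * D)) + 3 * (L\<^sup>2 * R))"
      using ht[OF t] L_pos by (intro mult_left_mono) auto
    also have "\<dots> = 10 * (L ^ 8 * (d * D)) + 3 * (L ^ 3 * R)"
      by (simp add: power_numeral_reduce algebra_simps)
    also have "\<dots> \<le> d / 2" using dDn[of 8] Rn[of 3] dD d0 by simp
    finally have "\<bar>h t\<bar> \<le> \<bar>X t - X' t\<bar> / L" using 1 L_pos by (simp add: field_simps)
    then have "\<bar>X t - X' t\<bar> / L \<le> \<bar>eta (X t) y - eta (X' t) y'\<bar>"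
      unfolding eta_def h_def by (rule curvature[OF mem(1)[OF t] y(1) mem(2)[OF t] y(2)])
    moreover have "d / (2 * L) \<le> \<bar>X t - X' t\<bar> / L" 
      using divide_right_mono[OF 1, of L] L_pos by (simp add: field_simps)
    ultimately show ?thesis by linarith
  qed
  define c where "c = eta x' y'"
  define p where "p t = fy (X t) y / fy x y" for t
  define p' where "p' t = fy (X' t) y' / fy x' y'" for t
  have nz: "fy s t \<noteq> 0" "fx s t \<noteq> 0" if "s \<in> {i0..i1}" "t \<in> {j0..j1}" for s t
    using fy_ge[OF that] fx_ge[OF that] L_pos by (auto simp: field_simps)
  have ppos: "0 < p t" "0 < p' t" if t: "t \<in> {0..1}" for t
    using fy_sign[OF mem(1)[OF t] y(1) x(1) y(1)] fy_sign[OF mem(2)[OF t] y(2) x(2) y(2)]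
    by (auto simp: p_def p'_def zero_less_mult_iff zero_less_divide_iff)
  have pge: "1 / L\<^sup>2 \<le> p t" "1 / L\<^sup>2 \<le> p' t" if t: "t \<in> {0..1}" for t
  proof -
    have *: "1 / L\<^sup>2 \<le> A / B" if "0 < A / B" "1 / L \<le> \<bar>A\<bar>" "\<bar>B\<bar> \<le> L" for A B :: real
    proof -
      have "\<bar>A\<bar> / \<bar>B\<bar> \<ge> (1 / L) / L" using that L_pos by (intro frac_le) auto
      moreover have "A / B = \<bar>A\<bar> / \<bar>B\<bar>" using that(1) by (metis abs_divide abs_of_pos)
      ultimately show ?thesis by (simp add: power2_eq_square)
    qed
    show "1 / L\<^sup>2 \<le> p t" "1 / L\<^sup>2 \<le> p' t"
      using ppos[OF t] fy_ge[OF mem(1)[OF t] y(1)] fy_ge[OF mem(2)[OF t] y(2)] fy_le[OF x(1) y(1)] fy_le[OF x(2) y(2)]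
      unfolding p_def p'_def by (blast intro: *)+
  qed
  \<comment> \<open>The derivative of the difference of logarithms is
    \<open>(eta - eta') * (gx t * a)\<close>, the main term, plus
    \<open>eta' * (gx t * a - gx' t * b)\<close>, where \<open>eta\<close> and \<open>eta'\<close>
    are taken at the moving points. Subtracting \<open>c * h t\<close> replaces the last coefficient
    by \<open>eta' - c\<close>, which is of size \<open>D\<close>, so this term becomes
    negligible.\<close>
  define H where "H t = (ln (p t) - ln (p' t)) - c * h t" for t
  define H' where "H' t = (eta (X t) y - eta (X' t) y') * (gx t * a) + (eta (X' t) y' - c) * (gx t * a - gx' t * b)" for t
  have DH: "(H has_real_derivative H' t) (at t)" if t: "t \<in> {0..1}" for t
  proof -
    have "(p has_real_derivative fxy (X t) y * a / fy x y) (at t)"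
      unfolding p_def[abs_def]
      by (intro DERIV_cdivide DERIV_chain2[OF Dfyx DX(1)] mem t y)
    moreover have "(p' has_real_derivative fxy (X' t) y' * b / fy x' y') (at t)"
      unfolding p'_def[abs_def]
      by (intro DERIV_cdivide DERIV_chain2[OF Dfyx DX(2)] mem t y)
    ultimately have "(H has_real_derivative
        (inverse (p t) * (fxy (X t) y * a / fy x y) - inverse (p' t) * (fxy (X' t) y' * b / fy x' y'))
        - c * (gx t * a - gx' t * b)) (at t)"
      unfolding H_def[abs_def]
      by (intro DERIV_diff DERIV_chain2[OF DERIV_ln] DERIV_cmult Dh t ppos)
    moreover have "inverse (p t) * (fxy (X t) y * a / fy x y) = eta (X t) y * gx t * a"
      "inverse (p' t) * (fxy (X' t) y' * b / fy x' y') = eta (X' t) y' * gx' t * b"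
      using nz[OF mem(1)[OF t] y(1)] nz[OF mem(2)[OF t] y(2)] nz[OF x(1) y(1)] nz[OF x(2) y(2)]
      by (auto simp: p_def p'_def eta_def gx_def gx'_def)
    ultimately show ?thesis unfolding H'_def by (simp add: algebra_simps)
  qed
  have "\<exists>t>0. t < 1 \<and> H 1 - H 0 = (1 - 0) * H' t"
    by (rule MVT2) (use DH in auto)
  then obtain t where "0 < t" "t < 1" "H 1 - H 0 = (1 - 0) * H' t" by blast
  then have t: "t \<in> {0..1}" "H 1 - H 0 = H' t" by auto
  have H0: "H 0 = - c * h 0" 
    using nz[OF x(1) y(1)] nz[OF x(2) y(2)] by (simp add: H_def p_def p'_def X_def X'_def)
  have cL: "\<bar>c\<bar> \<le> L" unfolding c_def eta_def by (rule eta_le[OF x(2) y(2)])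
  have c1: "\<bar>eta (X' t) y' - c\<bar> \<le> 7 * (L ^ 7 * D)"
  proof -
    have "\<bar>eta (X' t) y' - c\<bar> \<le> L * \<bar>X' t - x'\<bar>"
      unfolding c_def eta_def by (rule eta_lip[OF mem(2)[OF t(1)] x(2) y(2)])
    also have "\<bar>X' t - x'\<bar> \<le> 1 * \<bar>b\<bar>"
      using t(1) unfolding X'_def by (simp add: abs_mult mult_left_le_one_le)
    also have "L * (1 * \<bar>b\<bar>) \<le> L * (7 * (L ^ 6 * D))" using b L_pos by (intro mult_left_mono) auto
    finally show ?thesis using L_pos by (simp add: power_numeral_reduce algebra_simps)
  qed
  have "\<bar>(eta (X' t) y' - c) * (gx t * a - gx' t * b)\<bar> \<le> d * D / (20 * L\<^sup>2)"
  proof -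
    have "\<bar>(eta (X' t) y' - c) * (gx t * a - gx' t * b)\<bar> \<le> 7 * (L ^ 7 * D) * (10 * (L ^ 7 * (d * D)) + 2 * (L\<^sup>2 * R))"
      unfolding abs_mult using c1 C[OF t(1)] L_pos d0 by (intro mult_mono) auto
    also have "\<dots> \<le> 7 * (L ^ 7 * D) * (10 * (L ^ 7 * (d * D)) + L ^ 7 * (d * D))"
    proof -
      have "2 * (L\<^sup>2 * R) \<le> L ^ 7 * (d * D)"
        using Rn[of 2] Lm[of "d * D" 7] mult_nonneg_nonneg[OF d0] by linarith
      then show ?thesis using d0 L_pos by (intro mult_left_mono add_mono) auto
    qed
    finally have 1: "\<bar>(eta (X' t) y' - c) * (gx t * a - gx' t * b)\<bar> \<le> 77 * (L ^ 14 * D) * (d * D)"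
      by (simp add: power_numeral_reduce algebra_simps)
    have "L\<^sup>2 * \<bar>(eta (X' t) y' - c) * (gx t * a - gx' t * b)\<bar> \<le> L\<^sup>2 * (77 * (L ^ 14 * D) * (d * D))"
      using 1 by (intro mult_left_mono) auto
    also have "\<dots> = 77 * (L ^ 16 * D) * (d * D)" by (simp add: power_numeral_reduce algebra_simps)
    also have "\<dots> \<le> 1 / 20 * (d * D)" using Dn[of 16] d0 by (intro mult_right_mono) auto
    finally show ?thesis using L_pos by (simp add: field_simps)
  qed
  moreover have "d * D / (2 * L\<^sup>2) \<le> \<bar>(eta (X t) y - eta (X' t) y') * (gx t * a)\<bar>"
  proof -
    have "d / (2 * L) * (1 / L * D) \<le> \<bar>eta (X t) y - eta (X' t) y'\<bar> * (\<bar>gx t\<bar> * \<bar>a\<bar>)"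
      using curv[OF t(1)] gxL(3)[OF t(1)] L_pos d0
      by (intro mult_mono) (auto simp: D_def field_simps)
    then show ?thesis by (simp add: abs_mult power2_eq_square)
  qed
  ultimately have "d * D / (2 * L\<^sup>2) - d * D / (20 * L\<^sup>2) \<le> \<bar>H' t\<bar>"
    unfolding H'_def by linarith
  moreover have "\<bar>H' t\<bar> \<le> \<bar>ln (p 1) - ln (p' 1)\<bar> + \<bar>c * h 1\<bar> + \<bar>c * h 0\<bar>"
    unfolding t(2)[symmetric] H0 by (simp add: H_def)
  moreover have "\<bar>c * h 1\<bar> \<le> L * R" "\<bar>c * h 0\<bar> \<le> L * R"
    unfolding abs_mult h01 using cL u v L_pos by (auto intro!: mult_mono)
  moreover have "L * R \<le> d * D / (20 * L\<^sup>2)"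
  proof -
    have "20 * (L ^ 3 * R) \<le> d * D" using Rn[of 3] mult_nonneg_nonneg[OF d0] by linarith
    then show ?thesis using L_pos by (simp add: field_simps power_numeral_reduce)
  qed
  ultimately have ln: "d * D / (4 * L\<^sup>2) \<le> \<bar>ln (p 1) - ln (p' 1)\<bar>"
  proof -
    define A where "A = d * D / L\<^sup>2"
    have A: "d * D / (2 * L\<^sup>2) = A / 2" "d * D / (20 * L\<^sup>2) = A / 20" "d * D / (4 * L\<^sup>2) = A / 4" "0 \<le> A"
      using d0 by (auto simp: A_def)
    assume "d * D / (2 * L\<^sup>2) - d * D / (20 * L\<^sup>2) \<le> \<bar>H' t\<bar>"
      "\<bar>H' t\<bar> \<le> \<bar>ln (p 1) - ln (p' 1)\<bar> + \<bar>c * h 1\<bar> + \<bar>c * h 0\<bar>"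
      "\<bar>c * h 1\<bar> \<le> L * R" "\<bar>c * h 0\<bar> \<le> L * R" "L * R \<le> d * D / (20 * L\<^sup>2)"
    then show ?thesis unfolding A using A(4) by linarith
  qed
  have "\<bar>ln s - ln t\<bar> \<le> L\<^sup>2 * \<bar>s - t\<bar>" if "1 / L\<^sup>2 \<le> s" "1 / L\<^sup>2 \<le> t" for s t
  proof (rule lipschitz_real[of "{1 / L\<^sup>2..}"])
    fix t assume t: "t \<in> {1 / L\<^sup>2..}"
    have "0 < 1 / L\<^sup>2" using L_pos by simp
    then have "0 < t" by (rule less_le_trans) (use t in simp)
    then show "(ln has_real_derivative inverse t) (at t)" by (rule DERIV_ln)
    show "\<bar>inverse t\<bar> \<le> L\<^sup>2" using \<open>0 < t\<close> t L_pos by (simp add: field_simps)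
  qed (use that in auto)
  from this[OF pge(1) pge(2), of 1 1] ln have "d * D / (4 * L\<^sup>2) \<le> L\<^sup>2 * \<bar>p 1 - p' 1\<bar>" by simp
  then have pp: "d * D / (4 * L ^ 4) \<le> \<bar>p 1 - p' 1\<bar>" 
    using L_pos by (simp add: field_simps power_numeral_reduce)
  have "fy x' y' * fy z y - fy z' y' * fy x y = fy x y * fy x' y' * (p 1 - p' 1)"
    using nz[OF x(1) y(1)] nz[OF x(2) y(2)]
    by (simp add: p_def p'_def X_def X'_def a_def b_def field_simps)
  then have "\<bar>fy x' y' * fy z y - fy z' y' * fy x y\<bar> = \<bar>fy x y\<bar> * \<bar>fy x' y'\<bar> * \<bar>p 1 - p' 1\<bar>"
    by (simp add: abs_mult)
  also have "\<dots> \<ge> 1 / L * (1 / L) * (d * D / (4 * L ^ 4))"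
    using fy_ge[OF x(1) y(1)] fy_ge[OF x(2) y(2)] pp L_pos d0 by (intro mult_mono) auto
  also have "1 / L * (1 / L) * (d * D / (4 * L ^ 4)) = d * D / (4 * L ^ 6)"
    by (simp add: power_numeral_reduce)
  finally have W: "d * D / (4 * L ^ 6) \<le> \<bar>fy x' y' * fy z y - fy z' y' * fy x y\<bar>" .
  have K6: "4 * L ^ 6 \<le> K" "7 * L ^ 6 \<le> K"
    using L_power_le[of 6 20] one_le_power[OF L, of 20] by (auto simp: K_def)
  have "d * D / K \<le> d * D / (4 * L ^ 6)"
    using K6 d0 L_pos K_ge by (intro divide_left_mono) auto
  with W show "\<bar>x - x'\<bar> * \<bar>x - z\<bar> / K \<le> \<bar>fy x' y' * fy z y - fy z' y' * fy x y\<bar>"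
    unfolding D d_def by linarith
  have "\<bar>b\<bar> \<le> K * D" using b mult_right_mono[OF K6(2) d0(2)] by simp
  then show "\<bar>x' - z'\<bar> \<le> K * \<bar>x - z\<bar>" unfolding D by (simp add: b_def abs_minus_commute)
qed

section \<open>Kernels concentrated near the curves, and the decay of their correlations\<close>

abbreviation "Q \<equiv> cbox (j0, j0) (j1, j1) :: (real \<times> real) set"

text \<open>It vanishes on the boundary of the square, which removes the boundary terms in the
  integration by parts. The weight on the second variable will be kept away from the boundary, where
  \<open>chi\<close> has a positive lower bound.\<close>

definition "chi = (\<lambda>(y, y'). (y - j0) * (j1 - y) * ((y' - j0) * (j1 - y')))"

definition "psi r x x' = (\<lambda>(y, y'). bump_diff r (f x y - f x' y'))"

definition "theta r x x' = (\<lambda>(y, y'). bump_diff_int r (f x y - f x' y'))"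

lemma continuous_f: "x \<in> {i0..i1} \<Longrightarrow> continuous_on {j0..j1} (f x)"
  by (intro continuous_at_imp_continuous_on ballI DERIV_isCont[OF Dfy])

lemma continuous_level_difference:
  assumes "x \<in> {i0..i1}" "x' \<in> {i0..i1}"
  shows "continuous_on Q (\<lambda>t. f x (fst t) - f x' (snd t))"
  by (intro continuous_on_diff continuous_on_compose2[OF continuous_f[OF assms(1)]]
      continuous_on_compose2[OF continuous_f[OF assms(2)]] continuous_intros)
    (auto simp: cbox_Pair_eq)

lemma continuous_psi:
  assumes "x \<in> {i0..i1}" "x' \<in> {i0..i1}" "r > 0"
  shows "continuous_on Q (psi r x x')" "continuous_on Q (theta r x x')"
  using assms unfolding psi_def theta_def case_prod_unfold
  by (auto intro!: continuous_on_bump_diff continuous_level_difference)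

lemma continuous_chi: "continuous_on S chi"
  unfolding chi_def case_prod_unfold by (intro continuous_intros)

text \<open>The support radius of \<open>bump_diff\<close> makes \<open>6 * r\<close> the tolerance
  in \<open>transversality\<close>, and \<open>w0 = d * D / K\<close> bounds the Jacobian from
  below. Its derivative along the field is a combination of differences that vanish for
  \<open>z = x\<close>, \<open>z' = x'\<close>, hence \<open>G\<close> is a multiple of
  \<open>D\<close>. The error terms are \<open>4 * L / w0\<close>, of order
  \<open>1 / (d * D)\<close>, and \<open>6 * G / w0^2\<close>, of order
  \<open>1 / (d^2 * D)\<close>; as \<open>d \<le> 1\<close> they add up with
  \<open>28 = 4 + 24\<close>.\<close>

lemma kernel_far:
  assumes x: "x \<in> {i0..i1}" "x' \<in> {i0..i1}" "z \<in> {i0..i1}" "z' \<in> {i0..i1}"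
    and r: "r > 0" and far: "K * (6 * r) \<le> \<bar>x - x'\<bar> * \<bar>x - z\<bar>"
  shows "\<bar>integral Q (\<lambda>t. chi t * (psi r x x' t * psi r z z' t))\<bar>
    \<le> 28 * L ^ 3 * K ^ 3 / (\<bar>x - x'\<bar>\<^sup>2 * \<bar>x - z\<bar>) * integral Q (\<lambda>t. \<bar>psi r x x' t\<bar> * \<bar>theta r z z' t\<bar>)"
proof -
  define d where "d = \<bar>x - x'\<bar>"
  define D where "D = \<bar>x - z\<bar>"
  define w0 where "w0 = d * D / K"
  have K0: "0 < K" using K_ge by linarith
  have "0 < K * (6 * r)" using K0 r by simp
  then have "0 < d * D" using far unfolding d_def D_def by linarith
  then have dD: "0 < d" "0 < D" by (auto simp: zero_less_mult_iff d_def D_def)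
  then have w0: "0 < w0" using K0 by (simp add: w0_def)
  have "K * d \<le> K * (i1 - i0)" using x K0 by (intro mult_left_mono) (auto simp: d_def)
  then have "K * d \<le> 1" using i01 by (simp add: K_def)
  moreover have "2000 * d \<le> K * d" using K_ge dD by (intro mult_right_mono) auto
  ultimately have d1: "d \<le> 1" using dD by linarith
  have int: "0 \<le> integral Q (\<lambda>t. \<bar>psi r x x' t\<bar> * \<bar>theta r z z' t\<bar>)"
    by (intro integral_nonneg integrable_continuous continuous_intros continuous_psi x r) auto
  show ?thesis
  \<comment> \<open>If no point of the square is near both curves, the product vanishes identically.
    Otherwise a single common point already yields \<open>\<bar>x' - z'\<bar> \<le> K * D\<close>,
    and this is used to bound \<open>G\<close> on the whole square.\<close>
  proof (cases "\<exists>y\<in>{j0..j1}. \<exists>y'\<in>{j0..j1}. \<bar>f x y - f x' y'\<bar> < 6 * r \<and> \<bar>f z y - f z' y'\<bar> < 6 * r")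
    case False
    then have "chi t * (psi r x x' t * psi r z z' t) = 0" if "t \<in> Q" for t
      using that bump_diff_eq_0[OF r] by (cases t) (force simp: psi_def cbox_Pair_eq not_less)
    then have "integral Q (\<lambda>t. chi t * (psi r x x' t * psi r z z' t)) = 0"
      using integral_cong[of Q "\<lambda>t. chi t * (psi r x x' t * psi r z z' t)" "\<lambda>_. 0"] by simp
    then show ?thesis using int L_pos K0 by simp
  next
    case True
    have W: "w0 \<le> \<bar>fy x' y' * fy z y - fy z' y' * fy x y\<bar>" and b: "\<bar>x' - z'\<bar> \<le> K * D"
      if "y \<in> {j0..j1}" "y' \<in> {j0..j1}" "\<bar>f x y - f x' y'\<bar> < 6 * r" "\<bar>f z y - f z' y'\<bar> < 6 * r" for y y'
      using transversality[OF x that(1,2) less_imp_le[OF that(3)] less_imp_le[OF that(4)] far]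
      by (auto simp: w0_def d_def D_def)
    have b: "\<bar>x' - z'\<bar> \<le> K * D" using True b by blast
    define G where "G = 4 * L ^ 3 * K * D"
    have fy_lip: "\<bar>fy s y - fy t y\<bar> \<le> L * \<bar>s - t\<bar>" if "s \<in> {i0..i1}" "t \<in> {i0..i1}" "y \<in> {j0..j1}" for s t y
      by (rule lipschitz_real[of "{i0..i1}"]) (use that Dfyx fxy_le in auto)
    have G: "\<bar>fy x' y' * (fy x' y' * fyy z y - fy z' y' * fyy x y) + fy x y * (fyy x' y' * fy z y - fyy z' y' * fy x y)\<bar> \<le> G"
      if y: "y \<in> {j0..j1}" "y' \<in> {j0..j1}" for y y'
    proof -
      have *: "\<bar>A * B - A' * B'\<bar> \<le> L * (L * (K * D)) + L * (L * (K * D))"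
        if "\<bar>A\<bar> \<le> L" "\<bar>B - B'\<bar> \<le> L * (K * D)" "\<bar>A - A'\<bar> \<le> L * (K * D)" "\<bar>B'\<bar> \<le> L" for A B A' B'
      proof -
        have "A * B - A' * B' = A * (B - B') + B' * (A - A')" by (simp add: algebra_simps)
        then have "\<bar>A * B - A' * B'\<bar> \<le> \<bar>A\<bar> * \<bar>B - B'\<bar> + \<bar>B'\<bar> * \<bar>A - A'\<bar>"
          by (metis abs_mult abs_triangle_ineq)
        also have "\<dots> \<le> L * (L * (K * D)) + L * (L * (K * D))"
          using that L_pos by (intro add_mono mult_mono) auto
        finally show ?thesis .
      qed
      have KD: "D \<le> K * D" using mult_right_mono[of 1 K D] K_ge dD by simp
      have 0: "\<bar>B - B'\<bar> \<le> L * (K * D)" if "\<bar>B - B'\<bar> \<le> L * t" "t \<le> K * D" for B B' t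
        using mult_left_mono[OF that(2), of L] L_pos that(1) by linarith
      have D': "\<bar>z - x\<bar> \<le> K * D" using KD by (simp add: D_def abs_minus_commute)
      have 1: "\<bar>fy x' y' * fyy z y - fy z' y' * fyy x y\<bar> \<le> L * (L * (K * D)) + L * (L * (K * D))"
        by (rule *[OF fy_le[OF x(2) y(2)] 0[OF fyy_lip[OF x(3,1) y(1)] D'] 0[OF fy_lip[OF x(2,4) y(2)] b] fyy_le[OF x(1) y(1)]])
      have 2: "\<bar>fyy x' y' * fy z y - fyy z' y' * fy x y\<bar> \<le> L * (L * (K * D)) + L * (L * (K * D))"
        by (rule *[OF fyy_le[OF x(2) y(2)] 0[OF fy_lip[OF x(3,1) y(1)] D'] 0[OF fyy_lip[OF x(2,4) y(2)] b] fy_le[OF x(1) y(1)]])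
      have "\<bar>fy x' y' * (fy x' y' * fyy z y - fy z' y' * fyy x y)\<bar> + \<bar>fy x y * (fyy x' y' * fy z y - fyy z' y' * fy x y)\<bar>
         \<le> L * (L * (L * (K * D)) + L * (L * (K * D))) + L * (L * (L * (K * D)) + L * (L * (K * D)))"
        unfolding abs_mult[of "fy x' y'" "fy x' y' * fyy z y - fy z' y' * fyy x y"] 
          abs_mult[of "fy x y" "fyy x' y' * fy z y - fyy z' y' * fy x y"]
        by (intro add_mono mult_mono 1 2 fy_le x y) (use L_pos in auto)
      also have "\<dots> = G" by (simp add: G_def power3_eq_cube)
      finally show ?thesis by linarith
    qed
    have "\<bar>integral Q (\<lambda>(y, y'). (y - j0) * (j1 - y) * ((y' - j0) * (j1 - y')) *
        (bump_diff r (f x y - f x' y') * bump_diff r (f z y - f z' y')))\<bar>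
      \<le> (4 * L / w0 + 6 * G / w0\<^sup>2) * integral Q
        (\<lambda>(y, y'). \<bar>bump_diff r (f x y - f x' y')\<bar> * \<bar>bump_diff_int r (f z y - f z' y')\<bar>)"
      by (rule nonstationary_phase[OF j01 r w0 Dfy Dfy Dfy Dfy Dfyy Dfyy Dfyy Dfyy
            cont_fyy cont_fyy cont_fyy cont_fyy fy_le fy_le W G]; (rule x | assumption))
    then have "\<bar>integral Q (\<lambda>t. chi t * (psi r x x' t * psi r z z' t))\<bar>
       \<le> (4 * L / w0 + 6 * G / w0\<^sup>2) * integral Q (\<lambda>t. \<bar>psi r x x' t\<bar> * \<bar>theta r z z' t\<bar>)"
      by (simp add: chi_def psi_def theta_def case_prod_unfold)
    also have "\<dots> \<le> 28 * L ^ 3 * K ^ 3 / (d\<^sup>2 * D) * integral Q (\<lambda>t. \<bar>psi r x x' t\<bar> * \<bar>theta r z z' t\<bar>)"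
    proof (rule mult_right_mono[OF _ int])
      have "4 * L / w0 = 4 * L * K / (d * D)" by (simp add: w0_def)
      also have "\<dots> \<le> 4 * L ^ 3 * K ^ 3 / (d\<^sup>2 * D)"
      proof (rule frac_le)
        have "L * K \<le> L ^ 3 * K ^ 3"
          using L K_ge power_increasing[of 1 3 L] power_increasing[of 1 3 K] by (intro mult_mono) auto
        then show "4 * L * K \<le> 4 * L ^ 3 * K ^ 3" by simp
        show "d\<^sup>2 * D \<le> d * D" using dD d1 by (simp add: power2_eq_square mult_left_le_one_le)
      qed (use dD L_pos K0 in auto)
      finally have "4 * L / w0 \<le> 4 * L ^ 3 * K ^ 3 / (d\<^sup>2 * D)" .
      moreover have "6 * G / w0\<^sup>2 = 24 * L ^ 3 * K ^ 3 / (d\<^sup>2 * D)"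
        using dD K0 by (simp add: G_def w0_def power2_eq_square power3_eq_cube)
      ultimately have "4 * L / w0 + 6 * G / w0\<^sup>2
          \<le> 4 * L ^ 3 * K ^ 3 / (d\<^sup>2 * D) + 24 * L ^ 3 * K ^ 3 / (d\<^sup>2 * D)"
        by (intro add_mono) auto
      also have "\<dots> = 28 * L ^ 3 * K ^ 3 / (d\<^sup>2 * D)"
        by (simp add: add_divide_distrib[symmetric])
      finally show "4 * L / w0 + 6 * G / w0\<^sup>2 \<le> 28 * L ^ 3 * K ^ 3 / (d\<^sup>2 * D)" .
    qed
    finally show ?thesis unfolding d_def D_def .
  qed
qed

end

section \<open>Weights of positive dimension\<close>

text \<open>A finite weighted set that looks \<open>s\<close>-dimensional down to the resolution
  \<open>\<delta>\<close>. Below \<open>\<delta>\<close> nothing is required, so a single point may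
  carry weight up to \<open>C * \<delta> powr s\<close>.\<close>

definition frostman :: "real \<Rightarrow> real \<Rightarrow> real \<Rightarrow> real set \<Rightarrow> (real \<Rightarrow> real) \<Rightarrow> bool" where
  "frostman s C \<delta> X m \<longleftrightarrow> 0 < \<delta> \<and> \<delta> \<le> 1 \<and> finite X \<and> (\<forall>x\<in>X. 0 \<le> m x) \<and>
     (\<forall>t l. \<delta> \<le> l \<longrightarrow> (\<Sum>x\<in>{x \<in> X. \<bar>x - t\<bar> \<le> l}. m x) \<le> C * l powr s)"

lemma frostmanD:
  assumes "frostman s C \<delta> X m"
  shows "0 < \<delta>" "\<delta> \<le> 1" "finite X" "\<And>x. x \<in> X \<Longrightarrow> 0 \<le> m x"
    "\<And>t l. \<delta> \<le> l \<Longrightarrow> (\<Sum>x\<in>{x \<in> X. \<bar>x - t\<bar> \<le> l}. m x) \<le> C * l powr s"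
  using assms by (auto simp: frostman_def)

lemma frostman_constant_nonneg:
  assumes "frostman s C \<delta> X m" shows "0 \<le> C"
proof -
  have "0 \<le> (\<Sum>x\<in>{x \<in> X. \<bar>x - 0\<bar> \<le> 1}. m x)" using frostmanD(4)[OF assms] by (intro sum_nonneg) auto
  also have "\<dots> \<le> C * 1 powr s" using frostmanD(5)[OF assms frostmanD(2)[OF assms]] .
  finally show ?thesis by simp
qed

lemma frostman_sum_le:
  assumes F: "frostman s C \<delta> X m" and "S \<subseteq> X" "\<delta> \<le> l" "\<And>x y. x \<in> S \<Longrightarrow> y \<in> S \<Longrightarrow> \<bar>x - y\<bar> \<le> l"
  shows "(\<Sum>x\<in>S. m x) \<le> C * l powr s"
proof (cases "S = {}")
  case True
  then show ?thesis using frostman_constant_nonneg[OF F] by simp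
next
  case False
  then obtain t where t: "t \<in> S" by blast
  have "(\<Sum>x\<in>S. m x) \<le> (\<Sum>x\<in>{x \<in> X. \<bar>x - t\<bar> \<le> l}. m x)"
    using frostmanD[OF F] assms(2,4) t by (intro sum_mono2) auto
  also have "\<dots> \<le> C * l powr s" using frostmanD(5)[OF F assms(3)] .
  finally show ?thesis .
qed

lemma frostman_total_le:
  assumes F: "frostman s C \<delta> X m" and "X \<subseteq> {a..b}" "b - a \<le> 1"
  shows "(\<Sum>x\<in>X. m x) \<le> C"
proof -
  have "\<bar>x - y\<bar> \<le> 1" if "x \<in> X" "y \<in> X" for x y
    using assms(2) subsetD[OF assms(2) that(1)] subsetD[OF assms(2) that(2)] assms(3) by (simp add: abs_le_iff)
  then show ?thesis using frostman_sum_le[OF F order_refl frostmanD(2)[OF F]] by simp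
qed

text \<open>Decomposition into dyadic annuli around \<open>t\<close>: the points at distance about
  \<open>2 ^ j * D\<close> contribute at most a multiple of \<open>(2 ^ j * D) powr (s - g)\<close>,
  and these terms form a geometric series because \<open>s < g\<close>.\<close>

lemma frostman_negative_power_sum:
  assumes F: "frostman s C \<delta> X m" and "s < g" "0 \<le> g" and D: "\<delta> \<le> D"
  shows "(\<Sum>x\<in>{x \<in> X. D \<le> \<bar>x - t\<bar>}. m x * \<bar>x - t\<bar> powr (- g))
    \<le> C * (2 powr s / (1 - 2 powr (s - g))) * D powr (s - g)"
proof -
  let ?S = "{x \<in> X. D \<le> \<bar>x - t\<bar>}"
  note f = frostmanD[OF F]
  have D0: "0 < D" using f(1) D by linarith
  define k where "k x = nat \<lfloor>log 2 (\<bar>x - t\<bar> / D)\<rfloor>" for x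
  have k: "2 ^ k x * D \<le> \<bar>x - t\<bar>" "\<bar>x - t\<bar> \<le> 2 ^ Suc (k x) * D" if "x \<in> ?S" for x
  proof -
    have q: "1 \<le> \<bar>x - t\<bar> / D" using that D0 by simp
    then have l: "0 \<le> log 2 (\<bar>x - t\<bar> / D)" by simp
    then have fl: "real (k x) \<le> log 2 (\<bar>x - t\<bar> / D)" "log 2 (\<bar>x - t\<bar> / D) \<le> real (Suc (k x))"
      unfolding k_def by (auto simp: le_floor_iff) linarith+
    have "2 powr real (k x) \<le> \<bar>x - t\<bar> / D" "\<bar>x - t\<bar> / D \<le> 2 powr real (Suc (k x))"
      using fl q powr_le_cancel_iff[of 2] by (simp_all add: le_log_iff log_le_iff)
    then show "2 ^ k x * D \<le> \<bar>x - t\<bar>" "\<bar>x - t\<bar> \<le> 2 ^ Suc (k x) * D"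
      using D0 by (auto simp: powr_realpow pos_le_divide_eq pos_divide_le_eq simp del: power_Suc of_nat_Suc)
  qed
  have fin: "finite ?S" using f(3) by simp
  obtain N where N: "\<And>x. x \<in> ?S \<Longrightarrow> k x < N"
    using finite_nat_bounded[of "k ` ?S"] fin by (auto simp: subset_eq)
  have "(\<Sum>x\<in>?S. m x * \<bar>x - t\<bar> powr (- g)) = (\<Sum>j<N. \<Sum>x\<in>{x \<in> ?S. k x = j}. m x * \<bar>x - t\<bar> powr (- g))"
    by (rule sum.group[symmetric]) (use fin N in auto)
  also have "\<dots> \<le> (\<Sum>j<N. C * (2 powr s) * D powr (s - g) * (2 powr (s - g)) ^ j)"
  proof (rule sum_mono)
    fix j
    have pj: "0 < 2 ^ j * D" using D0 by simp
    have "(\<Sum>x\<in>{x \<in> ?S. k x = j}. m x * \<bar>x - t\<bar> powr (- g))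
      \<le> (\<Sum>x\<in>{x \<in> ?S. k x = j}. m x * (2 ^ j * D) powr (- g))"
    proof (intro sum_mono mult_left_mono)
      fix x assume x: "x \<in> {x \<in> ?S. k x = j}"
      then have "2 ^ j * D \<le> \<bar>x - t\<bar>" using k(1)[of x] by auto
      then show "\<bar>x - t\<bar> powr (- g) \<le> (2 ^ j * D) powr (- g)"
        using \<open>0 \<le> g\<close> pj by (intro powr_mono2') auto
    qed (use f in auto)
    also have "\<dots> = (\<Sum>x\<in>{x \<in> ?S. k x = j}. m x) * (2 ^ j * D) powr (- g)"
      by (simp add: sum_distrib_right)
    also have "\<dots> \<le> (C * (2 ^ Suc j * D) powr s) * (2 ^ j * D) powr (- g)"
    proof (rule mult_right_mono)
      have "(\<Sum>x\<in>{x \<in> ?S. k x = j}. m x) \<le> (\<Sum>x\<in>{x \<in> X. \<bar>x - t\<bar> \<le> 2 ^ Suc j * D}. m x)"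
        using f k(2) by (intro sum_mono2) auto
      also have "\<delta> \<le> 2 ^ Suc j * D"
      proof -
        have "1 * D \<le> 2 ^ Suc j * D" using D0 one_le_power[of "2::real" "Suc j"] by (intro mult_right_mono) auto
        then show ?thesis using D by linarith
      qed
      then have "(\<Sum>x\<in>{x \<in> X. \<bar>x - t\<bar> \<le> 2 ^ Suc j * D}. m x) \<le> C * (2 ^ Suc j * D) powr s"
        by (rule f(5))
      finally show "(\<Sum>x\<in>{x \<in> ?S. k x = j}. m x) \<le> C * (2 ^ Suc j * D) powr s" .
    qed simp
    also have "\<dots> = C * (2 powr s) * D powr (s - g) * (2 powr (s - g)) ^ j"
    proof -
      have 1: "(2 ^ Suc j * D) powr s = 2 powr s * (2 ^ j * D) powr s"
        using D0 by (simp add: powr_mult)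
      have 2: "(2 ^ j * D) powr s * (2 ^ j * D) powr (- g) = (2 ^ j * D) powr (s - g)"
        by (simp add: powr_add[symmetric])
      have 3: "(2 ^ j * D) powr (s - g) = (2 powr (s - g)) ^ j * D powr (s - g)"
        using D0 by (simp add: powr_mult powr_realpow[symmetric] powr_powr mult.commute)
      show ?thesis unfolding 1 using 2 3 by (simp add: algebra_simps)
    qed
    finally show "(\<Sum>x\<in>{x \<in> ?S. k x = j}. m x * \<bar>x - t\<bar> powr (- g)) 
      \<le> C * (2 powr s) * D powr (s - g) * (2 powr (s - g)) ^ j" .
  qed
  also have "\<dots> = C * (2 powr s) * D powr (s - g) * (\<Sum>j<N. (2 powr (s - g)) ^ j)"
    by (simp add: sum_distrib_left)
  also have "\<dots> \<le> C * (2 powr s) * D powr (s - g) * (1 / (1 - 2 powr (s - g)))"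
  proof (rule mult_left_mono)
    have q: "2 powr (s - g) < 1" using \<open>s < g\<close> powr_less_mono[of "s - g" 0 2] by simp
    have "(\<Sum>j<N. (2 powr (s - g)) ^ j) = (1 - (2 powr (s - g)) ^ N) / (1 - 2 powr (s - g))"
      using q by (subst sum_gp_strict) auto
    also have "\<dots> \<le> 1 / (1 - 2 powr (s - g))" using q by (intro divide_right_mono) auto
    finally show "(\<Sum>j<N. (2 powr (s - g)) ^ j) \<le> 1 / (1 - 2 powr (s - g))" .
  qed (use frostman_constant_nonneg[OF F] in simp)
  finally show ?thesis by (simp add: algebra_simps)
qed

lemma integral_peak:
  fixes h :: "real \<Rightarrow> real"
  assumes c: "continuous_on {a..b} h" and M: "\<And>y. y \<in> {a..b} \<Longrightarrow> h y \<le> M" and "0 \<le> M" "0 \<le> l"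
    and l: "\<And>y z. y \<in> {a..b} \<Longrightarrow> z \<in> {a..b} \<Longrightarrow> h y \<noteq> 0 \<Longrightarrow> h z \<noteq> 0 \<Longrightarrow> \<bar>y - z\<bar> \<le> l"
  shows "integral {a..b} h \<le> 2 * M * l"
proof (cases "\<exists>y\<in>{a..b}. h y \<noteq> 0")
  case False
  then have "integral {a..b} h = 0" using integral_cong[of "{a..b}" h "\<lambda>_. 0"] by simp
  then show ?thesis using assms by simp
next
  case True
  then obtain y where y: "y \<in> {a..b}" "h y \<noteq> 0" by blast
  have "integral {a..b} h \<le> integral {a..b} (\<lambda>z. if z \<in> {y - l..y + l} then M else 0)"
  proof (rule integral_le)
    show "h integrable_on {a..b}" using c by (rule integrable_continuous_interval)
    have "(\<lambda>z. if z \<in> {y - l..y + l} then M else 0) integrable_on {a..b} \<longleftrightarrow>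
       (\<lambda>z. M) integrable_on ({y - l..y + l} \<inter> {a..b})"
      by (rule integrable_restrict_Int)
    also have "{y - l..y + l} \<inter> {a..b} = {max (y - l) a..min (y + l) b}" by auto
    finally show "(\<lambda>z. if z \<in> {y - l..y + l} then M else 0) integrable_on {a..b}"
      using integrable_continuous_interval[OF continuous_on_const] by blast
    show "h z \<le> (if z \<in> {y - l..y + l} then M else 0)" if "z \<in> {a..b}" for z
      using M[OF that] l[OF y(1) that y(2)] by (cases "h z = 0") (auto simp: \<open>0 \<le> M\<close> abs_le_iff)
  qed
  also have "\<dots> = integral ({y - l..y + l} \<inter> {a..b}) (\<lambda>_. M)"
    using integral_restrict_Int[of "{a..b}" "{y - l..y + l}" "\<lambda>_. M"] by (simp add: Int_commute)
  also have "{y - l..y + l} \<inter> {a..b} = {max (y - l) a..min (y + l) b}" by auto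
  also have "integral {max (y - l) a..min (y + l) b} (\<lambda>_. M) = M * measure lborel {max (y - l) a..min (y + l) b}"
    by simp
  also have "\<dots> \<le> M * (2 * l)"
    using \<open>0 \<le> M\<close> \<open>0 \<le> l\<close> by (intro mult_left_mono) auto
  finally show ?thesis by (simp add: mult_ac)
qed

lemma abs_integral_le:
  fixes h :: "'a::euclidean_space \<Rightarrow> real"
  assumes "h integrable_on S" "g integrable_on S" "\<And>t. t \<in> S \<Longrightarrow> \<bar>h t\<bar> \<le> g t"
  shows "\<bar>integral S h\<bar> \<le> integral S g"
  using integral_norm_bound_integral[of h S g] assms by simp

section \<open>Slices of the weights and the total correlation with a fixed kernel\<close>

context web
begin

lemma slice_y:
  assumes F: "frostman s C \<delta> Y n" and Y: "Y \<subseteq> {j0..j1}" and x: "x \<in> {i0..i1}" and R: "\<delta> \<le> 2 * L * R"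
  shows "(\<Sum>y\<in>{y \<in> Y. \<bar>f x y - t\<bar> \<le> R}. n y) \<le> C * (2 * L * R) powr s"
proof (rule frostman_sum_le[OF F _ R])
  fix y z assume yz: "y \<in> {y \<in> Y. \<bar>f x y - t\<bar> \<le> R}" "z \<in> {y \<in> Y. \<bar>f x y - t\<bar> \<le> R}"
  then have "\<bar>y - z\<bar> \<le> L * \<bar>f x y - f x z\<bar>" using Y x by (intro f_y_lower) auto
  also have "\<dots> \<le> L * (2 * R)" using yz L_pos by (intro mult_left_mono) auto
  finally show "\<bar>y - z\<bar> \<le> 2 * L * R" by simp
qed auto

lemma slice_x:
  assumes F: "frostman s C \<delta> X m" and X: "X \<subseteq> {i0..i1}" and y: "y \<in> {j0..j1}" and R: "\<delta> \<le> 2 * L * R"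
  shows "(\<Sum>x\<in>{x \<in> X. \<bar>f x y - t\<bar> \<le> R}. m x) \<le> C * (2 * L * R) powr s"
proof (rule frostman_sum_le[OF F _ R])
  fix x z assume xz: "x \<in> {x \<in> X. \<bar>f x y - t\<bar> \<le> R}" "z \<in> {x \<in> X. \<bar>f x y - t\<bar> \<le> R}"
  then have "\<bar>x - z\<bar> \<le> L * \<bar>f x y - f z y\<bar>" using X y by (intro f_x_lower) auto
  also have "\<dots> \<le> L * (2 * R)" using xz L_pos by (intro mult_left_mono) auto
  finally show "\<bar>x - z\<bar> \<le> 2 * L * R" by simp
qed auto

lemma slice_sum_le:
  assumes F: "frostman s C \<delta> X m" and X: "X \<subseteq> {i0..i1}" and y: "y \<in> {j0..j1}" and r: "\<delta> \<le> r"
    and g: "\<And>t. \<bar>g t\<bar> \<le> M" "\<And>t. 6 * r \<le> \<bar>t\<bar> \<Longrightarrow> g t = 0"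
  shows "(\<Sum>x\<in>X. m x * \<bar>g (t - f x y)\<bar>) \<le> M * (C * (12 * L * r) powr s)"
proof -
  note f = frostmanD[OF F]
  have M: "0 \<le> M" using g(1)[of 0] by linarith
  have "(\<Sum>x\<in>X. m x * \<bar>g (t - f x y)\<bar>) = (\<Sum>x\<in>{x \<in> X. \<bar>f x y - t\<bar> \<le> 6 * r}. m x * \<bar>g (t - f x y)\<bar>)"
  proof (intro sum.mono_neutral_right ballI)
    fix x assume "x \<in> X - {x \<in> X. \<bar>f x y - t\<bar> \<le> 6 * r}"
    then have "6 * r \<le> \<bar>t - f x y\<bar>" by auto
    then show "m x * \<bar>g (t - f x y)\<bar> = 0" using g(2) by simp
  qed (use f(3) in auto)
  also have "\<dots> \<le> (\<Sum>x\<in>{x \<in> X. \<bar>f x y - t\<bar> \<le> 6 * r}. m x * M)"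
    using f(4) g(1) by (intro sum_mono mult_left_mono) auto
  also have "\<dots> = M * (\<Sum>x\<in>{x \<in> X. \<bar>f x y - t\<bar> \<le> 6 * r}. m x)"
    by (simp add: sum_distrib_left mult.commute)
  also have "\<dots> \<le> M * (C * (2 * L * (6 * r)) powr s)"
  proof (rule mult_left_mono[OF slice_x[OF F X y] M])
    have "1 * r \<le> L * r" using L f(1) r by (intro mult_right_mono) auto
    then have "\<delta> \<le> 12 * (L * r)" using r f(1) by linarith
    then show "\<delta> \<le> 2 * L * (6 * r)" by simp
  qed
  finally show ?thesis by (simp add: mult_ac)
qed

text \<open>For each \<open>y\<close> the points \<open>y'\<close> with nonzero kernel span at most
  \<open>12 * L * r\<close>, while the kernel is at most \<open>1 / r\<close>; the powers of
  \<open>r\<close> cancel.\<close>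

lemma integral_psi_le:
  assumes x: "x \<in> {i0..i1}" "x' \<in> {i0..i1}" and r: "r > 0"
  shows "integral Q (\<lambda>t. \<bar>psi r x x' t\<bar>) \<le> 24 * L"
proof -
  let ?h = "\<lambda>t. \<bar>psi r x x' t\<bar>"
  have c: "continuous_on Q ?h" by (intro continuous_intros continuous_psi x r)
  have inner: "integral (cbox j0 j1) (\<lambda>y'. ?h (y, y')) \<le> 24 * L" if y: "y \<in> {j0..j1}" for y
  proof -
    have "integral {j0..j1} (\<lambda>y'. ?h (y, y')) \<le> 2 * (1 / r) * (12 * L * r)"
    proof (rule integral_peak)
      show "continuous_on {j0..j1} (\<lambda>y'. ?h (y, y'))"
        by (rule continuous_on_compose2[OF c]) (use y in \<open>auto simp: cbox_Pair_eq intro!: continuous_intros\<close>)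
      show "?h (y, y') \<le> 1 / r" for y' using abs_bump_diff_le[OF r] by (simp add: psi_def)
      fix z w assume zw: "z \<in> {j0..j1}" "w \<in> {j0..j1}" "?h (y, z) \<noteq> 0" "?h (y, w) \<noteq> 0"
      then have "\<bar>f x y - f x' z\<bar> < 6 * r" "\<bar>f x y - f x' w\<bar> < 6 * r"
        using bump_diff_eq_0[OF r] by (fastforce simp: psi_def not_le[symmetric])+
      then have "\<bar>f x' z - f x' w\<bar> \<le> 12 * r" by linarith
      then have "L * \<bar>f x' z - f x' w\<bar> \<le> L * (12 * r)" using L_pos by (intro mult_left_mono) auto
      then show "\<bar>z - w\<bar> \<le> 12 * L * r" using f_y_lower[OF x(2) zw(2,1)] by simp
    qed (use r L_pos in auto)
    then show ?thesis using r by simp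
  qed
  have "integral Q ?h = integral (cbox j0 j1) (\<lambda>y. integral (cbox j0 j1) (\<lambda>y'. ?h (y, y')))"
    by (rule integral_prod_continuous[OF c])
  also have "\<dots> \<le> integral (cbox j0 j1) (\<lambda>y. 24 * L)"
    by (rule integral_le) (use inner integral_integrable_2dim[OF c] in auto)
  also have "\<dots> \<le> 24 * L" using j01 L_pos by (simp add: mult_left_le_one_le)
  finally show ?thesis .
qed

text \<open>The sum is taken under the integral, where it is controlled pointwise by counting in
  slices; \<open>\<bar>psi r x x'\<bar>\<close> then serves only as a weight of bounded
  mass.\<close>

lemma sum_integral_psi_le:
  assumes "finite S" and x: "x \<in> {i0..i1}" "x' \<in> {i0..i1}" and r: "r > 0" and B: "0 \<le> B"
    and c: "\<And>s. s \<in> S \<Longrightarrow> continuous_on Q (h s)"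
    and le: "\<And>t. t \<in> Q \<Longrightarrow> (\<Sum>s\<in>S. w s * h s t) \<le> B"
  shows "(\<Sum>s\<in>S. w s * integral Q (\<lambda>t. \<bar>psi r x x' t\<bar> * h s t)) \<le> 24 * L * B"
proof -
  have cp: "continuous_on Q (\<lambda>t. \<bar>psi r x x' t\<bar>)" by (intro continuous_intros continuous_psi x r)
  have "(\<Sum>s\<in>S. w s * integral Q (\<lambda>t. \<bar>psi r x x' t\<bar> * h s t))
      = (\<Sum>s\<in>S. integral Q (\<lambda>t. w s * (\<bar>psi r x x' t\<bar> * h s t)))"
    by simp
  also have "\<dots> = integral Q (\<lambda>t. \<Sum>s\<in>S. w s * (\<bar>psi r x x' t\<bar> * h s t))"
    by (rule integral_sum[symmetric, OF \<open>finite S\<close>]) (intro integrable_continuous continuous_intros cp c)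
  also have "\<dots> \<le> integral Q (\<lambda>t. B * \<bar>psi r x x' t\<bar>)"
  proof (rule integral_le)
    show "(\<lambda>t. \<Sum>s\<in>S. w s * (\<bar>psi r x x' t\<bar> * h s t)) integrable_on Q"
      by (intro integrable_continuous continuous_intros cp c)
    show "(\<lambda>t. B * \<bar>psi r x x' t\<bar>) integrable_on Q"
      by (intro integrable_continuous continuous_intros cp)
    fix t assume "t \<in> Q"
    have "(\<Sum>s\<in>S. w s * (\<bar>psi r x x' t\<bar> * h s t)) = (\<Sum>s\<in>S. w s * h s t) * \<bar>psi r x x' t\<bar>"
      unfolding sum_distrib_right by (intro sum.cong refl) (simp add: mult_ac)
    also have "\<dots> \<le> B * \<bar>psi r x x' t\<bar>" using le[OF \<open>t \<in> Q\<close>] by (intro mult_right_mono) auto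
    finally show "(\<Sum>s\<in>S. w s * (\<bar>psi r x x' t\<bar> * h s t)) \<le> B * \<bar>psi r x x' t\<bar>" .
  qed
  also have "\<dots> = B * integral Q (\<lambda>t. \<bar>psi r x x' t\<bar>)" by simp
  also have "\<dots> \<le> B * (24 * L)" by (intro mult_left_mono integral_psi_le x r B)
  finally show ?thesis by (simp add: mult_ac)
qed

definition "corr r p q = integral Q (\<lambda>t. chi t * (psi r (fst p) (snd p) t * psi r (fst q) (snd q) t))"

text \<open>The factors that remain in the two halves of \<open>kernel_sum_le\<close> when the
  powers of \<open>r\<close> and of \<open>\<bar>x - x'\<bar>\<close> are split off.\<close>

definition "near_constant s C = 24 * L * (C * (6 * K) powr s * (C * (12 * L) powr s))"

definition "far_constant s C = 24 * L * (28 * L ^ 3 * K ^ 3 *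
  (C * (2 powr s / (1 - 2 powr (s - 1))) * (6 * K) powr (s - 1) * (C * (12 * L) powr s)))"

lemma abs_chi_le: "t \<in> Q \<Longrightarrow> \<bar>chi t\<bar> \<le> 1" and chi_nonneg: "t \<in> Q \<Longrightarrow> 0 \<le> chi t"
proof -
  have *: "0 \<le> (y - j0) * (j1 - y)" "(y - j0) * (j1 - y) \<le> 1" if "y \<in> {j0..j1}" for y
    using that j01 mult_mono[of "y - j0" 1 "j1 - y" 1] by auto
  show "\<bar>chi t\<bar> \<le> 1" "0 \<le> chi t" if t: "t \<in> Q"
  proof -
    obtain y z where t': "t = (y, z)" "y \<in> {j0..j1}" "z \<in> {j0..j1}"
      using t by (cases t) (auto simp: cbox_Pair_eq)
    show "0 \<le> chi t" using *[OF t'(2)] *[OF t'(3)] by (simp add: chi_def t'(1))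
    moreover have "chi t \<le> 1 * 1"
      using *[OF t'(2)] *[OF t'(3)] unfolding chi_def t'(1) by (simp only: case_prod_conv) (intro mult_mono; simp)
    ultimately show "\<bar>chi t\<bar> \<le> 1" by simp
  qed
qed

text \<open>The sum is split at \<open>\<bar>z - x\<bar> = D\<close> with
  \<open>D = 6 * K * r / d^2\<close>, where the gain \<open>r / (d^2 * \<bar>x - z\<bar>)\<close>
  from \<open>kernel_far\<close> becomes comparable to 1. Nearer than \<open>D\<close> absolute
  values suffice and the weight of \<open>z\<close> is at most \<open>C * D powr s\<close>. Farther
  away the sum of \<open>1 / \<bar>z - x\<bar>\<close> is of order \<open>D powr (s - 1)\<close>,
  which needs \<open>s < 1\<close>. Slicing in \<open>z'\<close> costs a multiple of
  \<open>r powr s\<close> in both ranges, and both end with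
  \<open>r powr (2 * s - 1) * d powr (- (2 * s))\<close>.\<close>

lemma kernel_sum_le:
  assumes s: "0 < s" "s < 1" and F: "frostman s C \<delta> X m" and X: "X \<subseteq> {i0..i1}"
    and x: "x \<in> {i0..i1}" "x' \<in> {i0..i1}" "x \<noteq> x'" and r: "\<delta> \<le> r"
  shows "(\<Sum>q\<in>X \<times> X. m (fst q) * m (snd q) * \<bar>corr r (x, x') q\<bar>)
    \<le> (near_constant s C + far_constant s C) * (r powr (2 * s - 1) * \<bar>x - x'\<bar> powr (- (2 * s)))"
proof -
  note f = frostmanD[OF F]
  have C: "0 \<le> C" by (rule frostman_constant_nonneg[OF F])
  have r0: "0 < r" using f(1) r by linarith
  have K0: "0 < K" using K_ge by linarith
  define d where "d = \<bar>x - x'\<bar>"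
  have d: "0 < d" using x by (simp add: d_def)
  have "K * d \<le> K * (i1 - i0)" using x K0 by (intro mult_left_mono) (auto simp: d_def)
  then have "K * d \<le> 1" using i01 by (simp add: K_def)
  moreover have "2000 * d \<le> K * d" using K_ge d by (intro mult_right_mono) auto
  ultimately have d1: "d \<le> 1" using d by linarith
  define D where "D = 6 * K * r / d\<^sup>2"
  have d2: "d\<^sup>2 \<le> 1" using d d1 by (simp add: power_le_one)
  have "r \<le> 6 * K * r" using K_ge r0 by simp
  also have "\<dots> \<le> D" using d2 d K0 r0 by (simp add: D_def le_divide_eq mult_left_le)
  finally have D\<delta>: "\<delta> \<le> D" using r by simp
  let ?near = "{z \<in> X. \<bar>z - x\<bar> < D}" and ?far = "{z \<in> X. D \<le> \<bar>z - x\<bar>}"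
  let ?B = "C * (12 * L * r) powr s"
  have B: "0 \<le> ?B" using C by simp
  have fin: "finite ?near" "finite ?far" "finite X" using f(3) by auto
  have near: "(\<Sum>q\<in>?near \<times> X. m (fst q) * m (snd q) * \<bar>corr r (x, x') q\<bar>) \<le> 24 * L * (C * D powr s * (1 / r * ?B))"
  proof -
    have "(\<Sum>q\<in>?near \<times> X. m (fst q) * m (snd q) * \<bar>corr r (x, x') q\<bar>) \<le>
        (\<Sum>q\<in>?near \<times> X. m (fst q) * m (snd q) * integral Q (\<lambda>t. \<bar>psi r x x' t\<bar> * \<bar>psi r (fst q) (snd q) t\<bar>))"
    proof (rule sum_mono, rule mult_left_mono)
      fix q assume q: "q \<in> ?near \<times> X"
      then have qI: "fst q \<in> {i0..i1}" "snd q \<in> {i0..i1}" using X by auto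
      show "0 \<le> m (fst q) * m (snd q)" using q f(4) by auto
      show "\<bar>corr r (x, x') q\<bar> \<le> integral Q (\<lambda>t. \<bar>psi r x x' t\<bar> * \<bar>psi r (fst q) (snd q) t\<bar>)"
        unfolding corr_def
      proof (rule abs_integral_le)
        fix t assume "t \<in> Q"
        then show "\<bar>chi t * (psi r (fst (x, x')) (snd (x, x')) t * psi r (fst q) (snd q) t)\<bar> \<le> \<bar>psi r x x' t\<bar> * \<bar>psi r (fst q) (snd q) t\<bar>"
          using abs_chi_le[of t] by (simp add: abs_mult mult_left_le_one_le)
      next
        have "continuous_on Q (psi r x x')" "continuous_on Q (psi r (fst q) (snd q))"
          using continuous_psi(1)[OF x(1,2) r0] continuous_psi(1)[OF qI r0] .
        then show "(\<lambda>t. chi t * (psi r (fst (x, x')) (snd (x, x')) t * psi r (fst q) (snd q) t)) integrable_on Q"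
          "(\<lambda>t. \<bar>psi r x x' t\<bar> * \<bar>psi r (fst q) (snd q) t\<bar>) integrable_on Q"
          by (auto intro!: integrable_continuous continuous_intros continuous_chi)
      qed
    qed
    also have "\<dots> \<le> 24 * L * (C * D powr s * (1 / r * ?B))"
    proof (rule sum_integral_psi_le[OF _ x(1,2) r0])
      fix t assume "t \<in> Q"
      then obtain y y' where t: "t = (y, y')" "y \<in> {j0..j1}" "y' \<in> {j0..j1}"
        by (cases t) (auto simp: cbox_Pair_eq)
      have "(\<Sum>q\<in>?near \<times> X. m (fst q) * m (snd q) * \<bar>psi r (fst q) (snd q) t\<bar>)
        = (\<Sum>z\<in>?near. m z * (\<Sum>z'\<in>X. m z' * \<bar>bump_diff r (f z y - f z' y')\<bar>))"
        by (simp add: sum.cartesian_product' t psi_def sum_distrib_left mult_ac)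
      also have "\<dots> \<le> (\<Sum>z\<in>?near. m z * (1 / r * ?B))"
        by (intro sum_mono mult_left_mono slice_sum_le[OF F X t(3) r] abs_bump_diff_le bump_diff_eq_0 r0) (use f(4) in auto)
      also have "\<dots> = (\<Sum>z\<in>?near. m z) * (1 / r * ?B)" by (rule sum_distrib_right[symmetric])
      also have "\<dots> \<le> (C * D powr s) * (1 / r * ?B)"
      proof (rule mult_right_mono)
        have "(\<Sum>z\<in>?near. m z) \<le> (\<Sum>z\<in>{z \<in> X. \<bar>z - x\<bar> \<le> D}. m z)" using f by (intro sum_mono2) auto
        also have "\<dots> \<le> C * D powr s" by (rule f(5)[OF D\<delta>])
        finally show "(\<Sum>z\<in>?near. m z) \<le> C * D powr s" .
      qed (use B r0 in auto)
      finally show "(\<Sum>q\<in>?near \<times> X. m (fst q) * m (snd q) * \<bar>psi r (fst q) (snd q) t\<bar>) \<le> C * D powr s * (1 / r * ?B)" .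
    qed (use fin B C r0 X in \<open>auto intro!: continuous_intros continuous_psi\<close>)
    finally show ?thesis .
  qed
  have far: "(\<Sum>q\<in>?far \<times> X. m (fst q) * m (snd q) * \<bar>corr r (x, x') q\<bar>)
     \<le> 24 * L * (28 * L ^ 3 * K ^ 3 / d\<^sup>2 * (C * (2 powr s / (1 - 2 powr (s - 1))) * D powr (s - 1) * ?B))"
  proof -
    have s1: "2 powr (s - 1) < (1::real)" using s powr_less_mono[of "s - 1" 0 2] by simp
    have "(\<Sum>q\<in>?far \<times> X. m (fst q) * m (snd q) * \<bar>corr r (x, x') q\<bar>) \<le>
        (\<Sum>q\<in>?far \<times> X. (m (fst q) * m (snd q) * (28 * L ^ 3 * K ^ 3 / (d\<^sup>2 * \<bar>fst q - x\<bar>))) *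
          integral Q (\<lambda>t. \<bar>psi r x x' t\<bar> * \<bar>theta r (fst q) (snd q) t\<bar>))"
    proof (rule sum_mono)
      fix q assume q: "q \<in> ?far \<times> X"
      then have qI: "fst q \<in> {i0..i1}" "snd q \<in> {i0..i1}" using X by auto
      \<comment> \<open>The threshold \<open>D\<close> is larger by the factor \<open>1 / d\<close>
        than what transversality asks for.\<close>
      have "K * (6 * r) \<le> d * D"
      proof -
        have "K * (6 * r) \<le> K * (6 * r) / d" using d d1 K0 r0 by (simp add: le_divide_eq mult_left_le)
        also have "\<dots> = d * D" using d by (simp add: D_def power2_eq_square)
        finally show ?thesis .
      qed
      also have "\<dots> \<le> d * \<bar>x - fst q\<bar>" using q d by (intro mult_left_mono) (auto simp: abs_minus_commute)
      finally have "\<bar>corr r (x, x') q\<bar> \<le> 28 * L ^ 3 * K ^ 3 / (d\<^sup>2 * \<bar>fst q - x\<bar>) *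
         integral Q (\<lambda>t. \<bar>psi r x x' t\<bar> * \<bar>theta r (fst q) (snd q) t\<bar>)"
        using kernel_far[OF x(1,2) qI r0] by (simp add: corr_def d_def abs_minus_commute)
      then have "m (fst q) * m (snd q) * \<bar>corr r (x, x') q\<bar> \<le> m (fst q) * m (snd q) * (28 * L ^ 3 * K ^ 3 / (d\<^sup>2 * \<bar>fst q - x\<bar>) *
         integral Q (\<lambda>t. \<bar>psi r x x' t\<bar> * \<bar>theta r (fst q) (snd q) t\<bar>))"
        using q f(4) by (intro mult_left_mono) auto
      then show "m (fst q) * m (snd q) * \<bar>corr r (x, x') q\<bar> \<le> (m (fst q) * m (snd q) * (28 * L ^ 3 * K ^ 3 / (d\<^sup>2 * \<bar>fst q - x\<bar>))) *
          integral Q (\<lambda>t. \<bar>psi r x x' t\<bar> * \<bar>theta r (fst q) (snd q) t\<bar>)"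
        by (simp add: mult_ac)
    qed
    also have "\<dots> \<le> 24 * L * (28 * L ^ 3 * K ^ 3 / d\<^sup>2 * (C * (2 powr s / (1 - 2 powr (s - 1))) * D powr (s - 1) * ?B))"
    proof (rule sum_integral_psi_le[OF _ x(1,2) r0])
      fix t assume "t \<in> Q"
      then obtain y y' where t: "t = (y, y')" "y \<in> {j0..j1}" "y' \<in> {j0..j1}"
        by (cases t) (auto simp: cbox_Pair_eq)
      have "(\<Sum>q\<in>?far \<times> X. m (fst q) * m (snd q) * (28 * L ^ 3 * K ^ 3 / (d\<^sup>2 * \<bar>fst q - x\<bar>)) * \<bar>theta r (fst q) (snd q) t\<bar>)
        = (\<Sum>q\<in>?far \<times> X. 28 * L ^ 3 * K ^ 3 / d\<^sup>2 * (m (fst q) * (1 / \<bar>fst q - x\<bar>) * (m (snd q) * \<bar>theta r (fst q) (snd q) t\<bar>)))"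
        by (intro sum.cong refl) simp
      also have "\<dots> = 28 * L ^ 3 * K ^ 3 / d\<^sup>2 * (\<Sum>z\<in>?far. m z * (1 / \<bar>z - x\<bar>) * (\<Sum>z'\<in>X. m z' * \<bar>bump_diff_int r (f z y - f z' y')\<bar>))"
        by (simp add: sum.cartesian_product' t theta_def sum_distrib_left)
      also have "\<dots> \<le> 28 * L ^ 3 * K ^ 3 / d\<^sup>2 * (\<Sum>z\<in>?far. m z * (1 / \<bar>z - x\<bar>) * (1 * ?B))"
        by (intro sum_mono mult_left_mono slice_sum_le[OF F X t(3) r] abs_bump_diff_int_le bump_diff_int_eq_0 r0) 
          (use f(4) L_pos K0 in auto)
      also have "\<dots> = 28 * L ^ 3 * K ^ 3 / d\<^sup>2 * ((\<Sum>z\<in>?far. m z * \<bar>z - x\<bar> powr (- 1)) * ?B)"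
        by (simp add: sum_distrib_right powr_minus_divide)
      also have "\<dots> \<le> 28 * L ^ 3 * K ^ 3 / d\<^sup>2 * (C * (2 powr s / (1 - 2 powr (s - 1))) * D powr (s - 1) * ?B)"
        by (intro mult_left_mono mult_right_mono frostman_negative_power_sum[OF F] D\<delta> B s) (use L_pos K0 in auto)
      finally show "(\<Sum>q\<in>?far \<times> X. m (fst q) * m (snd q) * (28 * L ^ 3 * K ^ 3 / (d\<^sup>2 * \<bar>fst q - x\<bar>)) * \<bar>theta r (fst q) (snd q) t\<bar>)
        \<le> 28 * L ^ 3 * K ^ 3 / d\<^sup>2 * (C * (2 powr s / (1 - 2 powr (s - 1))) * D powr (s - 1) * ?B)" .
    qed (use fin B C r0 X L_pos K0 s1 in \<open>auto intro!: continuous_intros continuous_psi mult_nonneg_nonneg\<close>)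
    finally show ?thesis .
  qed
  have Dp: "D powr a = (6 * K) powr a * r powr a * d powr (- (2 * a))" for a
  proof -
    have "D powr a = (6 * K) powr a * r powr a / (d\<^sup>2) powr a"
      using K0 r0 d by (simp add: D_def powr_divide powr_mult)
    also have "(d\<^sup>2) powr a = d powr (2 * a)"
    proof -
      have "d\<^sup>2 = d powr 2" using d by simp
      then show ?thesis by (simp only: powr_powr)
    qed
    finally show ?thesis by (simp add: powr_minus divide_inverse)
  qed
  have Br: "(12 * L * r) powr s = (12 * L) powr s * r powr s" using L_pos r0 by (simp add: powr_mult)
  have e1: "r powr s * r powr s * (1 / r) = r powr (2 * s - 1)"
  proof -
    have "1 / r = r powr (- 1)" using r0 by (simp add: powr_minus_divide)
    then show ?thesis by (simp only: powr_add[symmetric]) simp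
  qed
  have e2: "r powr (s - 1) * r powr s = r powr (2 * s - 1)"
    by (simp add: powr_add[symmetric])
  have e3: "d powr (- (2 * (s - 1))) * (1 / d\<^sup>2) = d powr (- (2 * s))"
  proof -
    have "1 / d\<^sup>2 = d powr (- 2)" using d by (simp add: powr_minus_divide)
    then show ?thesis by (simp add: powr_add[symmetric])
  qed
  have "(\<Sum>q\<in>X \<times> X. m (fst q) * m (snd q) * \<bar>corr r (x, x') q\<bar>)
     = (\<Sum>q\<in>(?near \<times> X) \<union> (?far \<times> X). m (fst q) * m (snd q) * \<bar>corr r (x, x') q\<bar>)"
  proof -
    have "X \<times> X = ?near \<times> X \<union> ?far \<times> X" by auto
    then show ?thesis by (rule subst[where P = "\<lambda>S. (\<Sum>q\<in>X \<times> X. m (fst q) * m (snd q) * \<bar>corr r (x, x') q\<bar>) = (\<Sum>q\<in>S. m (fst q) * m (snd q) * \<bar>corr r (x, x') q\<bar>)"]) (rule refl)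
  qed
  also have "\<dots> = (\<Sum>q\<in>?near \<times> X. m (fst q) * m (snd q) * \<bar>corr r (x, x') q\<bar>) +
       (\<Sum>q\<in>?far \<times> X. m (fst q) * m (snd q) * \<bar>corr r (x, x') q\<bar>)"
    using fin by (intro sum.union_disjoint) auto
  also have "\<dots> \<le> 24 * L * (C * D powr s * (1 / r * ?B)) +
     24 * L * (28 * L ^ 3 * K ^ 3 / d\<^sup>2 * (C * (2 powr s / (1 - 2 powr (s - 1))) * D powr (s - 1) * ?B))"
    by (rule add_mono[OF near far])
  also have "24 * L * (C * D powr s * (1 / r * ?B)) = near_constant s C * (r powr s * r powr s * (1 / r) * d powr (- (2 * s)))"
    unfolding Dp Br near_constant_def divide_inverse by (simp only: mult_ac mult_1_left mult_1_right)
  also have "24 * L * (28 * L ^ 3 * K ^ 3 / d\<^sup>2 * (C * (2 powr s / (1 - 2 powr (s - 1))) * D powr (s - 1) * ?B))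
     = far_constant s C * (r powr (s - 1) * r powr s * (d powr (- (2 * (s - 1))) * (1 / d\<^sup>2)))"
    unfolding Dp Br far_constant_def divide_inverse by (simp only: mult_ac mult_1_left mult_1_right)
  finally show ?thesis unfolding e1 e2 e3 distrib_right d_def[symmetric] .
qed

end

section \<open>Mollified weights\<close>

lemma integral_product:
  fixes g h :: "real \<Rightarrow> real"
  assumes "continuous_on {a..b} g" "continuous_on {c..d} h"
  shows "integral (cbox (a, c) (b, d)) (\<lambda>t. g (fst t) * h (snd t)) = integral {a..b} g * integral {c..d} h"
proof -
  have "continuous_on (cbox (a, c) (b, d)) (\<lambda>t. g (fst t) * h (snd t))"
    by (intro continuous_on_mult continuous_on_compose2[OF assms(1)] continuous_on_compose2[OF assms(2)] continuous_intros)
      (auto simp: cbox_Pair_eq)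
  from integral_prod_continuous[OF this] show ?thesis by simp
qed

definition mollifier :: "real \<Rightarrow> real \<Rightarrow> real \<Rightarrow> real" where
  "mollifier \<rho> z y = bump ((y - z) / \<rho>) / \<rho>"

lemma continuous_on_mollifier: "\<rho> > 0 \<Longrightarrow> continuous_on S g \<Longrightarrow> continuous_on S (\<lambda>t. mollifier \<rho> z (g t))"
  unfolding mollifier_def by (intro continuous_intros) auto

lemma mollifier_nonneg: "\<rho> > 0 \<Longrightarrow> 0 \<le> mollifier \<rho> z y"
  by (simp add: mollifier_def bump_nonneg)

lemma mollifier_le: "\<rho> > 0 \<Longrightarrow> mollifier \<rho> z y \<le> 1 / \<rho>"
  by (simp add: mollifier_def bump_le_one divide_right_mono)

lemma mollifier_eq_0: "\<rho> > 0 \<Longrightarrow> 3 * \<rho> \<le> \<bar>y - z\<bar> \<Longrightarrow> mollifier \<rho> z y = 0"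
  by (simp add: mollifier_def bump_eq_0 field_simps)

lemma integral_mollifier:
  assumes "\<rho> > 0" "a \<le> z - 3 * \<rho>" "z + 3 * \<rho> \<le> b"
  shows "integral {a..b} (mollifier \<rho> z) = 1"
proof -
  have "(mollifier \<rho> z has_integral (bump_int ((b - z) / \<rho>) - bump_int ((a - z) / \<rho>))) {a..b}"
  proof (rule fundamental_theorem_of_calculus)
    show "a \<le> b" using assms by simp
    fix y
    have "((\<lambda>y. bump_int ((y - z) / \<rho>)) has_real_derivative bump ((y - z) / \<rho>) * ((1 - 0) / \<rho>)) (at y)"
      by (intro DERIV_bump_int DERIV_cdivide DERIV_diff DERIV_ident DERIV_const)
    then show "((\<lambda>y. bump_int ((y - z) / \<rho>)) has_vector_derivative mollifier \<rho> z y) (at y within {a..b})"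
      by (simp add: mollifier_def has_real_derivative_iff_has_vector_derivative[symmetric] has_field_derivative_at_within)
  qed
  moreover have "bump_int ((b - z) / \<rho>) = 1" using assms by (intro bump_int_high) (simp add: field_simps)
  moreover have "bump_int ((a - z) / \<rho>) = 0" using assms by (intro bump_int_low) (simp add: field_simps)
  ultimately show ?thesis by (simp add: integral_unique)
qed

definition smoothed :: "real \<Rightarrow> real set \<Rightarrow> (real \<Rightarrow> real) \<Rightarrow> real \<Rightarrow> real" where
  "smoothed \<rho> Y n y = (\<Sum>z\<in>Y. n z * mollifier \<rho> z y)"

lemma continuous_on_smoothed: "\<rho> > 0 \<Longrightarrow> continuous_on S g \<Longrightarrow> continuous_on S (\<lambda>t. smoothed \<rho> Y n (g t))"
  unfolding smoothed_def by (intro continuous_intros continuous_on_mollifier)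

lemma smoothed_le:
  assumes F: "frostman s C \<delta> Y n" and \<rho>: "\<delta> \<le> \<rho>"
  shows "0 \<le> smoothed \<rho> Y n y" "smoothed \<rho> Y n y \<le> C * 3 powr s * \<rho> powr (s - 1)"
proof -
  note f = frostmanD[OF F]
  have \<rho>0: "0 < \<rho>" using f \<rho> by linarith
  show "0 \<le> smoothed \<rho> Y n y"
    unfolding smoothed_def using f(4) mollifier_nonneg[OF \<rho>0] by (intro sum_nonneg mult_nonneg_nonneg) auto
  have "smoothed \<rho> Y n y = (\<Sum>z\<in>{z \<in> Y. \<bar>z - y\<bar> \<le> 3 * \<rho>}. n z * mollifier \<rho> z y)"
    unfolding smoothed_def
  proof (intro sum.mono_neutral_right ballI)
    fix z assume "z \<in> Y - {z \<in> Y. \<bar>z - y\<bar> \<le> 3 * \<rho>}"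
    then have "3 * \<rho> \<le> \<bar>y - z\<bar>" by (auto simp: abs_minus_commute)
    then show "n z * mollifier \<rho> z y = 0" using mollifier_eq_0[OF \<rho>0, of y z] by simp
  qed (use f in auto)
  also have "\<dots> \<le> (\<Sum>z\<in>{z \<in> Y. \<bar>z - y\<bar> \<le> 3 * \<rho>}. n z * (1 / \<rho>))"
    by (intro sum_mono mult_left_mono mollifier_le \<rho>0) (use f(4) in auto)
  also have "\<dots> = (\<Sum>z\<in>{z \<in> Y. \<bar>z - y\<bar> \<le> 3 * \<rho>}. n z) * (1 / \<rho>)"
    by (rule sum_distrib_right[symmetric])
  also have "\<dots> \<le> C * (3 * \<rho>) powr s * (1 / \<rho>)"
    by (rule mult_right_mono[OF f(5)]) (use \<rho> \<rho>0 in auto)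
  also have "\<dots> = C * 3 powr s * \<rho> powr (s - 1)"
    using \<rho>0 by (simp add: powr_mult powr_diff)
  finally show "smoothed \<rho> Y n y \<le> C * 3 powr s * \<rho> powr (s - 1)" .
qed

section \<open>Energy away from the diagonal, and the contribution of a single scale\<close>

context web
begin

text \<open>The support radius is left free because \<open>bump_diff\<close> reaches to
  \<open>6 * r\<close> and the bump itself only to \<open>3 * r\<close>.\<close>

lemma slice_sum_le_y:
  assumes F: "frostman s C \<delta> Y n" and Y: "Y \<subseteq> {j0..j1}" and x: "x \<in> {i0..i1}" and r: "\<delta> \<le> r"
    and g: "\<And>t. \<bar>g t\<bar> \<le> M" "\<And>t. c * r \<le> \<bar>t\<bar> \<Longrightarrow> g t = 0" and c: "1 \<le> c"
  shows "(\<Sum>y\<in>Y. n y * \<bar>g (t - f x y)\<bar>) \<le> M * (C * (2 * c * L * r) powr s)"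
proof -
  note f = frostmanD[OF F]
  have M: "0 \<le> M" using g(1)[of 0] by linarith
  have "(\<Sum>y\<in>Y. n y * \<bar>g (t - f x y)\<bar>) = (\<Sum>y\<in>{y \<in> Y. \<bar>f x y - t\<bar> \<le> c * r}. n y * \<bar>g (t - f x y)\<bar>)"
  proof (intro sum.mono_neutral_right ballI)
    fix y assume "y \<in> Y - {y \<in> Y. \<bar>f x y - t\<bar> \<le> c * r}"
    then have "c * r \<le> \<bar>t - f x y\<bar>" by auto
    then show "n y * \<bar>g (t - f x y)\<bar> = 0" using g(2) by simp
  qed (use f(3) in auto)
  also have "\<dots> \<le> (\<Sum>y\<in>{y \<in> Y. \<bar>f x y - t\<bar> \<le> c * r}. n y * M)"
    using f(4) g(1) by (intro sum_mono mult_left_mono) auto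
  also have "\<dots> = M * (\<Sum>y\<in>{y \<in> Y. \<bar>f x y - t\<bar> \<le> c * r}. n y)"
    by (simp add: sum_distrib_left mult.commute)
  also have "\<dots> \<le> M * (C * (2 * L * (c * r)) powr s)"
  proof (rule mult_left_mono[OF slice_y[OF F Y x] M])
    have "1 * r \<le> c * r" using c f(1) r by (intro mult_right_mono) auto
    moreover have "1 * (c * r) \<le> L * (c * r)" using L f(1) r c by (intro mult_right_mono) auto
    ultimately have "\<delta> \<le> 2 * (L * (c * r))" using r f(1) by linarith
    then show "\<delta> \<le> 2 * L * (c * r)" by simp
  qed
  finally show ?thesis by (simp add: mult_ac)
qed

lemma i1_minus_i0_le: "i1 - i0 \<le> 1"
proof (cases "0 \<le> i1 - i0")
  case True
  then have "1 * (i1 - i0) \<le> K * (i1 - i0)" using K_ge by (intro mult_right_mono) auto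
  then show ?thesis using i01 by (simp add: K_def)
qed auto

definition "energy_constant s C = (near_constant s C + far_constant s C) * (C * (C * (2 powr s / (1 - 2 powr (- s)))))"

text \<open>Expanding the square produces the correlations \<open>corr r p q\<close>, which
  \<open>kernel_sum_le\<close> sums over \<open>q\<close> for each fixed \<open>p\<close>. What
  remains is the sum of \<open>\<bar>x - x'\<bar> powr (- (2 * s))\<close> against an
  \<open>s\<close>-dimensional weight. It is too singular to be bounded uniformly near the diagonal,
  hence the truncation at \<open>d\<close> and the factor \<open>d powr (- s)\<close>.\<close>

lemma energy_le:
  assumes s: "0 < s" "s < 1" and F: "frostman s C \<delta> X m" and X: "X \<subseteq> {i0..i1}"
    and r: "\<delta> \<le> r" and d: "\<delta> \<le> d"
  shows "integral Q (\<lambda>t. chi t * (\<Sum>p\<in>{p \<in> X \<times> X. d \<le> \<bar>fst p - snd p\<bar>}. m (fst p) * m (snd p) * psi r (fst p) (snd p) t)\<^sup>2)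
    \<le> energy_constant s C * (r powr (2 * s - 1) * d powr (- s))"
proof -
  note f = frostmanD[OF F]
  have C: "0 \<le> C" by (rule frostman_constant_nonneg[OF F])
  have r0: "0 < r" and d0: "0 < d" using f(1) r d by linarith+
  have K0: "0 < K" using K_ge by linarith
  let ?P = "{p \<in> X \<times> X. d \<le> \<bar>fst p - snd p\<bar>}"
  define w where "w p = m (fst p) * m (snd p)" for p :: "real \<times> real"
  define c where "c = near_constant s C + far_constant s C"
  have s1: "2 powr (s - 1) < (1::real)" using s powr_less_mono[of "s - 1" 0 2] by simp
  have c0: "0 \<le> c"
    using C L_pos K0 s1 by (simp add: c_def near_constant_def far_constant_def)
  have fin: "finite ?P" "finite (X \<times> X)" using f(3) by auto
  have w0: "0 \<le> w p" if "p \<in> X \<times> X" for p using that f(4) by (auto simp: w_def)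
  have PI: "fst p \<in> {i0..i1}" "snd p \<in> {i0..i1}" if "p \<in> X \<times> X" for p using that X by auto
  have cp: "continuous_on Q (psi r (fst p) (snd p))" if "p \<in> ?P" for p
    using continuous_psi(1)[OF PI r0] that by blast
  have "integral Q (\<lambda>t. chi t * (\<Sum>p\<in>?P. w p * psi r (fst p) (snd p) t)\<^sup>2)
     = integral Q (\<lambda>t. \<Sum>p\<in>?P. \<Sum>q\<in>?P. w p * (w q * (chi t * (psi r (fst p) (snd p) t * psi r (fst q) (snd q) t))))"
  proof (rule integral_cong)
    fix t :: "real \<times> real"
    have D: "(\<Sum>p\<in>?P. w p * psi r (fst p) (snd p) t)\<^sup>2
       = (\<Sum>p\<in>?P. \<Sum>q\<in>?P. (w p * psi r (fst p) (snd p) t) * (w q * psi r (fst q) (snd q) t))"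
      unfolding power2_eq_square by (rule sum_product)
    show "chi t * (\<Sum>p\<in>?P. w p * psi r (fst p) (snd p) t)\<^sup>2
       = (\<Sum>p\<in>?P. \<Sum>q\<in>?P. w p * (w q * (chi t * (psi r (fst p) (snd p) t * psi r (fst q) (snd q) t))))"
      unfolding D sum_distrib_left by (intro sum.cong refl) (simp add: mult_ac)
  qed
  also have "\<dots> = (\<Sum>p\<in>?P. integral Q (\<lambda>t. \<Sum>q\<in>?P. w p * (w q * (chi t * (psi r (fst p) (snd p) t * psi r (fst q) (snd q) t)))))"
    by (intro integral_sum fin integrable_continuous continuous_intros continuous_chi cp)
  also have "\<dots> = (\<Sum>p\<in>?P. \<Sum>q\<in>?P. w p * (w q * corr r p q))"
  proof (rule sum.cong[OF refl])
    fix p assume p: "p \<in> ?P"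
    have "integral Q (\<lambda>t. \<Sum>q\<in>?P. w p * (w q * (chi t * (psi r (fst p) (snd p) t * psi r (fst q) (snd q) t))))
       = (\<Sum>q\<in>?P. integral Q (\<lambda>t. w p * (w q * (chi t * (psi r (fst p) (snd p) t * psi r (fst q) (snd q) t)))))"
      by (intro integral_sum fin integrable_continuous continuous_intros continuous_chi cp p)
    then show "integral Q (\<lambda>t. \<Sum>q\<in>?P. w p * (w q * (chi t * (psi r (fst p) (snd p) t * psi r (fst q) (snd q) t))))
       = (\<Sum>q\<in>?P. w p * (w q * corr r p q))"
      by (simp only: corr_def integral_mult_right)
  qed
  \<comment> \<open>All cancellation is already inside the single correlations, so absolute values
    may be taken. The inner sum may then run over all pairs, since \<open>kernel_sum_le\<close> asks
    only the fixed pair to have distinct entries.\<close>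
  also have "\<dots> \<le> (\<Sum>p\<in>?P. w p * (\<Sum>q\<in>X \<times> X. w q * \<bar>corr r p q\<bar>))"
  proof (rule sum_mono)
    fix p assume p: "p \<in> ?P"
    have "(\<Sum>q\<in>?P. w q * corr r p q) \<le> (\<Sum>q\<in>?P. w q * \<bar>corr r p q\<bar>)"
      using w0 by (intro sum_mono mult_left_mono) auto
    also have "\<dots> \<le> (\<Sum>q\<in>X \<times> X. w q * \<bar>corr r p q\<bar>)"
      using w0 fin by (intro sum_mono2) auto
    finally have "w p * (\<Sum>q\<in>?P. w q * corr r p q) \<le> w p * (\<Sum>q\<in>X \<times> X. w q * \<bar>corr r p q\<bar>)"
      using w0 p by (intro mult_left_mono) auto
    then show "(\<Sum>q\<in>?P. w p * (w q * corr r p q)) \<le> w p * (\<Sum>q\<in>X \<times> X. w q * \<bar>corr r p q\<bar>)"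
      by (simp add: sum_distrib_left)
  qed
  also have "\<dots> \<le> (\<Sum>p\<in>?P. w p * (c * (r powr (2 * s - 1) * \<bar>fst p - snd p\<bar> powr (- (2 * s)))))"
  proof (intro sum_mono mult_left_mono)
    fix p assume p: "p \<in> ?P"
    then have "fst p \<noteq> snd p" using d0 by auto
    then show "(\<Sum>q\<in>X \<times> X. w q * \<bar>corr r p q\<bar>) \<le> c * (r powr (2 * s - 1) * \<bar>fst p - snd p\<bar> powr (- (2 * s)))"
      using kernel_sum_le[OF s F X PI(1) PI(2) _ r, of p p] p by (simp add: w_def c_def)
  qed (use w0 in auto)
  also have "\<dots> = c * r powr (2 * s - 1) * (\<Sum>p\<in>?P. w p * \<bar>fst p - snd p\<bar> powr (- (2 * s)))"
    unfolding sum_distrib_left by (intro sum.cong refl) (simp add: mult_ac)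
  also have "(\<Sum>p\<in>?P. w p * \<bar>fst p - snd p\<bar> powr (- (2 * s)))
     = (\<Sum>x\<in>X. m x * (\<Sum>x'\<in>{x' \<in> X. d \<le> \<bar>x' - x\<bar>}. m x' * \<bar>x' - x\<bar> powr (- (2 * s))))"
  proof -
    have "?P = Sigma X (\<lambda>x. {x' \<in> X. d \<le> \<bar>x' - x\<bar>})" by (auto simp: abs_minus_commute)
    then have "(\<Sum>p\<in>?P. w p * \<bar>fst p - snd p\<bar> powr (- (2 * s)))
      = (\<Sum>x\<in>X. \<Sum>x'\<in>{x' \<in> X. d \<le> \<bar>x' - x\<bar>}. w (x, x') * \<bar>x - x'\<bar> powr (- (2 * s)))"
      using f(3) by (subst sum.Sigma) (auto simp: case_prod_unfold)
    also have "\<dots> = (\<Sum>x\<in>X. m x * (\<Sum>x'\<in>{x' \<in> X. d \<le> \<bar>x' - x\<bar>}. m x' * \<bar>x' - x\<bar> powr (- (2 * s))))"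
      unfolding sum_distrib_left w_def by (intro sum.cong refl) (simp add: abs_minus_commute)
    finally show ?thesis .
  qed
  also have "\<dots> \<le> (\<Sum>x\<in>X. m x * (C * (2 powr s / (1 - 2 powr (s - 2 * s))) * d powr (s - 2 * s)))"
    by (intro sum_mono mult_left_mono frostman_negative_power_sum[OF F] d) (use s f(4) in auto)
  also have "\<dots> = (\<Sum>x\<in>X. m x) * (C * (2 powr s / (1 - 2 powr (s - 2 * s))) * d powr (s - 2 * s))"
    by (rule sum_distrib_right[symmetric])
  also have "\<dots> \<le> C * (C * (2 powr s / (1 - 2 powr (s - 2 * s))) * d powr (s - 2 * s))"
  proof (rule mult_right_mono[OF frostman_total_le[OF F X i1_minus_i0_le]])
    have "2 powr (s - 2 * s) < (1::real)" using s powr_less_mono[of "s - 2 * s" 0 2] by simp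
    then show "0 \<le> C * (2 powr s / (1 - 2 powr (s - 2 * s))) * d powr (s - 2 * s)" using C by simp
  qed
  finally have "integral Q (\<lambda>t. chi t * (\<Sum>p\<in>?P. w p * psi r (fst p) (snd p) t)\<^sup>2)
     \<le> c * r powr (2 * s - 1) * (C * (C * (2 powr s / (1 - 2 powr (s - 2 * s))) * d powr (s - 2 * s)))"
    using c0 by (simp add: mult_left_mono)
  then show ?thesis by (simp add: w_def energy_constant_def c_def mult_ac)
qed

text \<open>The mollifiers have mass 1 inside the square, so \<open>psi r x x' (y, y')\<close> is
  compared with its average over points at distance at most \<open>3 * \<rho>\<close> in each
  variable. There \<open>f x y - f x' y'\<close> changes by at most
  \<open>6 * L * \<rho> \<le> 6 * r\<close>. With the Lipschitz constant \<open>2 / r^2\<close> this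
  gives \<open>12 * L * \<rho> / r^2\<close>, and the two can differ only where the value is at most
  \<open>6 * r + 6 * r\<close>.\<close>

lemma psi_smoothing:
  assumes x: "x \<in> {i0..i1}" "x' \<in> {i0..i1}" and r: "0 < r" and \<rho>: "0 < \<rho>" "L * \<rho> \<le> r"
    and Y: "finite Y" "\<And>y. y \<in> Y \<Longrightarrow> 0 \<le> n y" "\<And>y. y \<in> Y \<Longrightarrow> j0 \<le> y - 3 * \<rho>" "\<And>y. y \<in> Y \<Longrightarrow> y + 3 * \<rho> \<le> j1"
  shows "\<bar>(\<Sum>y\<in>Y. \<Sum>y'\<in>Y. n y * n y' * psi r x x' (y, y'))
      - integral Q (\<lambda>t. psi r x x' t * (smoothed \<rho> Y n (fst t) * smoothed \<rho> Y n (snd t)))\<bar>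
    \<le> 12 * L * \<rho> / r\<^sup>2 * (\<Sum>y\<in>Y. \<Sum>y'\<in>Y. n y * n y' * (if \<bar>f x y - f x' y'\<bar> \<le> 12 * r then 1 else 0))"
proof -
  define b where "b y y' t = mollifier \<rho> y (fst t) * mollifier \<rho> y' (snd t)" for y y' and t :: "real \<times> real"
  have cb: "continuous_on Q (b y y')" for y y'
    unfolding b_def[abs_def] by (intro continuous_intros continuous_on_mollifier \<rho>)
  have cp: "continuous_on Q (psi r x x')" by (rule continuous_psi(1)[OF x r])
  have int_b: "integral Q (b y y') = 1" if "y \<in> Y" "y' \<in> Y" for y y'
  proof -
    have c: "continuous_on {j0..j1} (mollifier \<rho> y)" for y
      using continuous_on_mollifier[OF \<rho>(1) continuous_on_id] by simp
    have "integral Q (b y y') = integral {j0..j1} (mollifier \<rho> y) * integral {j0..j1} (mollifier \<rho> y')"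
      unfolding b_def by (rule integral_product[OF c c])
    moreover have "integral {j0..j1} (mollifier \<rho> y) = 1" if "y \<in> Y" for y
      by (rule integral_mollifier[OF \<rho>(1) Y(3,4)[OF that]])
    ultimately show ?thesis using that by simp
  qed
  have b0: "0 \<le> b y y' t" for y y' t by (simp add: b_def mollifier_nonneg \<rho>)
  have "integral Q (\<lambda>t. psi r x x' t * (smoothed \<rho> Y n (fst t) * smoothed \<rho> Y n (snd t)))
     = integral Q (\<lambda>t. \<Sum>y\<in>Y. \<Sum>y'\<in>Y. n y * n y' * (psi r x x' t * b y y' t))"
  proof (rule integral_cong)
    fix t :: "real \<times> real"
    have D: "smoothed \<rho> Y n (fst t) * smoothed \<rho> Y n (snd t)
       = (\<Sum>y\<in>Y. \<Sum>y'\<in>Y. (n y * mollifier \<rho> y (fst t)) * (n y' * mollifier \<rho> y' (snd t)))"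
      unfolding smoothed_def by (rule sum_product)
    show "psi r x x' t * (smoothed \<rho> Y n (fst t) * smoothed \<rho> Y n (snd t))
       = (\<Sum>y\<in>Y. \<Sum>y'\<in>Y. n y * n y' * (psi r x x' t * b y y' t))"
      unfolding D sum_distrib_left by (intro sum.cong refl) (simp add: b_def mult_ac)
  qed
  also have "\<dots> = (\<Sum>y\<in>Y. integral Q (\<lambda>t. \<Sum>y'\<in>Y. n y * n y' * (psi r x x' t * b y y' t)))"
    by (intro integral_sum Y integrable_continuous continuous_intros cp cb)
  also have "\<dots> = (\<Sum>y\<in>Y. \<Sum>y'\<in>Y. n y * n y' * integral Q (\<lambda>t. psi r x x' t * b y y' t))"
  proof (rule sum.cong[OF refl])
    fix y
    have "integral Q (\<lambda>t. \<Sum>y'\<in>Y. n y * n y' * (psi r x x' t * b y y' t))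
       = (\<Sum>y'\<in>Y. integral Q (\<lambda>t. n y * n y' * (psi r x x' t * b y y' t)))"
      by (intro integral_sum Y integrable_continuous continuous_intros cp cb)
    then show "integral Q (\<lambda>t. \<Sum>y'\<in>Y. n y * n y' * (psi r x x' t * b y y' t))
       = (\<Sum>y'\<in>Y. n y * n y' * integral Q (\<lambda>t. psi r x x' t * b y y' t))"
      by (simp only: integral_mult_right)
  qed
  finally have eq: "(\<Sum>y\<in>Y. \<Sum>y'\<in>Y. n y * n y' * psi r x x' (y, y'))
      - integral Q (\<lambda>t. psi r x x' t * (smoothed \<rho> Y n (fst t) * smoothed \<rho> Y n (snd t)))
     = (\<Sum>y\<in>Y. \<Sum>y'\<in>Y. n y * n y' * (psi r x x' (y, y') - integral Q (\<lambda>t. psi r x x' t * b y y' t)))"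
    by (simp only: sum_subtractf right_diff_distrib)
  have "\<bar>\<Sum>y\<in>Y. \<Sum>y'\<in>Y. n y * n y' * (psi r x x' (y, y') - integral Q (\<lambda>t. psi r x x' t * b y y' t))\<bar>
    \<le> (\<Sum>y\<in>Y. \<Sum>y'\<in>Y. n y * n y' * (12 * L * \<rho> / r\<^sup>2 * (if \<bar>f x y - f x' y'\<bar> \<le> 12 * r then 1 else 0)))"
  proof (rule order_trans[OF sum_abs], rule sum_mono, rule order_trans[OF sum_abs], rule sum_mono)
    fix y y' assume y: "y \<in> Y" "y' \<in> Y"
    define M where "M = 12 * L * \<rho> / r\<^sup>2 * (if \<bar>f x y - f x' y'\<bar> \<le> 12 * r then 1 else 0)"
    have yJ: "y \<in> {j0..j1}" "y' \<in> {j0..j1}"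
      using Y(3)[OF y(1)] Y(4)[OF y(1)] Y(3)[OF y(2)] Y(4)[OF y(2)] \<rho> by auto
    have "psi r x x' (y, y') - integral Q (\<lambda>t. psi r x x' t * b y y' t)
       = integral Q (\<lambda>t. psi r x x' (y, y') * b y y' t) - integral Q (\<lambda>t. psi r x x' t * b y y' t)"
      using int_b[OF y] by simp
    also have "\<dots> = integral Q (\<lambda>t. psi r x x' (y, y') * b y y' t - psi r x x' t * b y y' t)"
      by (intro integral_diff[symmetric] integrable_continuous continuous_intros cp cb)
    finally have eq: "psi r x x' (y, y') - integral Q (\<lambda>t. psi r x x' t * b y y' t)
       = integral Q (\<lambda>t. psi r x x' (y, y') * b y y' t - psi r x x' t * b y y' t)" .
    have "\<bar>integral Q (\<lambda>t. psi r x x' (y, y') * b y y' t - psi r x x' t * b y y' t)\<bar>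
       \<le> integral Q (\<lambda>t. M * b y y' t)"
    proof (rule abs_integral_le)
      fix t assume t: "t \<in> Q"
      then obtain z z' where z: "t = (z, z')" "z \<in> {j0..j1}" "z' \<in> {j0..j1}"
        by (cases t) (auto simp: cbox_Pair_eq)
      show "\<bar>psi r x x' (y, y') * b y y' t - psi r x x' t * b y y' t\<bar> \<le> M * b y y' t"
      proof (cases "b y y' t = 0")
        case False
        then have "mollifier \<rho> y z \<noteq> 0" "mollifier \<rho> y' z' \<noteq> 0" by (auto simp: b_def z)
        then have near: "\<bar>y - z\<bar> \<le> 3 * \<rho>" "\<bar>y' - z'\<bar> \<le> 3 * \<rho>"
          using mollifier_eq_0[OF \<rho>(1), of z y] mollifier_eq_0[OF \<rho>(1), of z' y'] by force+
        have "\<bar>f x y - f x z\<bar> \<le> L * (3 * \<rho>)" 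
          using f_y_upper[OF x(1) z(2) yJ(1)] mult_left_mono[OF near(1), of L] L_pos by linarith
        moreover have "\<bar>f x' y' - f x' z'\<bar> \<le> L * (3 * \<rho>)" 
          using f_y_upper[OF x(2) z(3) yJ(2)] mult_left_mono[OF near(2), of L] L_pos by linarith
        ultimately have diff: "\<bar>(f x y - f x' y') - (f x z - f x' z')\<bar> \<le> 6 * (L * \<rho>)" by linarith
        have "\<bar>psi r x x' (y, y') - psi r x x' t\<bar> \<le> M"
        proof (cases "\<bar>f x y - f x' y'\<bar> \<le> 12 * r")
          case True
          have "\<bar>psi r x x' (y, y') - psi r x x' t\<bar> \<le> 2 / r\<^sup>2 * \<bar>(f x y - f x' y') - (f x z - f x' z')\<bar>"
            unfolding psi_def z by (simp only: case_prod_conv) (rule bump_diff_lipschitz[OF r])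
          also have "\<dots> \<le> 2 / r\<^sup>2 * (6 * (L * \<rho>))" using diff by (intro mult_left_mono) auto
          finally show ?thesis using True by (simp add: M_def)
        next
          case False
          then have "6 * r \<le> \<bar>f x y - f x' y'\<bar>" "6 * r \<le> \<bar>f x z - f x' z'\<bar>"
            using diff \<rho>(2) r by linarith+
          then have "psi r x x' (y, y') = 0" "psi r x x' t = 0"
            using bump_diff_eq_0[OF r] by (auto simp: psi_def z)
          then show ?thesis using L_pos \<rho> by (simp add: M_def)
        qed
        then have "\<bar>psi r x x' (y, y') - psi r x x' t\<bar> * b y y' t \<le> M * b y y' t"
          using b0 by (intro mult_right_mono) auto
        then show ?thesis using b0[of y y' t] by (simp add: left_diff_distrib[symmetric] abs_mult)
      qed simp
    next
      show "(\<lambda>t. psi r x x' (y, y') * b y y' t - psi r x x' t * b y y' t) integrable_on Q"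
        "(\<lambda>t. M * b y y' t) integrable_on Q"
        by (intro integrable_continuous continuous_intros cp cb)+
    qed
    then have "\<bar>psi r x x' (y, y') - integral Q (\<lambda>t. psi r x x' t * b y y' t)\<bar> \<le> M"
      unfolding eq using int_b[OF y] by simp
    then show "\<bar>n y * n y' * (psi r x x' (y, y') - integral Q (\<lambda>t. psi r x x' t * b y y' t))\<bar>
       \<le> n y * n y' * (12 * L * \<rho> / r\<^sup>2 * (if \<bar>f x y - f x' y'\<bar> \<le> 12 * r then 1 else 0))"
      unfolding M_def[symmetric] using Y(2)[OF y(1)] Y(2)[OF y(2)] by (simp add: abs_mult mult_left_mono)
  qed
  also have "\<dots> = 12 * L * \<rho> / r\<^sup>2 * (\<Sum>y\<in>Y. \<Sum>y'\<in>Y. n y * n y' * (if \<bar>f x y - f x' y'\<bar> \<le> 12 * r then 1 else 0))"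
    unfolding sum_distrib_left by (intro sum.cong refl) (simp add: mult_ac)
  finally show ?thesis unfolding eq .
qed

definition "step_constant s b C g =
  C * C * (C * (C * (12 * L) powr b))
  + C * C * (12 * L * (C * (C * (24 * L) powr b)))
  + (energy_constant s C + (C * 3 powr b)\<^sup>2 * (C * C) / (g / 2) ^ 4)"

text \<open>
  The bound for the contribution of the dyadic scale \<open>r\<close> to the count of nearly coinciding values.
  Its three terms come from the pairs closer than \<open>d\<close>, from replacing the weight on \<open>Y\<close> by its
  mollification at scale \<open>\<rho>\<close>, and from the Cauchy-Schwarz inequality, respectively.
\<close>

lemma scale_bound:
  assumes s: "0 < s" "s < 1" and b: "0 < b"
    and F: "frostman s C \<delta> X m" and X: "X \<subseteq> {i0..i1}"
    and G: "frostman b C \<delta> Y n" and g: "0 < g" and Y: "Y \<subseteq> {j0 + g..j1 - g}"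
    and r: "\<delta> \<le> r" and d: "\<delta> \<le> d" and \<rho>: "\<delta> \<le> \<rho>" "L * \<rho> \<le> r" "6 * \<rho> \<le> g"
  shows "\<bar>\<Sum>p\<in>X \<times> X. m (fst p) * m (snd p) * (\<Sum>y\<in>Y. \<Sum>y'\<in>Y. n y * n y' * psi r (fst p) (snd p) (y, y'))\<bar>
    \<le> step_constant s b C g *
      (r powr (b - 1) * d powr s + \<rho> * r powr (b - 2) + r powr (s - 1 / 2) * d powr (- s / 2) * \<rho> powr (b - 1))"
proof -
  note f = frostmanD[OF F] and h = frostmanD[OF G]
  have C: "0 \<le> C" by (rule frostman_constant_nonneg[OF F])
  have r0: "0 < r" and d0: "0 < d" and \<rho>0: "0 < \<rho>" using f(1) r d \<rho> by linarith+
  have K0: "0 < K" using K_ge by linarith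
  have YJ: "Y \<subseteq> {j0..j1}" using Y g by fastforce
  have mtot: "(\<Sum>x\<in>X. m x) \<le> C" by (rule frostman_total_le[OF F X i1_minus_i0_le])
  have ntot: "(\<Sum>y\<in>Y. n y) \<le> C" by (rule frostman_total_le[OF G YJ j01(2)])
  have m0: "0 \<le> (\<Sum>x\<in>X. m x)" using f(4) by (intro sum_nonneg) auto
  have n0: "0 \<le> (\<Sum>y\<in>Y. n y)" using h(4) by (intro sum_nonneg) auto
  let ?P = "{p \<in> X \<times> X. d \<le> \<bar>fst p - snd p\<bar>}" and ?D = "{p \<in> X \<times> X. \<bar>fst p - snd p\<bar> < d}"
  define w where "w p = m (fst p) * m (snd p)" for p :: "real \<times> real"
  define S where "S p = (\<Sum>y\<in>Y. \<Sum>y'\<in>Y. n y * n y' * psi r (fst p) (snd p) (y, y'))" for p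
  define N where "N t = smoothed \<rho> Y n (fst t) * smoothed \<rho> Y n (snd t)" for t :: "real \<times> real"
  have fin: "finite ?P" "finite ?D" "finite (X \<times> X)" using f(3) by auto
  have w0: "0 \<le> w p" if "p \<in> X \<times> X" for p using that f(4) by (auto simp: w_def)
  have PI: "fst p \<in> {i0..i1}" "snd p \<in> {i0..i1}" if "p \<in> X \<times> X" for p using that X by auto
  have wtot: "(\<Sum>p\<in>X \<times> X. w p) \<le> C * C"
  proof -
    have "(\<Sum>p\<in>X \<times> X. w p) = (\<Sum>x\<in>X. m x) * (\<Sum>x\<in>X. m x)"
      by (simp add: w_def sum.cartesian_product' sum_product)
    then show ?thesis using mtot m0 C by (simp add: mult_mono)
  qed
  have Sabs: "\<bar>S p\<bar> \<le> C * (1 / r * (C * (12 * L * r) powr b))" if p: "p \<in> X \<times> X" for p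
  proof -
    have "\<bar>S p\<bar> \<le> (\<Sum>y\<in>Y. n y * (\<Sum>y'\<in>Y. n y' * \<bar>bump_diff r (f (fst p) y - f (snd p) y')\<bar>))"
      unfolding S_def sum_distrib_left
      by (rule order_trans[OF sum_abs], rule sum_mono, rule order_trans[OF sum_abs], rule sum_mono)
        (use h(4) in \<open>simp add: psi_def abs_mult mult_ac\<close>)
    also have "\<dots> \<le> (\<Sum>y\<in>Y. n y * (1 / r * (C * (2 * 6 * L * r) powr b)))"
      by (intro sum_mono mult_left_mono slice_sum_le_y[OF G YJ PI(2)[OF p] r] abs_bump_diff_le bump_diff_eq_0 r0)
        (use h(4) in auto)
    also have "\<dots> = (\<Sum>y\<in>Y. n y) * (1 / r * (C * (12 * L * r) powr b))"
      by (simp only: sum_distrib_right) simp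
    also have "\<dots> \<le> C * (1 / r * (C * (12 * L * r) powr b))"
      using ntot C r0 by (intro mult_right_mono) auto
    finally show ?thesis .
  qed
  have "\<bar>\<Sum>p\<in>?D. w p * S p\<bar> \<le> (\<Sum>p\<in>?D. w p * (C * (1 / r * (C * (12 * L * r) powr b))))"
  proof (rule order_trans[OF sum_abs], rule sum_mono)
    fix p assume "p \<in> ?D"
    then have p: "p \<in> X \<times> X" by simp
    have "\<bar>w p * S p\<bar> = w p * \<bar>S p\<bar>" using w0[OF p] by (simp add: abs_mult)
    then show "\<bar>w p * S p\<bar> \<le> w p * (C * (1 / r * (C * (12 * L * r) powr b)))"
      using mult_left_mono[OF Sabs[OF p] w0[OF p]] by linarith
  qed
  also have "\<dots> = (\<Sum>p\<in>?D. w p) * (C * (1 / r * (C * (12 * L * r) powr b)))"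
    by (rule sum_distrib_right[symmetric])
  also have "\<dots> \<le> (C * (C * d powr s)) * (C * (1 / r * (C * (12 * L * r) powr b)))"
  proof (rule mult_right_mono)
    have "?D = Sigma X (\<lambda>x. {x' \<in> X. \<bar>x' - x\<bar> < d})" by (auto simp: abs_minus_commute)
    then have "(\<Sum>p\<in>?D. w p) = (\<Sum>x\<in>X. \<Sum>x'\<in>{x' \<in> X. \<bar>x' - x\<bar> < d}. w (x, x'))"
      using f(3) by (subst sum.Sigma) auto
    also have "\<dots> = (\<Sum>x\<in>X. m x * (\<Sum>x'\<in>{x' \<in> X. \<bar>x' - x\<bar> < d}. m x'))"
      by (simp add: w_def sum_distrib_left)
    also have "\<dots> \<le> (\<Sum>x\<in>X. m x * (C * d powr s))"
    proof (intro sum_mono mult_left_mono)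
      fix x
      have "(\<Sum>x'\<in>{x' \<in> X. \<bar>x' - x\<bar> < d}. m x') \<le> (\<Sum>x'\<in>{x' \<in> X. \<bar>x' - x\<bar> \<le> d}. m x')"
        using f by (intro sum_mono2) auto
      also have "\<dots> \<le> C * d powr s" by (rule f(5)[OF d])
      finally show "(\<Sum>x'\<in>{x' \<in> X. \<bar>x' - x\<bar> < d}. m x') \<le> C * d powr s" .
    qed (use f(4) in auto)
    also have "\<dots> = (\<Sum>x\<in>X. m x) * (C * d powr s)" by (rule sum_distrib_right[symmetric])
    also have "\<dots> \<le> C * (C * d powr s)" using mtot C by (intro mult_right_mono) auto
    finally show "(\<Sum>p\<in>?D. w p) \<le> C * (C * d powr s)" .
  qed (use C r0 in auto)
  also have "\<dots> = C * C * (C * (C * (12 * L) powr b)) * (r powr (b - 1) * d powr s)"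
    using r0 L_pos by (simp add: powr_mult powr_diff)
  finally have diag: "\<bar>\<Sum>p\<in>?D. w p * S p\<bar> \<le> C * C * (C * (C * (12 * L) powr b)) * (r powr (b - 1) * d powr s)" .

  have smooth1: "\<bar>S p - integral Q (\<lambda>t. psi r (fst p) (snd p) t * N t)\<bar> \<le> 12 * L * \<rho> / r\<^sup>2 * (C * (C * (24 * L * r) powr b))"
    if p: "p \<in> X \<times> X" for p
  proof -
    have A: "\<bar>S p - integral Q (\<lambda>t. psi r (fst p) (snd p) t * N t)\<bar> \<le>
      12 * L * \<rho> / r\<^sup>2 * (\<Sum>y\<in>Y. \<Sum>y'\<in>Y. n y * n y' * (if \<bar>f (fst p) y - f (snd p) y'\<bar> \<le> 12 * r then 1 else 0))"
      unfolding S_def N_def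
    proof (rule psi_smoothing[OF PI(1)[OF p] PI(2)[OF p] r0 \<rho>0 \<rho>(2) h(3,4)])
      fix y assume "y \<in> Y"
      then have "j0 + g \<le> y" "y \<le> j1 - g" using Y by auto
      then show "j0 \<le> y - 3 * \<rho>" "y + 3 * \<rho> \<le> j1" using \<rho>(3) \<rho>0 by linarith+
    qed
    have "(\<Sum>y\<in>Y. \<Sum>y'\<in>Y. n y * n y' * (if \<bar>f (fst p) y - f (snd p) y'\<bar> \<le> 12 * r then 1 else 0))
       = (\<Sum>y\<in>Y. n y * (\<Sum>y'\<in>{y' \<in> Y. \<bar>f (snd p) y' - f (fst p) y\<bar> \<le> 12 * r}. n y'))"
      using h(3) by (intro sum.cong refl) 
        (simp add: sum_distrib_left sum.inter_filter abs_minus_commute if_distrib cong: if_cong)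
    also have "\<dots> \<le> (\<Sum>y\<in>Y. n y * (C * (2 * L * (12 * r)) powr b))"
    proof (intro sum_mono mult_left_mono slice_y[OF G YJ PI(2)[OF p]])
      have "1 * r \<le> L * r" using L r0 by (intro mult_right_mono) auto
      then have "\<delta> \<le> 24 * (L * r)" using r r0 by linarith
      then show "\<delta> \<le> 2 * L * (12 * r)" by simp
    qed (use h(4) in auto)
    also have "\<dots> = (\<Sum>y\<in>Y. n y) * (C * (24 * L * r) powr b)" by (simp only: sum_distrib_right) (simp add: mult_ac)
    also have "\<dots> \<le> C * (C * (24 * L * r) powr b)" using ntot C by (intro mult_right_mono) auto
    finally show ?thesis
      by (rule order_trans[OF A mult_left_mono]) (use L_pos \<rho>0 in auto)
  qed
  have "\<bar>(\<Sum>p\<in>?P. w p * S p) - (\<Sum>p\<in>?P. w p * integral Q (\<lambda>t. psi r (fst p) (snd p) t * N t))\<bar>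
     = \<bar>\<Sum>p\<in>?P. w p * (S p - integral Q (\<lambda>t. psi r (fst p) (snd p) t * N t))\<bar>"
    by (simp only: sum_subtractf right_diff_distrib)
  also have "\<dots> \<le> (\<Sum>p\<in>?P. w p * (12 * L * \<rho> / r\<^sup>2 * (C * (C * (24 * L * r) powr b))))"
  proof (rule order_trans[OF sum_abs], rule sum_mono)
    fix p assume "p \<in> ?P"
    then have p: "p \<in> X \<times> X" by simp
    have "\<bar>w p * (S p - integral Q (\<lambda>t. psi r (fst p) (snd p) t * N t))\<bar>
      = w p * \<bar>S p - integral Q (\<lambda>t. psi r (fst p) (snd p) t * N t)\<bar>" using w0[OF p] by (simp add: abs_mult)
    then show "\<bar>w p * (S p - integral Q (\<lambda>t. psi r (fst p) (snd p) t * N t))\<bar> \<le> w p * (12 * L * \<rho> / r\<^sup>2 * (C * (C * (24 * L * r) powr b)))"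
      using mult_left_mono[OF smooth1[OF p] w0[OF p]] by linarith
  qed
  also have "\<dots> = (\<Sum>p\<in>?P. w p) * (12 * L * \<rho> / r\<^sup>2 * (C * (C * (24 * L * r) powr b)))"
    by (rule sum_distrib_right[symmetric])
  also have "\<dots> \<le> (C * C) * (12 * L * \<rho> / r\<^sup>2 * (C * (C * (24 * L * r) powr b)))"
  proof (rule mult_right_mono)
    have "(\<Sum>p\<in>?P. w p) \<le> (\<Sum>p\<in>X \<times> X. w p)" using w0 fin by (intro sum_mono2) auto
    then show "(\<Sum>p\<in>?P. w p) \<le> C * C" using wtot by linarith
  qed (use C L_pos \<rho>0 in auto)
  also have "\<dots> = C * C * (12 * L * (C * (C * (24 * L) powr b))) * (\<rho> * r powr (b - 2))"
  proof -
    have "r powr (b - 2) = r powr b / r\<^sup>2" using r0 by (simp add: powr_diff)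
    then show ?thesis using r0 L_pos by (simp add: powr_mult)
  qed
  finally have smooth: "\<bar>(\<Sum>p\<in>?P. w p * S p) - (\<Sum>p\<in>?P. w p * integral Q (\<lambda>t. psi r (fst p) (snd p) t * N t))\<bar>
     \<le> C * C * (12 * L * (C * (C * (24 * L) powr b))) * (\<rho> * r powr (b - 2))" .

  define T where "T t = (\<Sum>p\<in>?P. w p * psi r (fst p) (snd p) t)" for t
  define E where "E = r powr (s - 1 / 2) * d powr (- s / 2) * \<rho> powr (b - 1)"
  \<comment> \<open>The weight in \<open>\<bar>T * N\<bar> \<le> \<sigma> / 2 * chi * T^2 + N^2 / (2
    * \<sigma> * chi)\<close>, used in place of Cauchy-Schwarz. It is the quotient of the powers in
    the bounds for the norms of \<open>N\<close> and of \<open>T\<close>, so that both halves become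
    multiples of \<open>E\<close>.\<close>
  define \<sigma> where "\<sigma> = r powr (1 / 2 - s) * d powr (s / 2) * \<rho> powr (b - 1)"
  define c where "c = (g / 2) ^ 4"
  have \<sigma>0: "0 < \<sigma>" using r0 d0 \<rho>0 by (simp add: \<sigma>_def)
  have c0: "0 < c" using g by (simp add: c_def)
  have cp: "continuous_on Q (psi r (fst p) (snd p))" if "p \<in> ?P" for p
    using continuous_psi(1)[OF PI r0] that by blast
  have cT: "continuous_on Q T" unfolding T_def[abs_def] by (intro continuous_intros cp)
  have cN: "continuous_on Q N" unfolding N_def[abs_def] by (intro continuous_intros continuous_on_smoothed \<rho>0)
  have intT: "(\<Sum>p\<in>?P. w p * integral Q (\<lambda>t. psi r (fst p) (snd p) t * N t)) = integral Q (\<lambda>t. T t * N t)"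
  proof -
    have "integral Q (\<lambda>t. T t * N t) = integral Q (\<lambda>t. \<Sum>p\<in>?P. w p * (psi r (fst p) (snd p) t * N t))"
      unfolding T_def sum_distrib_right by (intro integral_cong sum.cong refl) simp
    also have "\<dots> = (\<Sum>p\<in>?P. integral Q (\<lambda>t. w p * (psi r (fst p) (snd p) t * N t)))"
      by (intro integral_sum fin integrable_continuous continuous_intros cp cN)
    finally show ?thesis by (simp only: integral_mult_right)
  qed
  have N0: "0 \<le> N t" for t unfolding N_def using smoothed_le(1)[OF G \<rho>(1)] by simp
  \<comment> \<open>By \<open>6 * \<rho> \<le> g\<close> the mollified weight stays at distance
    \<open>g / 2\<close> from the sides, and \<open>chi\<close> is a product of four distances to
    sides.\<close>
  have chi_ge: "c \<le> chi t" if t: "t \<in> Q" "N t \<noteq> 0" for t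
  proof -
    have *: "(g / 2)\<^sup>2 \<le> (y - j0) * (j1 - y)" if y: "smoothed \<rho> Y n y \<noteq> 0" for y
    proof -
      obtain z where z: "z \<in> Y" "mollifier \<rho> z y \<noteq> 0"
      proof -
        have "\<exists>z\<in>Y. mollifier \<rho> z y \<noteq> 0"
        proof (rule ccontr)
          assume "\<not> (\<exists>z\<in>Y. mollifier \<rho> z y \<noteq> 0)"
          then have "smoothed \<rho> Y n y = 0" by (simp add: smoothed_def)
          then show False using y by simp
        qed
        then show ?thesis using that by blast
      qed
      then have "\<bar>y - z\<bar> < 3 * \<rho>" using mollifier_eq_0[OF \<rho>0, of y z] by force
      moreover have "j0 + g \<le> z" "z \<le> j1 - g" using z Y by auto
      ultimately have "g / 2 \<le> y - j0" "g / 2 \<le> j1 - y" using \<rho>(3) by linarith+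
      then show ?thesis unfolding power2_eq_square using g by (intro mult_mono) auto
    qed
    have "(g / 2)\<^sup>2 * (g / 2)\<^sup>2 \<le> (fst t - j0) * (j1 - fst t) * ((snd t - j0) * (j1 - snd t))"
    proof (rule mult_mono)
      have nz: "smoothed \<rho> Y n (fst t) \<noteq> 0" "smoothed \<rho> Y n (snd t) \<noteq> 0" using t(2) by (auto simp: N_def)
      show "(g / 2)\<^sup>2 \<le> (fst t - j0) * (j1 - fst t)" "(g / 2)\<^sup>2 \<le> (snd t - j0) * (j1 - snd t)"
        using *[OF nz(1)] *[OF nz(2)] .
      show "0 \<le> (fst t - j0) * (j1 - fst t)" by (rule order_trans[OF _ *[OF nz(1)]]) simp
    qed simp
    then show ?thesis by (simp add: chi_def c_def case_prod_unfold power_numeral_reduce mult_ac)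
  qed
  have "\<bar>integral Q (\<lambda>t. T t * N t)\<bar> \<le> integral Q (\<lambda>t. \<sigma> / 2 * (chi t * (T t)\<^sup>2) + 1 / (2 * \<sigma> * c) * (N t)\<^sup>2)"
  proof (rule abs_integral_le)
    show "(\<lambda>t. T t * N t) integrable_on Q" by (intro integrable_continuous continuous_intros cT cN)
    show "(\<lambda>t. \<sigma> / 2 * (chi t * (T t)\<^sup>2) + 1 / (2 * \<sigma> * c) * (N t)\<^sup>2) integrable_on Q" 
      by (intro integrable_continuous continuous_intros cT cN continuous_chi)
    fix t assume t: "t \<in> Q"
    show "\<bar>T t * N t\<bar> \<le> \<sigma> / 2 * (chi t * (T t)\<^sup>2) + 1 / (2 * \<sigma> * c) * (N t)\<^sup>2"
    proof (cases "N t = 0")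
      case True
      then show ?thesis using \<sigma>0 chi_nonneg[OF t] by simp
    next
      case False
      have "0 \<le> (\<sigma> * c * \<bar>T t\<bar> - N t)\<^sup>2" by simp
      then have "2 * (\<sigma> * c) * (\<bar>T t\<bar> * N t) \<le> (\<sigma> * c)\<^sup>2 * (T t)\<^sup>2 + (N t)\<^sup>2"
        by (simp add: power2_diff power_mult_distrib mult_ac)
      then have "2 * (\<sigma> * c) * (\<bar>T t\<bar> * N t) / (2 * (\<sigma> * c)) \<le> ((\<sigma> * c)\<^sup>2 * (T t)\<^sup>2 + (N t)\<^sup>2) / (2 * (\<sigma> * c))"
        using \<sigma>0 c0 by (intro divide_right_mono) auto
      then have A: "\<bar>T t\<bar> * N t \<le> \<sigma> / 2 * (c * (T t)\<^sup>2) + 1 / (2 * \<sigma> * c) * (N t)\<^sup>2"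
        using \<sigma>0 c0 by (simp add: add_divide_distrib power2_eq_square)
      have "\<sigma> / 2 * (c * (T t)\<^sup>2) \<le> \<sigma> / 2 * (chi t * (T t)\<^sup>2)"
        using chi_ge[OF t False] \<sigma>0 by (intro mult_left_mono mult_right_mono) auto
      moreover have "\<bar>T t * N t\<bar> = \<bar>T t\<bar> * N t" using N0[of t] by (simp add: abs_mult)
      ultimately show ?thesis using A by linarith
    qed
  qed
  also have "\<dots> = \<sigma> / 2 * integral Q (\<lambda>t. chi t * (T t)\<^sup>2) + 1 / (2 * \<sigma> * c) * integral Q (\<lambda>t. (N t)\<^sup>2)"
  proof -
    have "integral Q (\<lambda>t. \<sigma> / 2 * (chi t * (T t)\<^sup>2) + 1 / (2 * \<sigma> * c) * (N t)\<^sup>2)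
       = integral Q (\<lambda>t. \<sigma> / 2 * (chi t * (T t)\<^sup>2)) + integral Q (\<lambda>t. 1 / (2 * \<sigma> * c) * (N t)\<^sup>2)"
      by (intro integral_add integrable_continuous continuous_intros cT cN continuous_chi)
    then show ?thesis by (simp only: integral_mult_right)
  qed
  also have "\<dots> \<le> \<sigma> / 2 * (energy_constant s C * (r powr (2 * s - 1) * d powr (- s)))
     + 1 / (2 * \<sigma> * c) * ((C * 3 powr b * \<rho> powr (b - 1))\<^sup>2 * (C * C))"
  proof (intro add_mono mult_left_mono)
    show "integral Q (\<lambda>t. chi t * (T t)\<^sup>2) \<le> energy_constant s C * (r powr (2 * s - 1) * d powr (- s))"
      using energy_le[OF s F X r d] by (simp add: T_def w_def)
    define B where "B = C * 3 powr b * \<rho> powr (b - 1)"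
    have dB: "0 \<le> smoothed \<rho> Y n y" "smoothed \<rho> Y n y \<le> B" for y
      unfolding B_def by (rule smoothed_le[OF G \<rho>(1)])+
    have B0: "0 \<le> B" using dB[of 0] by linarith
    have cd: "continuous_on {j0..j1} (smoothed \<rho> Y n)"
      using continuous_on_smoothed[OF \<rho>0 continuous_on_id] by simp
    have "integral {j0..j1} (smoothed \<rho> Y n) = (\<Sum>y\<in>Y. integral {j0..j1} (\<lambda>z. n y * mollifier \<rho> y z))"
      unfolding smoothed_def[abs_def]
      by (intro integral_sum h(3) integrable_continuous_interval continuous_intros continuous_on_mollifier \<rho>0)
    also have "\<dots> = (\<Sum>y\<in>Y. n y)"
    proof (rule sum.cong[OF refl])
      fix y assume "y \<in> Y"
      then have "j0 + g \<le> y" "y \<le> j1 - g" using Y by auto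
      then have "j0 \<le> y - 3 * \<rho>" "y + 3 * \<rho> \<le> j1" using \<rho>(3) \<rho>0 by linarith+
      then show "integral {j0..j1} (\<lambda>z. n y * mollifier \<rho> y z) = n y"
        using integral_mollifier[OF \<rho>0] by (simp add: integral_mult_right)
    qed
    finally have id: "integral {j0..j1} (smoothed \<rho> Y n) = (\<Sum>y\<in>Y. n y)" .
    \<comment> \<open>Only one factor \<open>N\<close> is replaced by the bound \<open>B^2\<close>;
      the other integrates to the square of the total weight. The norm of \<open>N\<close> therefore
      loses a single factor \<open>\<rho> powr (b - 1)\<close>.\<close>
    have "integral Q (\<lambda>t. (N t)\<^sup>2) \<le> integral Q (\<lambda>t. B\<^sup>2 * N t)"
    proof (rule integral_le)
      show "(\<lambda>t. (N t)\<^sup>2) integrable_on Q" "(\<lambda>t. B\<^sup>2 * N t) integrable_on Q"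
        by (intro integrable_continuous continuous_intros cN)+
      fix t
      have "N t \<le> B * B" unfolding N_def using dB B0 by (intro mult_mono) auto
      then show "(N t)\<^sup>2 \<le> B\<^sup>2 * N t" using N0[of t] by (simp add: power2_eq_square mult_right_mono)
    qed
    also have "\<dots> = B\<^sup>2 * integral Q N" by (rule integral_mult_right)
    also have "\<dots> = B\<^sup>2 * ((\<Sum>y\<in>Y. n y) * (\<Sum>y\<in>Y. n y))"
      unfolding N_def[abs_def] integral_product[OF cd cd] id ..
    also have "B\<^sup>2 * ((\<Sum>y\<in>Y. n y) * (\<Sum>y\<in>Y. n y)) \<le> B\<^sup>2 * (C * C)"
      using ntot n0 C by (intro mult_left_mono mult_mono) auto
    finally show "integral Q (\<lambda>t. (N t)\<^sup>2) \<le> (C * 3 powr b * \<rho> powr (b - 1))\<^sup>2 * (C * C)" by (simp add: B_def)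
  qed (use \<sigma>0 c0 in auto)
  also have "\<dots> = 1 / 2 * (energy_constant s C + (C * 3 powr b)\<^sup>2 * (C * C) / c) * E"
  proof -
    have 1: "\<sigma> * (r powr (2 * s - 1) * d powr (- s)) = E"
    proof -
      have "r powr (1 / 2 - s) * r powr (2 * s - 1) = r powr (s - 1 / 2)"
        by (simp only: powr_add[symmetric]) simp
      moreover have "d powr (s / 2) * d powr (- s) = d powr (- s / 2)"
        by (simp only: powr_add[symmetric]) simp
      ultimately show ?thesis by (simp add: \<sigma>_def E_def mult_ac)
    qed
    have 2: "(\<rho> powr (b - 1))\<^sup>2 / \<sigma> = E"
    proof -
      have "\<sigma> * E = (r powr (1 / 2 - s) * r powr (s - 1 / 2)) * (d powr (s / 2) * d powr (- s / 2)) * (\<rho> powr (b - 1))\<^sup>2"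
        by (simp add: \<sigma>_def E_def power2_eq_square mult_ac)
      also have "\<dots> = (\<rho> powr (b - 1))\<^sup>2"
        using r0 d0 by (simp add: powr_add[symmetric])
      finally have "(\<rho> powr (b - 1))\<^sup>2 = E * \<sigma>" by (simp only: mult.commute)
      then show ?thesis using \<sigma>0 by simp
    qed
    have "1 / (2 * \<sigma> * c) * ((C * 3 powr b * \<rho> powr (b - 1))\<^sup>2 * (C * C)) = 1 / 2 * ((C * 3 powr b)\<^sup>2 * (C * C) / c) * ((\<rho> powr (b - 1))\<^sup>2 / \<sigma>)"
      by (simp add: power_mult_distrib mult_ac)
    moreover have "\<sigma> / 2 * (energy_constant s C * (r powr (2 * s - 1) * d powr (- s))) = 1 / 2 * energy_constant s C * (\<sigma> * (r powr (2 * s - 1) * d powr (- s)))"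
      by simp
    ultimately show ?thesis unfolding 1 2 by (simp add: algebra_simps)
  qed
  finally have main': "\<bar>integral Q (\<lambda>t. T t * N t)\<bar> \<le> 1 / 2 * (energy_constant s C + (C * 3 powr b)\<^sup>2 * (C * C) / c) * E" .
  have s1: "2 powr (s - 1) < (1::real)" "2 powr (- s) < (1::real)"
    using s powr_less_mono[of "s - 1" 0 2] powr_less_mono[of "- s" 0 2] by simp_all
  have ec: "0 \<le> energy_constant s C"
    using C L_pos K0 s1 by (simp add: energy_constant_def near_constant_def far_constant_def)
  have E0: "0 \<le> E" by (simp add: E_def)
  have main: "\<bar>integral Q (\<lambda>t. T t * N t)\<bar> \<le> (energy_constant s C + (C * 3 powr b)\<^sup>2 * (C * C) / c) * E"
  proof -
    have "0 \<le> (energy_constant s C + (C * 3 powr b)\<^sup>2 * (C * C) / c) * E"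
      using ec E0 c0 C by (intro mult_nonneg_nonneg add_nonneg_nonneg) auto
    moreover have "A \<le> B" if "0 \<le> B" "A \<le> 1 / 2 * B" for A B :: real using that by linarith
    ultimately show ?thesis using main' by (simp only: mult.assoc)
  qed
  have "(\<Sum>p\<in>X \<times> X. w p * S p) = (\<Sum>p\<in>?D. w p * S p) + (\<Sum>p\<in>?P. w p * S p)"
  proof -
    have "X \<times> X = ?D \<union> ?P" by auto
    then have "(\<Sum>p\<in>X \<times> X. w p * S p) = (\<Sum>p\<in>?D \<union> ?P. w p * S p)" by (rule arg_cong)
    also have "\<dots> = (\<Sum>p\<in>?D. w p * S p) + (\<Sum>p\<in>?P. w p * S p)" using fin by (intro sum.union_disjoint) auto
    finally show ?thesis .
  qed
  then have "\<bar>\<Sum>p\<in>X \<times> X. w p * S p\<bar> \<le> C * C * (C * (C * (12 * L) powr b)) * (r powr (b - 1) * d powr s)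
     + C * C * (12 * L * (C * (C * (24 * L) powr b))) * (\<rho> * r powr (b - 2))
     + (energy_constant s C + (C * 3 powr b)\<^sup>2 * (C * C) / c) * E"
    using diag smooth main unfolding intT by linarith
  also have "\<dots> \<le> step_constant s b C g * (r powr (b - 1) * d powr s + \<rho> * r powr (b - 2) + E)"
  proof -
    have *: "a1 * e1 + a2 * e2 + a3 * e3 \<le> (a1 + a2 + a3) * (e1 + e2 + e3)"
      if "0 \<le> a1" "0 \<le> a2" "0 \<le> a3" "0 \<le> e1" "0 \<le> e2" "0 \<le> e3" for a1 a2 a3 e1 e2 e3 :: real
      using that by (simp add: algebra_simps)
    show ?thesis unfolding step_constant_def c_def[symmetric]
      by (rule *) (use C L_pos ec c0 E0 \<rho>0 in \<open>auto intro!: add_nonneg_nonneg mult_nonneg_nonneg divide_nonneg_pos\<close>)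
  qed
  finally show ?thesis by (simp add: w_def S_def E_def)
qed

section \<open>The count of nearly coinciding values over all scales\<close>

definition "pair_count r X m Y n =
  (\<Sum>p\<in>X \<times> X. m (fst p) * m (snd p) *
    (\<Sum>y\<in>Y. \<Sum>y'\<in>Y. n y * n y' * (bump ((f (fst p) y - f (snd p) y') / r) / r)))"

text \<open>The trivial count: for fixed \<open>x\<close>, \<open>x'\<close>, \<open>y\<close> the
  points \<open>y'\<close> lie in an interval of length a multiple of \<open>r\<close>, which costs
  \<open>r powr b\<close> against the normalisation \<open>1 / r\<close>. It settles the case
  \<open>w \<le> b\<close> and the finitely many coarse scales.\<close>

lemma pair_count_le:
  assumes F: "frostman s C \<delta> X m" and X: "X \<subseteq> {i0..i1}"
    and G: "frostman b C \<delta> Y n" and Y: "Y \<subseteq> {j0..j1}" and r: "\<delta> \<le> r"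
  shows "pair_count r X m Y n \<le> C * C * (C * (C * (6 * L) powr b)) * r powr (b - 1)"
proof -
  note f = frostmanD[OF F] and h = frostmanD[OF G]
  have C: "0 \<le> C" by (rule frostman_constant_nonneg[OF F])
  have r0: "0 < r" using f(1) r by linarith
  have mtot: "(\<Sum>x\<in>X. m x) \<le> C" by (rule frostman_total_le[OF F X i1_minus_i0_le])
  have ntot: "(\<Sum>y\<in>Y. n y) \<le> C" by (rule frostman_total_le[OF G Y j01(2)])
  have m0: "0 \<le> (\<Sum>x\<in>X. m x)" using f(4) by (intro sum_nonneg) auto
  let ?B = "1 / r * (C * (2 * 3 * L * r) powr b)"
  have g: "\<bar>bump (t / r) / r\<bar> \<le> 1 / r" "3 * r \<le> \<bar>t\<bar> \<Longrightarrow> bump (t / r) / r = 0" for t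
    using bump_nonneg[of "t / r"] bump_le_one[of "t / r"] bump_eq_0[of "t / r"] r0
    by (auto simp: divide_right_mono field_simps)
  have S: "(\<Sum>y\<in>Y. \<Sum>y'\<in>Y. n y * n y' * (bump ((f (fst p) y - f (snd p) y') / r) / r)) \<le> C * ?B"
    if p: "p \<in> X \<times> X" for p
  proof -
    have "(\<Sum>y\<in>Y. \<Sum>y'\<in>Y. n y * n y' * (bump ((f (fst p) y - f (snd p) y') / r) / r))
       = (\<Sum>y\<in>Y. n y * (\<Sum>y'\<in>Y. n y' * \<bar>bump ((f (fst p) y - f (snd p) y') / r) / r\<bar>))"
      unfolding sum_distrib_left using r0 bump_nonneg by (intro sum.cong refl) simp
    also have "\<dots> \<le> (\<Sum>y\<in>Y. n y * ?B)"
      by (intro sum_mono mult_left_mono slice_sum_le_y[OF G Y _ r, where g = "\<lambda>t. bump (t / r) / r"] g)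
        (use h(4) p X in auto)
    also have "\<dots> = (\<Sum>y\<in>Y. n y) * ?B" by (rule sum_distrib_right[symmetric])
    also have "\<dots> \<le> C * ?B" using ntot C r0 by (intro mult_right_mono) auto
    finally show ?thesis .
  qed
  have "pair_count r X m Y n \<le> (\<Sum>p\<in>X \<times> X. m (fst p) * m (snd p) * (C * ?B))"
    unfolding pair_count_def by (intro sum_mono mult_left_mono S) (use f(4) in auto)
  also have "\<dots> = (\<Sum>p\<in>X \<times> X. m (fst p) * m (snd p)) * (C * ?B)" by (rule sum_distrib_right[symmetric])
  also have "(\<Sum>p\<in>X \<times> X. m (fst p) * m (snd p)) = (\<Sum>x\<in>X. m x) * (\<Sum>x\<in>X. m x)"
    by (simp add: sum.cartesian_product' sum_product)
  also have "(\<Sum>x\<in>X. m x) * (\<Sum>x\<in>X. m x) * (C * ?B) \<le> C * C * (C * ?B)"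
    using mtot m0 C r0 by (intro mult_right_mono mult_mono) auto
  also have "C * C * (C * ?B) = C * C * (C * (C * (6 * L) powr b)) * r powr (b - 1)"
    using r0 L_pos by (simp add: powr_mult powr_diff)
  finally show ?thesis .
qed

text \<open>For \<open>w > b\<close> put \<open>z = w - b + e\<close> and choose
  \<open>d = r powr (z / s)\<close> and \<open>\<rho> = r powr (1 + z)\<close>. The first two terms
  of \<open>scale_bound\<close> are then exactly \<open>r powr (w - 1 + e)\<close>, and the third is
  no larger when \<open>z * (3 / 2 - b) \<le> s + b - 1 / 2 - w - e\<close>. The surplus
  \<open>e\<close> makes the sum over the scales geometric. Since \<open>z \<le> 1\<close> and
  \<open>z \<le> s\<close>, both \<open>\<rho>\<close> and \<open>d\<close> are at least
  \<open>r^2\<close>, and this is why the weights need the resolution \<open>r^2\<close>.\<close>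

lemma pair_count_bound:
  assumes s: "0 < s" "s \<le> b" "b < 1" and sb: "2 / 3 + w < s + b" and w: "w \<le> 1" and g: "0 < g" and C: "0 \<le> C"
  shows "\<exists>B. \<forall>X m Y n \<delta> j. frostman s C \<delta> X m \<longrightarrow> X \<subseteq> {i0..i1} \<longrightarrow> frostman b C \<delta> Y n \<longrightarrow>
    Y \<subseteq> {j0 + g..j1 - g} \<longrightarrow> \<delta> \<le> ((1 / 2) ^ j)\<^sup>2 \<longrightarrow> pair_count ((1 / 2) ^ j) X m Y n \<le> B * ((1 / 2) ^ j) powr (w - 1)"
proof -
  define B0 where "B0 = C * C * (C * (C * (6 * L) powr b))"
  have B0: "0 \<le> B0" using C by (simp add: B0_def)
  have b0: "0 < b" using s by linarith
  have pow: "\<delta> \<le> (1 / 2) ^ j" if "\<delta> \<le> ((1 / 2) ^ j)\<^sup>2" for \<delta> :: real and j :: nat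
  proof -
    have "((1 / 2) ^ j)\<^sup>2 \<le> ((1 / 2) ^ j :: real)" by (simp add: power2_eq_square mult_left_le power_le_one)
    then show ?thesis using that by linarith
  qed
  show ?thesis
  proof (cases "w \<le> b")
    case True
    show ?thesis
    proof (intro exI allI impI)
      fix X m Y n \<delta> j
      assume F: "frostman s C \<delta> X m" "X \<subseteq> {i0..i1}" "frostman b C \<delta> Y n" "Y \<subseteq> {j0 + g..j1 - g}" 
        "\<delta> \<le> ((1 / 2) ^ j)\<^sup>2"
      have "Y \<subseteq> {j0..j1}" using F(4) g by fastforce
      then have "pair_count ((1 / 2) ^ j) X m Y n \<le> B0 * ((1 / 2) ^ j) powr (b - 1)"
        unfolding B0_def by (rule pair_count_le[OF F(1-3) _ pow[OF F(5)]])
      also have "\<dots> \<le> B0 * ((1 / 2) ^ j) powr (w - 1)"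
        using True B0 by (intro mult_left_mono powr_mono') (auto simp: power_le_one)
      finally show "pair_count ((1 / 2) ^ j) X m Y n \<le> B0 * ((1 / 2) ^ j) powr (w - 1)" .
    qed
  next
    case False
    \<comment> \<open>Any small constant would do: the hypothesis leaves more than
      \<open>1 / 6 - e\<close> on the right of \<open>z_gap\<close>, while the left side will be at
      most \<open>1 / 9 + 3 / 200\<close>.\<close>
    define e :: real where "e = 1 / 100"
    define z where "z = w - b + e"
    have z: "0 < z" "z \<le> s" "z \<le> 1" using False s sb w by (auto simp: z_def e_def)
    have z_gap: "z * (3 / 2 - b) \<le> s + b - 1 / 2 - w - e"
    proof -
      \<comment> \<open>There are two bounds for \<open>w - b\<close>: \<open>1 - b\<close> from
        \<open>w \<le> 1\<close>, and \<open>b - 2 / 3\<close> from the hypothesis together with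
        \<open>s \<le> b\<close>. They cross at \<open>b = 5 / 6\<close>, where the product is
        \<open>1 / 6 * (2 / 3)\<close>.\<close>
      have "(w - b) * (3 / 2 - b) \<le> 1 / 9"
      proof (cases "5 / 6 \<le> b")
        case True
        have "(w - b) * (3 / 2 - b) \<le> (1 / 6) * (2 / 3)"
          using True False w s by (intro mult_mono) auto
        then show ?thesis by simp
      next
        case b: False
        have "(w - b) * (3 / 2 - b) \<le> (b - 2 / 3) * (3 / 2 - b)"
          using sb s by (intro mult_right_mono) auto
        also have "\<dots> = 1 / 9 - (5 / 6 - b) * (4 / 3 - b)" by (simp add: algebra_simps)
        also have "\<dots> \<le> 1 / 9" using b by simp
        finally show ?thesis .
      qed
      moreover have "e * (3 / 2 - b) \<le> 3 / 200" using b0 by (simp add: e_def)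
      moreover have "z * (3 / 2 - b) = (w - b) * (3 / 2 - b) + e * (3 / 2 - b)"
        by (simp add: z_def distrib_right)
      moreover have "e = 1 / 100" by (rule e_def)
      ultimately show ?thesis using sb by linarith
    qed
    define S where "S = 3 * step_constant s b C g"
    have s1: "2 powr (s - 1) < (1::real)" "2 powr (- s) < (1::real)"
      using s powr_less_mono[of "s - 1" 0 2] powr_less_mono[of "- s" 0 2] by simp_all
    have K0: "0 < K" using K_ge by linarith
    have ec: "0 \<le> energy_constant s C"
      using C L_pos K0 s1 by (simp add: energy_constant_def near_constant_def far_constant_def)
    have sc: "0 \<le> step_constant s b C g"
      unfolding step_constant_def using C L_pos ec by (intro add_nonneg_nonneg mult_nonneg_nonneg) auto
    have S0: "0 \<le> S" using sc by (simp add: S_def)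
    obtain J0 where J0: "(1 / 2) ^ J0 < (1 / L) powr (1 / z)"
      using real_arch_pow_inv[of "(1 / L) powr (1 / z)" "1 / 2"] L_pos by auto
    obtain J1 where J1: "(1 / 2) ^ J1 < g / 6"
      using real_arch_pow_inv[of "g / 6" "1 / 2"] g by auto
    \<comment> \<open>From level \<open>J\<close> on the scales satisfy
      \<open>L * \<rho> \<le> r\<close> and \<open>6 * \<rho> \<le> g\<close>. The successor ensures
      that \<open>j - 1\<close> is the next coarser level, so that \<open>2 * r\<close> is its
      scale.\<close>
    define J where "J = Suc (max J0 J1)"
    have step: "\<bar>pair_count ((1 / 2) ^ j) X m Y n - pair_count ((1 / 2) ^ (j - 1)) X m Y n\<bar> \<le> S * ((1 / 2) ^ j) powr (w - 1 + e)"
      if F: "frostman s C \<delta> X m" "X \<subseteq> {i0..i1}" "frostman b C \<delta> Y n" "Y \<subseteq> {j0 + g..j1 - g}" 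
        "\<delta> \<le> ((1 / 2) ^ j)\<^sup>2" and j: "J \<le> j" for X m Y n \<delta> j
    proof -
      define r :: real where "r = (1 / 2) ^ j"
      have r: "0 < r" "r \<le> 1" "\<delta> \<le> r" using pow[OF F(5)] by (auto simp: r_def power_le_one)
      have r2: "2 * r = (1 / 2) ^ (j - 1)" using j by (cases j) (auto simp: r_def J_def)
      define d where "d = r powr (z / s)"
      define \<rho> where "\<rho> = r powr (1 + z)"
      have d: "\<delta> \<le> d"
      proof -
        have "r powr 1 \<le> r powr (z / s)" using r z s by (intro powr_mono') auto
        then show ?thesis using r by (simp add: d_def)
      qed
      have \<rho>1: "\<delta> \<le> \<rho>"
      proof -
        have "r powr 2 \<le> r powr (1 + z)" using r z by (intro powr_mono') auto
        then show ?thesis using r F(5) by (simp add: \<rho>_def r_def[symmetric])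
      qed
      have \<rho>2: "L * \<rho> \<le> r"
      proof -
        have "r \<le> (1 / 2) ^ J0" unfolding r_def using j by (intro power_decreasing) (auto simp: J_def)
        then have "r \<le> (1 / L) powr (1 / z)" using J0 by linarith
        then have "r powr z \<le> ((1 / L) powr (1 / z)) powr z" using r z by (intro powr_mono2) auto
        also have "\<dots> = 1 / L" using z L_pos by (simp add: powr_powr)
        finally have "L * r powr z \<le> 1" using L_pos by (simp add: field_simps)
        then have "r * (L * r powr z) \<le> r * 1" using r by (intro mult_left_mono) auto
        then show ?thesis using r by (simp add: \<rho>_def powr_add mult_ac)
      qed
      have \<rho>3: "6 * \<rho> \<le> g"
      proof -
        have "r \<le> (1 / 2) ^ J1" unfolding r_def using j by (intro power_decreasing) (auto simp: J_def)
        moreover have "\<rho> \<le> r"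
        proof -
          have "r powr (1 + z) \<le> r powr 1" using r z by (intro powr_mono') auto
          then show ?thesis using r by (simp add: \<rho>_def)
        qed
        ultimately show ?thesis using J1 by linarith
      qed
      have "pair_count r X m Y n - pair_count (2 * r) X m Y n
        = (\<Sum>p\<in>X \<times> X. m (fst p) * m (snd p) * (\<Sum>y\<in>Y. \<Sum>y'\<in>Y. n y * n y' * psi r (fst p) (snd p) (y, y')))"
        unfolding pair_count_def psi_def bump_diff_def case_prod_conv
        by (simp only: right_diff_distrib sum_subtractf)
      then have "\<bar>pair_count r X m Y n - pair_count (2 * r) X m Y n\<bar> \<le> step_constant s b C g *
        (r powr (b - 1) * d powr s + \<rho> * r powr (b - 2) + r powr (s - 1 / 2) * d powr (- s / 2) * \<rho> powr (b - 1))"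
        using scale_bound[OF s(1) _ b0 F(1,2,3) g F(4) r(3) d \<rho>1 \<rho>2 \<rho>3] s by simp
      also have "\<dots> \<le> step_constant s b C g * (r powr (w - 1 + e) + r powr (w - 1 + e) + r powr (w - 1 + e))"
      proof (intro mult_left_mono sc add_mono)
        have "r powr (b - 1) * d powr s = r powr (b - 1 + z)"
          using s by (simp add: d_def powr_powr powr_add[symmetric])
        moreover have "b - 1 + z = w - 1 + e" by (simp add: z_def)
        ultimately show "r powr (b - 1) * d powr s \<le> r powr (w - 1 + e)" by (simp only: order_refl)
        have "\<rho> * r powr (b - 2) = r powr (1 + z + (b - 2))"
          by (simp only: \<rho>_def powr_add[symmetric])
        moreover have "1 + z + (b - 2) = w - 1 + e" by (simp add: z_def)
        ultimately show "\<rho> * r powr (b - 2) \<le> r powr (w - 1 + e)" by (simp only: order_refl)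
        have "d powr (- s / 2) = r powr (- (z / 2))" using s by (simp add: d_def powr_powr)
        moreover have "\<rho> powr (b - 1) = r powr ((1 + z) * (b - 1))" by (simp add: \<rho>_def powr_powr)
        ultimately have "r powr (s - 1 / 2) * d powr (- s / 2) * \<rho> powr (b - 1)
           = r powr (s - 1 / 2 + - (z / 2) + (1 + z) * (b - 1))"
          by (simp only: powr_add)
        also have "\<dots> \<le> r powr (w - 1 + e)"
          using r z_gap by (intro powr_mono') (auto simp: algebra_simps)
        finally show "r powr (s - 1 / 2) * d powr (- s / 2) * \<rho> powr (b - 1) \<le> r powr (w - 1 + e)" .
      qed
      also have "\<dots> = S * r powr (w - 1 + e)" by (simp add: S_def)
      finally show ?thesis unfolding r2 by (simp only: r_def)
    qed
    define A where "A = B0 * 2 ^ J"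
    have A0: "0 \<le> A" using B0 by (simp add: A_def)
    \<comment> \<open>Levels below \<open>J\<close> are covered by \<open>A\<close>. From
      \<open>J\<close> on each level adds \<open>S * q powr (w - 1 + e)\<close>, whose factor
      \<open>q powr e\<close> is the next term of the geometric sum; the bound inherited from
      coarser levels persists because \<open>q powr (w - 1)\<close> grows as \<open>q\<close>
      decreases.\<close>
    have main: "pair_count ((1 / 2) ^ j) X m Y n \<le> ((1 / 2) ^ j) powr (w - 1) * (A + S * (\<Sum>i<Suc j. ((1 / 2) powr e) ^ i))"
      if F: "frostman s C \<delta> X m" "X \<subseteq> {i0..i1}" "frostman b C \<delta> Y n" "Y \<subseteq> {j0 + g..j1 - g}" 
        "\<delta> \<le> ((1 / 2) ^ j)\<^sup>2" for X m Y n \<delta> j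
      using F(5)
    proof (induction j)
      case 0
      have c: "j < J \<Longrightarrow> \<delta> \<le> ((1 / 2) ^ j)\<^sup>2 \<Longrightarrow> pair_count ((1 / 2) ^ j) X m Y n \<le> A" for j
      proof -
        assume j: "j < J" "\<delta> \<le> ((1 / 2) ^ j)\<^sup>2"
        have "Y \<subseteq> {j0..j1}" using F(4) g by fastforce
        then have "pair_count ((1 / 2) ^ j) X m Y n \<le> B0 * ((1 / 2) ^ j) powr (b - 1)"
          unfolding B0_def by (rule pair_count_le[OF F(1-3) _ pow[OF j(2)]])
        also have "((1 / 2) ^ j :: real) powr (b - 1) \<le> ((1 / 2) ^ j) powr (-1)"
          using b0 by (intro powr_mono') (auto simp: power_le_one)
        also have "((1 / 2) ^ j :: real) powr (-1) = 2 ^ j" by (simp add: powr_minus_divide power_divide)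
        also have "(2 :: real) ^ j \<le> 2 ^ J" using j by (intro power_increasing) auto
        finally show ?thesis using B0 by (simp add: A_def mult_left_mono)
      qed
      show ?case using c[of 0] 0 S0 by (simp add: J_def)
    next
      case (Suc j)
      define q :: real where "q = (1 / 2) ^ Suc j"
      have q: "0 < q" "q \<le> 1" by (auto simp: q_def power_le_one simp del: power_Suc)
      have sum0: "0 \<le> (\<Sum>i<k. ((1 / 2) powr e) ^ i)" for k by (intro sum_nonneg) auto
      show ?case
      proof (cases "Suc j < J")
        case True
        have "Y \<subseteq> {j0..j1}" using F(4) g by fastforce
        then have "pair_count q X m Y n \<le> B0 * q powr (b - 1)"
          unfolding B0_def q_def by (rule pair_count_le[OF F(1-3) _ pow[OF Suc.prems]])
        also have "\<dots> \<le> B0 * (q powr (-1))"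
          using b0 B0 q by (intro mult_left_mono powr_mono') auto
        also have "q powr (-1) = 2 ^ Suc j" by (simp add: q_def powr_minus_divide power_divide)
        also have "B0 * 2 ^ Suc j \<le> A"
          unfolding A_def using True B0 by (intro mult_left_mono power_increasing) auto
        finally have 1: "pair_count q X m Y n \<le> A" .
        have 2: "A \<le> A + S * (\<Sum>i<Suc (Suc j). ((1 / 2) powr e) ^ i)" using S0 sum0 by simp
        have 3: "1 \<le> q powr (w - 1)" using powr_mono'[of "w - 1" 0 q] w q by simp
        have "1 * A \<le> q powr (w - 1) * (A + S * (\<Sum>i<Suc (Suc j). ((1 / 2) powr e) ^ i))"
          using 2 3 A0 by (intro mult_mono) auto
        then show ?thesis using 1 unfolding q_def by linarith
      next
        case False
        have mono: "((1 / 2) ^ Suc j)\<^sup>2 \<le> ((1 / 2 :: real) ^ j)\<^sup>2"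
          by (intro power_mono power_decreasing) auto
        have IH: "pair_count ((1 / 2) ^ j) X m Y n \<le> ((1 / 2) ^ j) powr (w - 1) * (A + S * (\<Sum>i<Suc j. ((1 / 2) powr e) ^ i))"
          by (rule Suc.IH) (use mono Suc.prems in linarith)
        have "pair_count q X m Y n \<le> pair_count ((1 / 2) ^ j) X m Y n + S * q powr (w - 1 + e)"
          using step[OF F(1-4) Suc.prems] False unfolding q_def by simp
        also have "\<dots> \<le> q powr (w - 1) * (A + S * (\<Sum>i<Suc j. ((1 / 2) powr e) ^ i)) + S * q powr (w - 1 + e)"
        proof -
          have "((1 / 2) ^ j) powr (w - 1) \<le> q powr (w - 1)"
            unfolding q_def using w by (intro powr_mono2') (auto intro: power_decreasing)
          then have "((1 / 2) ^ j) powr (w - 1) * (A + S * (\<Sum>i<Suc j. ((1 / 2) powr e) ^ i))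
             \<le> q powr (w - 1) * (A + S * (\<Sum>i<Suc j. ((1 / 2) powr e) ^ i))"
            using A0 S0 sum0 by (intro mult_right_mono) auto
          then show ?thesis using IH by linarith
        qed
        also have "q powr (w - 1 + e) = q powr (w - 1) * ((1 / 2) powr e) ^ Suc j"
        proof -
          have "q powr e = ((1 / 2) powr e) ^ Suc j"
            unfolding q_def by (simp only: powr_realpow[symmetric] powr_powr mult.commute half_gt_zero_iff zero_less_one powr_gt_zero)
          then show ?thesis by (simp add: powr_add)
        qed
        finally show ?thesis unfolding q_def by (simp add: algebra_simps)
      qed
    qed
    have e1: "(1 / 2) powr e < (1::real)" using powr_less_mono'[of "1 / 2" 0 e] by (simp add: e_def)
    show ?thesis
    proof (intro exI allI impI)
      fix X m Y n \<delta> j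
      assume F: "frostman s C \<delta> X m" "X \<subseteq> {i0..i1}" "frostman b C \<delta> Y n" "Y \<subseteq> {j0 + g..j1 - g}" 
        "\<delta> \<le> ((1 / 2) ^ j)\<^sup>2"
      have "(\<Sum>i<Suc j. ((1 / 2) powr e) ^ i) = (1 - ((1 / 2) powr e) ^ Suc j) / (1 - (1 / 2) powr e)"
        using e1 by (subst sum_gp_strict) auto
      also have "\<dots> \<le> 1 / (1 - (1 / 2) powr e)" using e1 by (intro divide_right_mono) auto
      finally have "A + S * (\<Sum>i<Suc j. ((1 / 2) powr e) ^ i) \<le> A + S * (1 / (1 - (1 / 2) powr e))"
        using S0 by (intro add_left_mono mult_left_mono) auto
      then have "((1 / 2) ^ j) powr (w - 1) * (A + S * (\<Sum>i<Suc j. ((1 / 2) powr e) ^ i))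
        \<le> ((1 / 2) ^ j) powr (w - 1) * (A + S * (1 / (1 - (1 / 2) powr e)))"
        by (intro mult_left_mono) auto
      then show "pair_count ((1 / 2) ^ j) X m Y n \<le> (A + S * (1 / (1 - (1 / 2) powr e))) * ((1 / 2) ^ j) powr (w - 1)"
        using main[OF F] by (simp only: mult.commute)
    qed
  qed
qed

end

section \<open>Hausdorff content\<close>

text \<open>For positive exponents the content vanishes exactly when the measure does, and it can be
  estimated by a single covering set. The bound 1 on the diameters also makes the weight of a
  covering decrease with the exponent.\<close>

abbreviation hausdorff_content :: "real \<Rightarrow> 'a::metric_space set \<Rightarrow> ennreal" where
  "hausdorff_content s A \<equiv> hausdorff_premeasure s 1 A"

lemma hausdorff_premeasure_le:
  assumes "A \<subseteq> (\<Union>i. U i)" "\<And>i. bounded (U i)" "\<And>i. diameter (U i) \<le> \<delta>"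
  shows "hausdorff_premeasure s \<delta> A \<le> (\<Sum>i. hausdorff_weight s (U i))"
  unfolding hausdorff_premeasure_def by (rule INF_lower) (use assms in auto)

lemma hausdorff_premeasure_less:
  assumes "hausdorff_premeasure s \<delta> A < e"
  obtains U :: "nat \<Rightarrow> 'a::metric_space set" where "A \<subseteq> (\<Union>i. U i)" "\<And>i. bounded (U i)" "\<And>i. diameter (U i) \<le> \<delta>"
    "(\<Sum>i. hausdorff_weight s (U i)) < e"
  using assms unfolding hausdorff_premeasure_def INF_less_iff by auto

lemma hausdorff_content_mono: "A \<subseteq> B \<Longrightarrow> hausdorff_content s A \<le> hausdorff_content s B"
  unfolding hausdorff_premeasure_def by (rule INF_superset_mono) auto

lemma hausdorff_content_empty [simp]: "hausdorff_content s ({} :: 'a::metric_space set) = 0"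
proof -
  have "hausdorff_content s ({} :: 'a set) \<le> (\<Sum>i::nat. hausdorff_weight s ({} :: 'a set))"
    using hausdorff_premeasure_le[of "{}" "\<lambda>_. {} :: 'a set" 1 s] by simp
  then show ?thesis by (simp add: hausdorff_weight_def)
qed

lemma hausdorff_content_Un:
  fixes A B :: "'a::metric_space set"
  shows "hausdorff_content s (A \<union> B) \<le> hausdorff_content s A + hausdorff_content s B"
proof (rule ennreal_le_epsilon)
  fix e :: real assume e: "0 < e" and fin: "hausdorff_content s A + hausdorff_content s B < top"
  have "hausdorff_content s A < hausdorff_content s A + ennreal (e / 2)"
    "hausdorff_content s B < hausdorff_content s B + ennreal (e / 2)"
    using e fin by (auto simp: ennreal_add_left_cancel_less[of _ 0, simplified])
  note less = this
  obtain U :: "nat \<Rightarrow> 'a set" where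
    U: "A \<subseteq> (\<Union>i. U i)" "\<And>i. bounded (U i)" "\<And>i. diameter (U i) \<le> 1"
      "(\<Sum>i. hausdorff_weight s (U i)) < hausdorff_content s A + ennreal (e / 2)"
    using hausdorff_premeasure_less[OF less(1)] by blast
  obtain V :: "nat \<Rightarrow> 'a set" where
    V: "B \<subseteq> (\<Union>i. V i)" "\<And>i. bounded (V i)" "\<And>i. diameter (V i) \<le> 1"
      "(\<Sum>i. hausdorff_weight s (V i)) < hausdorff_content s B + ennreal (e / 2)"
    using hausdorff_premeasure_less[OF less(2)] by blast
  define W where "W i = (if even i then U (i div 2) else V (i div 2))" for i
  have "A \<union> B \<subseteq> (\<Union>i. W i)"
  proof
    fix x assume "x \<in> A \<union> B"
    then consider i where "x \<in> U i" | i where "x \<in> V i" using U(1) V(1) by blast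
    then show "x \<in> (\<Union>i. W i)"
    proof cases
      case (1 i)
      then have "x \<in> W (2 * i)" by (simp add: W_def)
      then show ?thesis by blast
    next
      case (2 i)
      then have "x \<in> W (2 * i + 1)" by (simp add: W_def)
      then show ?thesis by blast
    qed
  qed
  then have "hausdorff_content s (A \<union> B) \<le> (\<Sum>i. hausdorff_weight s (W i))"
    by (rule hausdorff_premeasure_le) (use U V in \<open>auto simp: W_def\<close>)
  also have "\<dots> = (\<Sum>i. hausdorff_weight s (U i) + hausdorff_weight s (V i))"
  proof -
    have "(\<lambda>i. hausdorff_weight s (W i)) sums (\<Sum>i. hausdorff_weight s (W i))" by (simp add: summable_sums)
    then have "(\<lambda>n. \<Sum>i = n * 2..<n * 2 + 2. hausdorff_weight s (W i)) sums (\<Sum>i. hausdorff_weight s (W i))"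
      by (rule sums_group) simp
    moreover have "(\<Sum>i = n * 2..<n * 2 + 2. hausdorff_weight s (W i)) = hausdorff_weight s (U n) + hausdorff_weight s (V n)" for n
    proof -
      have "{n * 2..<n * 2 + 2} = {2 * n, 2 * n + 1}" by auto
      then show ?thesis by (simp add: W_def)
    qed
    ultimately show ?thesis by (simp add: sums_unique)
  qed
  also have "\<dots> = (\<Sum>i. hausdorff_weight s (U i)) + (\<Sum>i. hausdorff_weight s (V i))"
    by (rule suminf_add[symmetric]) auto
  also have "\<dots> \<le> (hausdorff_content s A + ennreal (e / 2)) + (hausdorff_content s B + ennreal (e / 2))"
    using U(4) V(4) by (intro add_mono) auto
  also have "\<dots> = hausdorff_content s A + hausdorff_content s B + (ennreal (e / 2) + ennreal (e / 2))"
    by (simp add: ac_simps)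
  also have "ennreal (e / 2) + ennreal (e / 2) = ennreal e" using e by (simp add: ennreal_plus[symmetric])
  finally show "hausdorff_content s (A \<union> B) \<le> hausdorff_content s A + hausdorff_content s B + ennreal e" .
qed

lemma hausdorff_content_UN:
  assumes "finite I"
  shows "hausdorff_content s (\<Union>i\<in>I. A i) \<le> (\<Sum>i\<in>I. hausdorff_content s (A i))"
  using assms
proof induction
  case (insert i I)
  then show ?case using order_trans[OF hausdorff_content_Un add_left_mono[OF insert.IH]] by simp
qed simp

lemma hausdorff_content_le:
  fixes A :: "'a::metric_space set"
  assumes "bounded A" "diameter A \<le> d" "d \<le> 1" "0 < s"
  shows "hausdorff_content s A \<le> ennreal (d powr s)"
proof -
  have d0: "0 \<le> diameter A" using assms(1) by (rule diameter_ge_0)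
  define U where "U i = (if i = 0 then A else {})" for i :: nat
  have "hausdorff_content s A \<le> (\<Sum>i. hausdorff_weight s (U i))"
    by (rule hausdorff_premeasure_le) (use assms in \<open>auto simp: U_def\<close>)
  also have "\<dots> = (\<Sum>i\<in>{0}. hausdorff_weight s (U i))"
    by (rule suminf_finite) (auto simp: U_def hausdorff_weight_def)
  also have "\<dots> \<le> ennreal (d powr s)"
    using assms d0 by (auto simp: U_def hausdorff_weight_def intro!: ennreal_leI powr_mono2)
  finally show ?thesis .
qed

lemma suminf_ennreal_ge: "f i \<le> (\<Sum>i. f i :: ennreal)"
  using sum_le_suminf[of f "{i}"] by (simp add: summableI)

text \<open>A covering of total weight less than \<open>\<delta> powr s\<close> consists
  automatically of sets of diameter less than \<open>\<delta>\<close>.\<close>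

lemma hausdorff_measure_eq_0:
  assumes "0 < s" "hausdorff_content s A = 0"
  shows "hausdorff_measure s A = 0"
proof -
  have "hausdorff_premeasure s \<delta> A \<le> 0" if \<delta>: "0 < \<delta>" for \<delta>
  proof (rule ennreal_le_epsilon)
    fix e :: real assume e: "0 < e"
    define h where "h = min e (\<delta> powr s)"
    have "hausdorff_content s A < ennreal h" using assms e \<delta> by (simp add: h_def)
    then obtain U :: "nat \<Rightarrow> 'a set" where U: "A \<subseteq> (\<Union>i. U i)" "\<And>i. bounded (U i)" "\<And>i. diameter (U i) \<le> 1"
      "(\<Sum>i. hausdorff_weight s (U i)) < ennreal h" using hausdorff_premeasure_less by blast
    have "diameter (U i) \<le> \<delta>" for i
    proof (cases "U i = {}")
      case True
      then show ?thesis using \<delta> by simp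
    next
      case False
      have "ennreal (diameter (U i) powr s) \<le> (\<Sum>i. hausdorff_weight s (U i))"
        using suminf_ennreal_ge[of "\<lambda>i. hausdorff_weight s (U i)" i] False assms by (simp add: hausdorff_weight_def)
      then have "ennreal (diameter (U i) powr s) < ennreal h" using U(4) by (rule le_less_trans)
      then have "diameter (U i) powr s < \<delta> powr s" by (simp add: ennreal_less_iff h_def)
      then show ?thesis using powr_mono2[of s \<delta> "diameter (U i)"] assms \<delta> by force
    qed
    then have "hausdorff_premeasure s \<delta> A \<le> (\<Sum>i. hausdorff_weight s (U i))"
      using U by (intro hausdorff_premeasure_le) auto
    also have "\<dots> \<le> ennreal h" using U(4) by simp
    also have "\<dots> \<le> ennreal e" by (simp add: h_def ennreal_leI)
    finally show "hausdorff_premeasure s \<delta> A \<le> 0 + ennreal e" by simp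
  qed
  then have "hausdorff_measure s A \<le> 0" unfolding hausdorff_measure_def by (intro SUP_least) auto
  then show ?thesis by simp
qed

lemma hausdorff_content_pos:
  assumes "0 < s" "ennreal s < hausdorff_dim A"
  shows "0 < hausdorff_content s A"
proof (rule ccontr)
  assume "\<not> 0 < hausdorff_content s A"
  then have "hausdorff_measure s A = 0" using hausdorff_measure_eq_0[OF assms(1)] by simp
  then have "hausdorff_dim A \<le> ennreal s" unfolding hausdorff_dim_def by (intro INF_lower) (use assms in auto)
  then show False using assms(2) by simp
qed

text \<open>The exponent supplied by the infimum may be 0, where weights follow a separate
  convention. It is raised to at least \<open>u / 2\<close>, which does not increase weights since
  all diameters are at most 1.\<close>

lemma hausdorff_dim_less_content:
  assumes "hausdorff_dim A < ennreal u" "A \<noteq> {}" "0 < u"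
  obtains s where "0 < s" "s < u" "hausdorff_content s A = 0"
proof -
  obtain s0 where s0: "0 \<le> s0" "hausdorff_measure s0 A = 0" "ennreal s0 < ennreal u"
    using assms(1) unfolding hausdorff_dim_def INF_less_iff by auto
  have c0: "hausdorff_content s0 A = 0"
  proof -
    have "hausdorff_content s0 A \<le> hausdorff_measure s0 A"
      unfolding hausdorff_measure_def by (rule SUP_upper) simp
    then show ?thesis using s0 by simp
  qed
  define s where "s = max s0 (u / 2)"
  have s: "0 < s" "s < u" using s0 assms by (auto simp: s_def ennreal_less_iff)
  have "hausdorff_content s A \<le> hausdorff_content s0 A"
    unfolding hausdorff_premeasure_def
  proof (rule INF_mono)
    fix U :: "nat \<Rightarrow> 'a set"
    assume U: "U \<in> {U. A \<subseteq> (\<Union>i. U i) \<and> (\<forall>i. bounded (U i) \<and> diameter (U i) \<le> 1)}"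
    have "hausdorff_weight s (U i) \<le> hausdorff_weight s0 (U i)" for i
    proof -
      have "0 \<le> diameter (U i)" "diameter (U i) \<le> 1" using U diameter_ge_0 by auto
      moreover have "s0 \<le> s" by (simp add: s_def)
      ultimately show ?thesis using s s0(1)
        by (auto simp: hausdorff_weight_def intro!: ennreal_leI powr_mono' powr_le1)
    qed
    then show "\<exists>V\<in>{U. A \<subseteq> (\<Union>i. U i) \<and> (\<forall>i. bounded (U i) \<and> diameter (U i) \<le> 1)}.
        (\<Sum>i. hausdorff_weight s (V i)) \<le> (\<Sum>i. hausdorff_weight s0 (U i))"
      using U by (intro bexI[of _ U] suminf_le) auto
  qed
  then show ?thesis using that s c0 by simp
qed

text \<open>Otherwise finitely many balls of zero content would cover the compact set. This is what
  permits localising to a neighbourhood of one point without losing dimension.\<close>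

lemma hausdorff_content_local_pos:
  fixes A :: "'a::metric_space set"
  assumes "compact A" "0 < hausdorff_content s A"
  obtains x where "x \<in> A" "\<And>e. 0 < e \<Longrightarrow> 0 < hausdorff_content s (A \<inter> ball x e)"
proof (rule ccontr)
  assume "\<not> thesis"
  then have "\<forall>x\<in>A. \<exists>e>0. \<not> 0 < hausdorff_content s (A \<inter> ball x e)" using that by blast
  then have "\<forall>x\<in>A. \<exists>e>0. hausdorff_content s (A \<inter> ball x e) = 0" by simp
  then obtain e where e: "\<And>x. x \<in> A \<Longrightarrow> 0 < e x" "\<And>x. x \<in> A \<Longrightarrow> hausdorff_content s (A \<inter> ball x (e x)) = 0"
    by metis
  obtain I where I: "I \<subseteq> A" "finite I" "A \<subseteq> (\<Union>x\<in>I. ball x (e x))"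
  proof (rule compactE_image[OF assms(1)])
    show "A \<subseteq> (\<Union>x\<in>A. ball x (e x))" using e(1) by auto
  qed auto
  have "hausdorff_content s A \<le> hausdorff_content s (\<Union>x\<in>I. A \<inter> ball x (e x))"
    by (rule hausdorff_content_mono) (use I in auto)
  also have "\<dots> \<le> (\<Sum>x\<in>I. hausdorff_content s (A \<inter> ball x (e x)))" by (rule hausdorff_content_UN[OF I(2)])
  also have "\<dots> = 0" using I e by (intro sum.neutral) auto
  finally show False using assms(2) by simp
qed

section \<open>Dyadic cells\<close>

definition cell :: "nat \<Rightarrow> real \<Rightarrow> int" where
  "cell l x = \<lfloor>2 ^ l * x\<rfloor>"

lemma cell_coarsen: "l \<le> k \<Longrightarrow> cell l x = cell k x div 2 ^ (k - l)"
proof -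
  assume "l \<le> k"
  then have "(2::real) ^ l * x = 2 ^ k * x / real_of_int (2 ^ (k - l))"
  proof -
    have "(2::real) ^ k = 2 ^ l * 2 ^ (k - l)" using \<open>l \<le> k\<close> by (simp add: power_add[symmetric])
    then show ?thesis by simp
  qed
  then show ?thesis unfolding cell_def by (simp only: floor_divide_real_eq_div zero_le_power zero_le_numeral)
qed

lemma cell_dist: "cell l x = cell l y \<Longrightarrow> \<bar>x - y\<bar> \<le> (1 / 2) ^ l"
proof -
  assume "cell l x = cell l y"
  then have "\<bar>2 ^ l * x - 2 ^ l * y\<bar> \<le> 1" unfolding cell_def by linarith
  then have "2 ^ l * \<bar>x - y\<bar> \<le> 1" by (simp add: right_diff_distrib[symmetric] abs_mult)
  then show ?thesis by (simp add: power_divide field_simps)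
qed

lemma finite_cell_image:
  assumes "bounded A" shows "finite (cell l ` A)"
proof -
  obtain a where a: "\<And>x. x \<in> A \<Longrightarrow> \<bar>x\<bar> \<le> a" using assms unfolding bounded_iff by auto
  have "cell l ` A \<subseteq> {\<lfloor>2 ^ l * (- a)\<rfloor>..\<lfloor>2 ^ l * a\<rfloor>}"
  proof
    fix i assume "i \<in> cell l ` A"
    then obtain x where x: "x \<in> A" "i = cell l x" by blast
    have "- a \<le> x" "x \<le> a" using a[OF x(1)] by auto
    then have "2 ^ l * (- a) \<le> 2 ^ l * x" "2 ^ l * x \<le> 2 ^ l * a" by (intro mult_left_mono; simp)+
    then show "i \<in> {\<lfloor>2 ^ l * (- a)\<rfloor>..\<lfloor>2 ^ l * a\<rfloor>}" by (simp add: x(2) cell_def floor_mono)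
  qed
  then show ?thesis by (rule finite_subset) simp
qed

lemma dyadic_scale:
  fixes R :: real
  assumes "0 < R" "R < 1"
  obtains k :: nat where "(1 / 2) ^ Suc k \<le> R" "R < (1 / 2) ^ k"
proof -
  define k where "k = (LEAST k. (1 / 2) ^ Suc k \<le> R)"
  obtain n where "(1 / 2) ^ n < R" using real_arch_pow_inv[of R "1 / 2"] assms by auto
  moreover have "(1 / 2 :: real) ^ Suc n \<le> (1 / 2) ^ n" by (intro power_decreasing) auto
  ultimately have "(1 / 2) ^ Suc n \<le> R" by linarith
  then have 1: "(1 / 2) ^ Suc k \<le> R" unfolding k_def by (rule LeastI)
  have 2: "R < (1 / 2) ^ k"
  proof (cases k)
    case (Suc j)
    then have "\<not> (1 / 2) ^ Suc j \<le> R" using not_less_Least[of j "\<lambda>k. (1 / 2) ^ Suc k \<le> R"] by (simp add: k_def)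
    then show ?thesis using Suc by simp
  qed (use assms in simp)
  show thesis using that 1 2 .
qed

lemma cell_near:
  assumes "\<bar>x - t\<bar> \<le> R" "R \<le> (1 / 2) ^ k"
  shows "cell k x \<in> {cell k (t - R)..cell k (t - R) + 2}"
proof -
  have p: "(2::real) ^ k * (1 / 2) ^ k = 1" by (simp add: power_mult_distrib[symmetric])
  have "2 ^ k * (t - R) \<le> 2 ^ k * x" using assms by (intro mult_left_mono) auto
  moreover have "2 ^ k * x \<le> 2 ^ k * (t - R) + 2"
  proof -
    have "2 ^ k * x \<le> 2 ^ k * ((t - R) + 2 * (1 / 2) ^ k)" using assms by (intro mult_left_mono) auto
    then show ?thesis using p by (simp add: distrib_left)
  qed
  ultimately have "\<lfloor>2 ^ k * (t - R)\<rfloor> \<le> \<lfloor>2 ^ k * x\<rfloor>" "\<lfloor>2 ^ k * x\<rfloor> \<le> \<lfloor>2 ^ k * (t - R) + 2\<rfloor>"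
    using floor_mono by blast+
  then show ?thesis by (simp add: cell_def)
qed

lemma hausdorff_content_cell:
  assumes "bounded A" "0 < s"
  shows "hausdorff_content s (A \<inter> {x. cell l x = i}) \<le> ennreal (((1 / 2) ^ l) powr s)"
proof (rule hausdorff_content_le)
  show "bounded (A \<inter> {x. cell l x = i})" using assms(1) by (rule bounded_subset) blast
  show "diameter (A \<inter> {x. cell l x = i}) \<le> (1 / 2) ^ l"
  proof (rule diameter_le)
    fix x y assume "x \<in> A \<inter> {x. cell l x = i}" "y \<in> A \<inter> {x. cell l x = i}"
    then show "norm (x - y) \<le> (1 / 2) ^ l" unfolding real_norm_def by (intro cell_dist) simp
  qed simp
qed (use assms in \<open>auto simp: power_le_one\<close>)

section \<open>A discrete form of Frostman's lemma\<close>

definition cell_mass :: "real set \<Rightarrow> (real \<Rightarrow> real) \<Rightarrow> nat \<Rightarrow> int \<Rightarrow> real" where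
  "cell_mass X m l i = (\<Sum>x\<in>{x \<in> X. cell l x = i}. m x)"

text \<open>
  Starting from equal weights at the finest level \<open>N\<close>, the weights in every cell that is too heavy
  are scaled down, level by level.  A cell that is scaled down at level \<open>l\<close> carries exactly
  the weight that it would have as a member of a covering.
\<close>

lemma frostman_levels:
  fixes A :: "real set"
  assumes A: "bounded A" and s: "0 < s" and "l \<le> N"
  shows "\<exists>X m. X \<subseteq> A \<and> finite X \<and> (\<forall>x\<in>X. 0 \<le> m x) \<and>
    (\<forall>k i. l \<le> k \<longrightarrow> k \<le> N \<longrightarrow> cell_mass X m k i \<le> ((1 / 2) ^ k) powr s) \<and>
    (\<forall>i. hausdorff_content s (A \<inter> {x. cell l x = i}) \<le> ennreal (cell_mass X m l i))"
  using \<open>l \<le> N\<close>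
proof (induction l rule: inc_induct)
  case base
  have "\<forall>i\<in>cell N ` A. \<exists>x. x \<in> A \<and> cell N x = i" by auto
  from bchoice[OF this] obtain rep where rep: "\<And>i. i \<in> cell N ` A \<Longrightarrow> rep i \<in> A"
    "\<And>i. i \<in> cell N ` A \<Longrightarrow> cell N (rep i) = i"
    by blast
  define X where "X = rep ` cell N ` A"
  define m where "m x = ((1 / 2) ^ N) powr s" for x :: real
  have cm: "cell_mass X m N i = (if i \<in> cell N ` A then ((1 / 2) ^ N) powr s else 0)" for i
  proof -
    have "{x \<in> X. cell N x = i} = (if i \<in> cell N ` A then {rep i} else {})"
    proof (cases "i \<in> cell N ` A")
      case True
      have "x = rep i" if x: "x \<in> X" "cell N x = i" for x
      proof -
        obtain j where j: "j \<in> cell N ` A" "x = rep j" using x(1) by (auto simp only: X_def)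
        then have "j = i" using rep(2)[OF j(1)] x(2) by simp
        then show ?thesis using j(2) by simp
      qed
      moreover have "rep i \<in> X" unfolding X_def using True by (rule imageI)
      ultimately have "{x \<in> X. cell N x = i} = {rep i}" using rep(2)[OF True] by blast
      then show ?thesis using True by (simp only: if_True)
    next
      case False
      have "cell N x \<noteq> i" if x: "x \<in> X" for x
      proof -
        obtain j where j: "j \<in> cell N ` A" "x = rep j" using x(1) by (auto simp only: X_def)
        then show ?thesis using rep(2)[OF j(1)] False by auto
      qed
      then have "{x \<in> X. cell N x = i} = {}" by blast
      then show ?thesis using False by (simp only: if_False)
    qed
    then show ?thesis by (simp add: cell_mass_def m_def)
  qed
  have cont: "hausdorff_content s (A \<inter> {x. cell N x = i}) \<le> ennreal (cell_mass X m N i)" for i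
  proof (cases "i \<in> cell N ` A")
    case True
    have "hausdorff_content s (A \<inter> {x. cell N x = i}) \<le> ennreal (((1 / 2) ^ N) powr s)"
      by (rule hausdorff_content_cell[OF A s])
    then show ?thesis using True by (simp add: cm)
  next
    case False
    then have e: "A \<inter> {x. cell N x = i} = {}" by auto
    show ?thesis unfolding e by simp
  qed
  show ?case
  proof (intro exI[of _ X] exI[of _ m] conjI allI impI)
    show "X \<subseteq> A" using rep by (auto simp: X_def)
    show "finite X" using finite_cell_image[OF A] by (simp add: X_def)
    fix k i assume "N \<le> k" "k \<le> N"
    then have k: "k = N" by simp
    show "cell_mass X m k i \<le> ((1 / 2) ^ k) powr s" unfolding k cm by simp
  next
    fix i show "hausdorff_content s (A \<inter> {x. cell N x = i}) \<le> ennreal (cell_mass X m N i)" by (rule cont)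
  qed (simp add: m_def)
next
  case (step l)
  then obtain X m where X: "X \<subseteq> A" "finite X" "\<And>x. x \<in> X \<Longrightarrow> 0 \<le> m x"
    and le: "\<And>k i. Suc l \<le> k \<Longrightarrow> k \<le> N \<Longrightarrow> cell_mass X m k i \<le> ((1 / 2) ^ k) powr s"
    and co: "\<And>i. hausdorff_content s (A \<inter> {x. cell (Suc l) x = i}) \<le> ennreal (cell_mass X m (Suc l) i)"
    by blast
  define b :: real where "b = ((1 / 2) ^ l) powr s"
  have b: "0 < b" by (simp add: b_def)
  define c where "c i = min 1 (b / cell_mass X m l i)" for i
  define m' where "m' x = c (cell l x) * m x" for x
  have cm0: "0 \<le> cell_mass X m k i" for k i unfolding cell_mass_def using X by (intro sum_nonneg) auto
  have c: "0 \<le> c i" "c i \<le> 1" for i using cm0 b by (auto simp: c_def)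
  have m'0: "0 \<le> m' x" if "x \<in> X" for x using X(3)[OF that] c by (simp add: m'_def)
  have m'm: "cell_mass X m' k i \<le> cell_mass X m k i" for k i
    unfolding cell_mass_def m'_def using X(3) c by (intro sum_mono mult_left_le_one_le) auto
  have l: "cell_mass X m' l i = c i * cell_mass X m l i" for i
    unfolding cell_mass_def m'_def sum_distrib_left by (intro sum.cong) auto
  have l_min: "cell_mass X m' l i = min (cell_mass X m l i) b" for i
  proof (cases "cell_mass X m l i \<le> b")
    case True
    show ?thesis
    proof (cases "cell_mass X m l i = 0")
      case False
      then have "1 \<le> b / cell_mass X m l i" using True cm0[of l i] by simp
      then show ?thesis unfolding l c_def using True by simp
    qed (use True l in simp)
  next
    case False
    then have "b / cell_mass X m l i \<le> 1" "cell_mass X m l i \<noteq> 0" using b by simp_all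
    then show ?thesis unfolding l c_def using False by simp
  qed
  have split: "{x. cell l x = i} = {x. cell (Suc l) x = 2 * i} \<union> {x. cell (Suc l) x = 2 * i + 1}" for i
  proof -
    have "cell l x = cell (Suc l) x div 2" for x using cell_coarsen[of l "Suc l" x] by simp
    moreover have "n div 2 = i \<longleftrightarrow> n = 2 * i \<or> n = 2 * i + 1" for n :: int by presburger
    ultimately have "cell l x = i \<longleftrightarrow> cell (Suc l) x = 2 * i \<or> cell (Suc l) x = 2 * i + 1" for x by simp
    then show ?thesis by blast
  qed
  \<comment> \<open>Both entries of the minimum bound the content: \<open>b\<close> because the cell
    has diameter at most \<open>(1 / 2) ^ l\<close>, and the old weight by subadditivity over the
    two halves of the cell.\<close>
  have cont: "hausdorff_content s (A \<inter> {x. cell l x = i}) \<le> ennreal (cell_mass X m' l i)" for i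
  proof -
    have "hausdorff_content s (A \<inter> {x. cell l x = i}) \<le> ennreal b"
      unfolding b_def by (rule hausdorff_content_cell[OF A s])
    moreover have "hausdorff_content s (A \<inter> {x. cell l x = i}) \<le> ennreal (cell_mass X m l i)"
    proof -
      have "A \<inter> {x. cell l x = i} = (A \<inter> {x. cell (Suc l) x = 2 * i}) \<union> (A \<inter> {x. cell (Suc l) x = 2 * i + 1})"
        unfolding split by blast
      then have "hausdorff_content s (A \<inter> {x. cell l x = i})
        \<le> hausdorff_content s (A \<inter> {x. cell (Suc l) x = 2 * i}) + hausdorff_content s (A \<inter> {x. cell (Suc l) x = 2 * i + 1})"
        by (simp only: hausdorff_content_Un)
      also have "\<dots> \<le> ennreal (cell_mass X m (Suc l) (2 * i)) + ennreal (cell_mass X m (Suc l) (2 * i + 1))"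
        by (intro add_mono co)
      also have "\<dots> = ennreal (cell_mass X m (Suc l) (2 * i) + cell_mass X m (Suc l) (2 * i + 1))"
        by (simp add: cm0)
      also have "cell_mass X m (Suc l) (2 * i) + cell_mass X m (Suc l) (2 * i + 1) = cell_mass X m l i"
      proof -
        have "{x \<in> X. cell l x = i} = {x \<in> X. cell (Suc l) x = 2 * i} \<union> {x \<in> X. cell (Suc l) x = 2 * i + 1}"
          using split[of i] by blast
        then show ?thesis unfolding cell_mass_def using X(2) by (subst sum.union_disjoint[symmetric]) auto
      qed
      finally show ?thesis .
    qed
    ultimately show ?thesis unfolding l_min by (simp add: min_def)
  qed
  show ?case
  proof (intro exI[of _ X] exI[of _ m'] conjI allI impI)
    fix k i assume k: "l \<le> k" "k \<le> N"
    show "cell_mass X m' k i \<le> ((1 / 2) ^ k) powr s"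
    proof (cases "k = l")
      case True
      then show ?thesis using l_min[of i] by (simp add: b_def)
    next
      case False
      then show ?thesis using le[of k i] k m'm[of k i] by simp
    qed
  next
    fix i show "hausdorff_content s (A \<inter> {x. cell l x = i}) \<le> ennreal (cell_mass X m' l i)" by (rule cont)
  qed (use X m'0 in auto)
qed

text \<open>The point is the order of quantifiers: \<open>C\<close> and \<open>c\<close> are fixed
  before the resolution. The content bounds the total weight from below. From above, a radius of at
  least 1 is handled by counting the unit cells that meet \<open>A\<close>, each of weight at most
  1, and a smaller radius by three cells of comparable size.\<close>

lemma discrete_frostman:
  fixes A :: "real set"
  assumes A: "bounded A" and s: "0 < s" and pos: "0 < hausdorff_content s A"
  obtains C c where "0 \<le> C" "0 < c" "\<And>N. \<exists>X m. X \<subseteq> A \<and> frostman s C ((1 / 2) ^ N) X m \<and> c \<le> (\<Sum>x\<in>X. m x)"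
proof -
  define I where "I = cell 0 ` A"
  have I: "finite I" unfolding I_def by (rule finite_cell_image[OF A])
  define C where "C = real (card I) + 3 * 2 powr s"
  obtain c where c: "0 < c" "ennreal c \<le> hausdorff_content s A"
  proof (cases "hausdorff_content s A = top")
    case True
    then show ?thesis using that[of 1] by simp
  next
    case False
    then show ?thesis using that[of "enn2real (hausdorff_content s A)"] pos
      by (simp add: enn2real_positive_iff less_top ennreal_enn2real_if)
  qed
  have "\<exists>X m. X \<subseteq> A \<and> frostman s C ((1 / 2) ^ N) X m \<and> c \<le> (\<Sum>x\<in>X. m x)" for N
  proof -
    obtain X m where XA: "X \<subseteq> A" "finite X" "\<forall>x\<in>X. 0 \<le> m x"
      and le': "\<forall>k i. 0 \<le> k \<longrightarrow> k \<le> N \<longrightarrow> cell_mass X m k i \<le> ((1 / 2) ^ k) powr s"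
      and co: "\<forall>i. hausdorff_content s (A \<inter> {x. cell 0 x = i}) \<le> ennreal (cell_mass X m 0 i)"
      using frostman_levels[OF A s le0, of N] by blast
    note X = XA(1,2) XA(3)[rule_format]
    have le: "cell_mass X m k i \<le> ((1 / 2) ^ k) powr s" if "k \<le> N" for k i
      using le' that by blast
    have tot: "(\<Sum>x\<in>X. m x) = (\<Sum>i\<in>I. cell_mass X m 0 i)"
      unfolding cell_mass_def by (rule sum.group[symmetric]) (use X I in \<open>auto simp: I_def\<close>)
    have "ennreal c \<le> hausdorff_content s (\<Union>i\<in>I. A \<inter> {x. cell 0 x = i})"
      by (rule order_trans[OF c(2) hausdorff_content_mono]) (auto simp: I_def)
    also have "\<dots> \<le> (\<Sum>i\<in>I. hausdorff_content s (A \<inter> {x. cell 0 x = i}))" by (rule hausdorff_content_UN[OF I])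
    also have "\<dots> \<le> (\<Sum>i\<in>I. ennreal (cell_mass X m 0 i))" by (intro sum_mono co[rule_format])
    also have "\<dots> = ennreal (\<Sum>i\<in>I. cell_mass X m 0 i)"
      unfolding cell_mass_def using X by (intro sum_ennreal sum_nonneg) auto
    finally have "ennreal c \<le> ennreal (\<Sum>x\<in>X. m x)" by (simp add: tot)
    then have ctot: "c \<le> (\<Sum>x\<in>X. m x)" using X(3) by (simp add: ennreal_le_iff sum_nonneg)
    have "(\<Sum>x\<in>{x \<in> X. \<bar>x - t\<bar> \<le> R}. m x) \<le> C * R powr s" if R: "(1 / 2) ^ N \<le> R" for t R
    proof -
      have R0: "0 < R" using R by (rule less_le_trans[rotated]) simp
      show ?thesis
      proof (cases "1 \<le> R")
        case True
        have "(\<Sum>x\<in>{x \<in> X. \<bar>x - t\<bar> \<le> R}. m x) \<le> (\<Sum>x\<in>X. m x)" using X by (intro sum_mono2) auto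
        also have "\<dots> \<le> (\<Sum>i\<in>I. 1)" unfolding tot using le[of 0] by (intro sum_mono) simp
        also have "\<dots> \<le> C * 1" by (simp add: C_def)
        also have "\<dots> \<le> C * R powr s" using True s by (intro mult_left_mono) (auto simp: C_def ge_one_powr_ge_zero)
        finally show ?thesis .
      next
        case False
        then obtain k where k: "(1 / 2) ^ Suc k \<le> R" "R < (1 / 2) ^ k" using dyadic_scale[of R] R0 by auto
        have "k \<le> N"
        proof (rule ccontr)
          assume "\<not> k \<le> N"
          then have "(1 / 2 :: real) ^ k \<le> (1 / 2) ^ N" by (intro power_decreasing) auto
          then show False using R k by linarith
        qed
        let ?J = "{cell k (t - R)..cell k (t - R) + 2}"
        have card: "card ?J = 3" by simp
        have "(\<Sum>x\<in>{x \<in> X. \<bar>x - t\<bar> \<le> R}. m x) \<le> (\<Sum>x\<in>{x \<in> X. cell k x \<in> ?J}. m x)"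
          using X cell_near[of _ t R k] k by (intro sum_mono2) auto
        also have "\<dots> = (\<Sum>i\<in>?J. \<Sum>x\<in>{x \<in> {x \<in> X. cell k x \<in> ?J}. cell k x = i}. m x)"
          by (rule sum.group[symmetric]) (use X in auto)
        also have "\<dots> \<le> (\<Sum>i\<in>?J. ((1 / 2) ^ k) powr s)"
        proof (rule sum_mono)
          fix i assume i: "i \<in> ?J"
          have "{x \<in> {x \<in> X. cell k x \<in> ?J}. cell k x = i} = {x \<in> X. cell k x = i}" using i by auto
          then show "(\<Sum>x\<in>{x \<in> {x \<in> X. cell k x \<in> ?J}. cell k x = i}. m x) \<le> ((1 / 2) ^ k) powr s"
            using le[OF \<open>k \<le> N\<close>, of i] by (simp add: cell_mass_def)
        qed
        also have "\<dots> = 3 * ((1 / 2) ^ k) powr s" using card by simp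
        also have "\<dots> \<le> 3 * (2 * R) powr s" using k s by (intro mult_left_mono powr_mono2) auto
        also have "\<dots> = 3 * 2 powr s * R powr s" using R0 by (simp add: powr_mult)
        also have "\<dots> \<le> C * R powr s" by (intro mult_right_mono) (auto simp: C_def)
        finally show ?thesis .
      qed
    qed
    then have "frostman s C ((1 / 2) ^ N) X m"
      unfolding frostman_def using X by (auto simp: power_le_one)
    then show ?thesis using X(1) ctot by blast
  qed
  moreover have "0 \<le> C" by (simp add: C_def)
  ultimately show thesis using that c(1) by blast
qed

section \<open>Weighted points and small coverings\<close>

text \<open>After expanding the squares, a pair of points is counted for at most one
  \<open>k\<close>, and only if it lies in a single fibre.\<close>

lemma sum_square_fibres_le:
  fixes q :: "'a \<Rightarrow> real" and h :: "'a \<Rightarrow> int"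
  assumes "finite P" "finite S" "\<And>p. p \<in> P \<Longrightarrow> 0 \<le> q p"
  shows "(\<Sum>k\<in>S. (\<Sum>p\<in>{p \<in> P. h p = k}. q p)\<^sup>2)
    \<le> (\<Sum>p\<in>P. \<Sum>p'\<in>P. q p * q p' * (if h p = h p' then 1 else 0))"
proof -
  have "(\<Sum>k\<in>S. (\<Sum>p\<in>{p \<in> P. h p = k}. q p)\<^sup>2)
     = (\<Sum>k\<in>S. \<Sum>p\<in>P. \<Sum>p'\<in>P. q p * q p' * (if h p = k \<and> h p' = k then 1 else 0))"
  proof (rule sum.cong[OF refl])
    fix k
    have "(\<Sum>p\<in>{p \<in> P. h p = k}. q p) = (\<Sum>p\<in>P. if h p = k then q p else 0)"
      using assms(1) by (rule sum.inter_filter)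
    then have "(\<Sum>p\<in>{p \<in> P. h p = k}. q p)\<^sup>2
      = (\<Sum>p\<in>P. \<Sum>p'\<in>P. (if h p = k then q p else 0) * (if h p' = k then q p' else 0))"
      by (simp only: power2_eq_square sum_product)
    also have "\<dots> = (\<Sum>p\<in>P. \<Sum>p'\<in>P. q p * q p' * (if h p = k \<and> h p' = k then 1 else 0))"
      by (intro sum.cong refl) auto
    finally show "(\<Sum>p\<in>{p \<in> P. h p = k}. q p)\<^sup>2
      = (\<Sum>p\<in>P. \<Sum>p'\<in>P. q p * q p' * (if h p = k \<and> h p' = k then 1 else 0))" .
  qed
  also have "\<dots> = (\<Sum>p\<in>P. \<Sum>p'\<in>P. \<Sum>k\<in>S. q p * q p' * (if h p = k \<and> h p' = k then 1 else 0))"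
    by (subst sum.swap, rule sum.cong[OF refl], subst sum.swap) (rule refl)
  also have "\<dots> \<le> (\<Sum>p\<in>P. \<Sum>p'\<in>P. q p * q p' * (if h p = h p' then 1 else 0))"
  proof (intro sum_mono)
    fix p p' assume p: "p \<in> P" "p' \<in> P"
    have "(\<Sum>k\<in>S. q p * q p' * (if h p = k \<and> h p' = k then 1 else 0))
       = q p * q p' * (\<Sum>k\<in>S. if h p = k \<and> h p' = k then 1 else 0)"
      by (rule sum_distrib_left[symmetric])
    also have "\<dots> \<le> q p * q p' * (if h p = h p' then 1 else 0)"
    proof (rule mult_left_mono)
      show "(\<Sum>k\<in>S. if h p = k \<and> h p' = k then 1 else 0) \<le> (if h p = h p' then 1 else (0::real))"
      proof (cases "h p = h p'")
        case True
        have "(\<Sum>k\<in>S. if h p = k \<and> h p' = k then 1 else 0) = (\<Sum>k\<in>S. if h p = k then 1 else (0::real))"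
          using True by (intro sum.cong) auto
        also have "\<dots> = (if h p \<in> S then 1 else 0)" using assms(2) by (rule sum.delta')
        finally show ?thesis using True by simp
      next
        case False
        then have "(\<Sum>k\<in>S. if h p = k \<and> h p' = k then 1 else 0) = (0::real)" by (intro sum.neutral) auto
        then show ?thesis by simp
      qed
      show "0 \<le> q p * q p'" using assms(3) p by simp
    qed
    finally show "(\<Sum>k\<in>S. q p * q p' * (if h p = k \<and> h p' = k then 1 else 0)) \<le> q p * q p' * (if h p = h p' then 1 else 0)" .
  qed
  finally show ?thesis .
qed

text \<open>A finite substitute for a probability measure on \<open>D\<close> whose mass in dyadic
  cells has small square sums. The points and weights may change with the depth \<open>N\<close>,
  but \<open>c\<close> and \<open>B\<close> may not. Coincidence is expressed by cells because
  coverings will be made of cells. The index set lies in the plane since \<open>t\<close> is going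
  to be \<open>f\<close> on a product.\<close>

definition energy_family :: "real set \<Rightarrow> real \<Rightarrow> bool" where
  "energy_family D w \<longleftrightarrow> (\<exists>c>0. \<exists>B\<ge>0. \<forall>N. \<exists>(P :: (real \<times> real) set) q t. finite P \<and> (\<forall>p\<in>P. 0 \<le> q p \<and> t p \<in> D) \<and>
     c \<le> (\<Sum>p\<in>P. q p) \<and>
     (\<forall>j\<le>N. (\<Sum>p\<in>P. \<Sum>p'\<in>P. q p * q p' * (if cell j (t p) = cell j (t p') then 1 else 0)) \<le> B * ((1 / 2) ^ j) powr w))"

text \<open>A covering of tiny weight is inflated to open balls with
  \<open>R powr s = d powr s + h * (1 / 2) ^ Suc i\<close>, finitely many of which cover the compact
  set; each meets \<open>D\<close> in at most three dyadic cells of comparable size. In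
  \<open>6 * 2 powr s\<close> there is a 3 for these cells, \<open>2 powr s\<close> for the
  comparison of sizes and a 2 from the inflation. The bound \<open>1 / 4\<close> forces the radii
  below 1.\<close>

lemma small_dyadic_cover:
  fixes D :: "real set"
  assumes "compact D" and s: "0 < s" and z: "hausdorff_content s D = 0" and e: "0 < e"
  obtains F :: "(nat \<times> int) set" where "finite F" "\<And>x. x \<in> D \<Longrightarrow> \<exists>p\<in>F. cell (fst p) x = snd p"
    "(\<Sum>p\<in>F. ((1 / 2) ^ fst p) powr s) \<le> e"
proof -
  define h where "h = min (1 / 4) (e / (6 * 2 powr s))"
  have h: "0 < h" "h \<le> 1 / 4" "6 * 2 powr s * h \<le> e" using e by (auto simp: h_def min_def field_simps)
  have "hausdorff_content s D < ennreal h" using z h by simp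
  then obtain U :: "nat \<Rightarrow> real set" where U: "D \<subseteq> (\<Union>i. U i)" "\<And>i. bounded (U i)" "\<And>i. diameter (U i) \<le> 1"
    "(\<Sum>i. hausdorff_weight s (U i)) < ennreal h" using hausdorff_premeasure_less by blast
  define d where "d i = diameter (U i)" for i
  define R where "R i = (d i powr s + h * (1 / 2) ^ Suc i) powr (1 / s)" for i
  have p0: "0 < d i powr s + h * (1 / 2) ^ Suc i" for i using h by (intro add_nonneg_pos) auto
  have Rs: "R i powr s = d i powr s + h * (1 / 2) ^ Suc i" for i
    using p0[of i] s by (simp add: R_def powr_powr)
  have R0: "0 < R i" for i using p0[of i] by (simp add: R_def)
  have dR: "d i < R i" for i
  proof -
    have "d i powr s < R i powr s" unfolding Rs using h by simp
    then show ?thesis using powr_mono2[of s "R i" "d i"] s R0[of i] by force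
  qed
  define u where "u i = (SOME x. x \<in> U i)" for i
  have Ub: "U i \<subseteq> ball (u i) (R i)" for i
  proof
    fix x assume x: "x \<in> U i"
    then have "u i \<in> U i" unfolding u_def by (rule someI)
    then have "dist (u i) x \<le> d i" unfolding d_def using x by (rule diameter_bounded_bound[OF U(2)])
    then show "x \<in> ball (u i) (R i)" using dR[of i] by simp
  qed
  have "D \<subseteq> (\<Union>i\<in>UNIV. ball (u i) (R i))" using U(1) Ub by blast
  then obtain I where I: "finite I" "D \<subseteq> (\<Union>i\<in>I. ball (u i) (R i))"
    using compactE_image[OF assms(1), of UNIV "\<lambda>i. ball (u i) (R i)"] by auto
  have Rsum: "(\<Sum>i\<in>I. R i powr s) \<le> 2 * h"
  proof -
    have "ennreal (\<Sum>i\<in>I. d i powr s) = (\<Sum>i\<in>I. ennreal (d i powr s))" by (rule sum_ennreal[symmetric]) simp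
    also have "\<dots> \<le> (\<Sum>i\<in>I. hausdorff_weight s (U i))"
      using s by (intro sum_mono) (auto simp: hausdorff_weight_def d_def)
    also have "\<dots> \<le> (\<Sum>i. hausdorff_weight s (U i))" by (rule sum_le_suminf) (use I in auto)
    also have "\<dots> \<le> ennreal h" using U(4) by simp
    finally have 1: "(\<Sum>i\<in>I. d i powr s) \<le> h" using h by (simp add: ennreal_le_iff)
    have "(\<Sum>i\<in>I. (1 / 2) ^ Suc i) \<le> (\<Sum>i. (1 / 2 :: real) ^ Suc i)"
      by (rule sum_le_suminf) (use I power_half_series sums_summable in auto)
    also have "\<dots> = 1" using power_half_series by (simp add: sums_iff)
    finally have "(\<Sum>i\<in>I. h * (1 / 2) ^ Suc i) \<le> h * 1"
      unfolding sum_distrib_left[symmetric] using h by (intro mult_left_mono) auto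
    then show ?thesis using 1 by (simp add: Rs sum.distrib)
  qed
  have R1: "R i < 1" if "i \<in> I" for i
  proof (rule ccontr)
    assume "\<not> R i < 1"
    then have "1 \<le> R i powr s" using s by (simp add: ge_one_powr_ge_zero)
    also have "\<dots> \<le> (\<Sum>i\<in>I. R i powr s)" using that I by (intro member_le_sum) auto
    finally show False using Rsum h by linarith
  qed
  have "\<exists>k::nat. (1 / 2) ^ Suc k \<le> R i \<and> R i < (1 / 2) ^ k" if "i \<in> I" for i
    using dyadic_scale[OF R0 R1[OF that]] by blast
  then obtain j where j: "\<And>i. i \<in> I \<Longrightarrow> (1 / 2) ^ Suc (j i) \<le> R i" "\<And>i. i \<in> I \<Longrightarrow> R i < (1 / 2) ^ j i"
    by metis
  define g where "g = (\<lambda>(i, n). (j i, cell (j i) (u i - R i) + n))"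
  define F where "F = g ` (I \<times> {0..2})"
  show thesis
  proof (rule that[of F])
    show "finite F" using I by (simp add: F_def)
    fix x assume "x \<in> D"
    then obtain i where i: "i \<in> I" "x \<in> ball (u i) (R i)" using I by blast
    have "\<bar>x - u i\<bar> \<le> R i" using i(2) by (simp add: dist_real_def abs_minus_commute)
    moreover have "R i \<le> (1 / 2) ^ j i" using j(2)[OF i(1)] by simp
    ultimately have c: "cell (j i) x \<in> {cell (j i) (u i - R i)..cell (j i) (u i - R i) + 2}" by (rule cell_near)
    define n where "n = cell (j i) x - cell (j i) (u i - R i)"
    have "n \<in> {0..2}" using c by (simp add: n_def)
    then have "g (i, n) \<in> F" unfolding F_def using i by (intro imageI) auto
    moreover have "cell (fst (g (i, n))) x = snd (g (i, n))" by (simp add: g_def n_def)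
    ultimately show "\<exists>p\<in>F. cell (fst p) x = snd p" by blast
  next
    have "(\<Sum>p\<in>F. ((1 / 2) ^ fst p) powr s) \<le> (\<Sum>p\<in>I \<times> {0..2}. ((1 / 2) ^ fst (g p)) powr s)"
      unfolding F_def using sum_image_le[of "I \<times> {0..2}" "\<lambda>p. ((1 / 2) ^ fst p) powr s" g] I by (simp add: o_def)
    also have "\<dots> = (\<Sum>i\<in>I. \<Sum>n\<in>{0..2::int}. ((1 / 2) ^ j i) powr s)"
      by (simp add: sum.cartesian_product' g_def)
    also have "\<dots> = (\<Sum>i\<in>I. 3 * ((1 / 2) ^ j i) powr s)" by simp
    also have "\<dots> \<le> (\<Sum>i\<in>I. 3 * (2 powr s * R i powr s))"
    proof (intro sum_mono mult_left_mono)
      fix i assume "i \<in> I"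
      then have "(1 / 2) ^ j i \<le> 2 * R i" using j(1)[of i] by simp
      then have "((1 / 2) ^ j i) powr s \<le> (2 * R i) powr s" using s by (intro powr_mono2) auto
      then show "((1 / 2) ^ j i) powr s \<le> 2 powr s * R i powr s" using R0[of i] by (simp add: powr_mult)
    qed simp
    also have "\<dots> = 3 * 2 powr s * (\<Sum>i\<in>I. R i powr s)" by (simp add: sum_distrib_left mult.assoc)
    also have "\<dots> \<le> 3 * 2 powr s * (2 * h)" using Rsum by (intro mult_left_mono) auto
    also have "\<dots> \<le> e" using h(3) by simp
    finally show "(\<Sum>p\<in>F. ((1 / 2) ^ fst p) powr s) \<le> e" .
  qed
qed

lemma sum_fibres_ge:
  assumes "finite P" "finite F" "\<And>p. p \<in> P \<Longrightarrow> 0 \<le> (q p :: real)" "\<And>p. p \<in> P \<Longrightarrow> \<exists>k\<in>F. h k p"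
  shows "(\<Sum>p\<in>P. q p) \<le> (\<Sum>k\<in>F. \<Sum>p\<in>{p \<in> P. h k p}. q p)"
proof -
  have "(\<Sum>p\<in>P. q p) \<le> (\<Sum>p\<in>P. \<Sum>k\<in>F. if h k p then q p else 0)"
  proof (rule sum_mono)
    fix p assume p: "p \<in> P"
    then obtain k where k: "k \<in> F" "h k p" using assms(4) by blast
    have "q p = (if h k p then q p else 0)" using k by simp
    also have "\<dots> \<le> (\<Sum>k\<in>F. if h k p then q p else 0)"
      using k(1) assms(2) assms(3)[OF p] by (intro member_le_sum[of k F "\<lambda>k. if h k p then q p else 0"]) auto
    finally show "q p \<le> (\<Sum>k\<in>F. if h k p then q p else 0)" .
  qed
  also have "\<dots> = (\<Sum>k\<in>F. \<Sum>p\<in>P. if h k p then q p else 0)" by (rule sum.swap)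
  also have "\<dots> = (\<Sum>k\<in>F. \<Sum>p\<in>{p \<in> P. h k p}. q p)"
    by (rule sum.cong[OF refl], rule sum.inter_filter[symmetric, OF assms(1)])
  finally show ?thesis .
qed

text \<open>Suppose cells of total weight \<open>c / (2 * l)\<close> cover \<open>D\<close>. The
  mass \<open>S\<close> in a cell of weight \<open>a\<close> is at most
  \<open>l / 2 * a + S^2 / (2 * l * a)\<close>. Summed over the cells of one level the squares are
  controlled by the energy, and the quotients \<open>((1 / 2) ^ j) powr (w - s)\<close> are summable
  over the levels since \<open>s < w\<close>. The choice of \<open>l\<close> makes each half at most
  \<open>c / 4\<close>, against a total of at least \<open>c\<close>.\<close>

lemma content_pos_of_energy:
  assumes "compact D" and s: "0 < s" "s < w" and E: "energy_family D w"
  shows "0 < hausdorff_content s D"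
proof (rule ccontr)
  assume "\<not> 0 < hausdorff_content s D"
  then have z: "hausdorff_content s D = 0" by simp
  obtain c B where c: "0 < c" and B: "0 \<le> B" and fam: "\<And>N. \<exists>(P :: (real \<times> real) set) q t. finite P \<and> (\<forall>p\<in>P. 0 \<le> q p \<and> t p \<in> D) \<and>
     c \<le> (\<Sum>p\<in>P. q p) \<and>
     (\<forall>j\<le>N. (\<Sum>p\<in>P. \<Sum>p'\<in>P. q p * q p' * (if cell j (t p) = cell j (t p') then 1 else 0)) \<le> B * ((1 / 2) ^ j) powr w)"
    using E unfolding energy_family_def by blast
  define g :: real where "g = (1 / 2) powr (w - s)"
  have g: "0 < g" "g < 1" using s powr_less_mono'[of "1 / 2" 0 "w - s"] by (auto simp: g_def)
  define B' where "B' = B / (1 - g)"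
  have B': "0 \<le> B'" using B g by (simp add: B'_def)
  define l where "l = 2 * (B' + 1) / c"
  have l: "0 < l" using B' c by (simp add: l_def)
  obtain F :: "(nat \<times> int) set" where F: "finite F" "\<And>x. x \<in> D \<Longrightarrow> \<exists>p\<in>F. cell (fst p) x = snd p"
    "(\<Sum>p\<in>F. ((1 / 2) ^ fst p) powr s) \<le> c / (2 * l)"
    using small_dyadic_cover[OF assms(1) s(1) z, of "c / (2 * l)"] c l by (metis divide_pos_pos mult_pos_pos zero_less_numeral)
  \<comment> \<open>The finest level of the covering determines how deep the family has to be; the
    covering was chosen from \<open>c\<close> and \<open>B\<close> alone.\<close>
  define N where "N = Max (insert 0 (fst ` F))"
  have N: "fst k \<le> N" if "k \<in> F" for k using that F(1) by (simp add: N_def)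
  obtain P :: "(real \<times> real) set" and q t where P: "finite P" "\<And>p. p \<in> P \<Longrightarrow> 0 \<le> q p" "\<And>p. p \<in> P \<Longrightarrow> t p \<in> D"
    "c \<le> (\<Sum>p\<in>P. q p)"
    "\<And>j. j \<le> N \<Longrightarrow> (\<Sum>p\<in>P. \<Sum>p'\<in>P. q p * q p' * (if cell j (t p) = cell j (t p') then 1 else 0)) \<le> B * ((1 / 2) ^ j) powr w"
    using fam[of N] by blast
  define S where "S k = (\<Sum>p\<in>{p \<in> P. cell (fst k) (t p) = snd k}. q p)" for k
  define a where "a k = ((1 / 2) ^ fst k) powr s" for k :: "nat \<times> int"
  have a: "0 < a k" for k by (simp add: a_def)
  have "c \<le> (\<Sum>k\<in>F. S k)"
    using sum_fibres_ge[OF P(1) F(1) P(2), where h = "\<lambda>k p. cell (fst k) (t p) = snd k"] F(2) P(3,4)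
    unfolding S_def by force
  also have "\<dots> \<le> (\<Sum>k\<in>F. l / 2 * a k + 1 / (2 * l) * ((S k)\<^sup>2 / a k))"
  proof (rule sum_mono)
    fix k
    have "0 \<le> (l * a k - S k)\<^sup>2" by simp
    then have "2 * (l * a k) * S k \<le> (l * a k)\<^sup>2 + (S k)\<^sup>2" by (simp add: power2_diff)
    then have "2 * (l * a k) * S k / (2 * (l * a k)) \<le> ((l * a k)\<^sup>2 + (S k)\<^sup>2) / (2 * (l * a k))"
      using l a[of k] by (intro divide_right_mono) auto
    moreover have "2 * (l * a k) * S k / (2 * (l * a k)) = S k" using l a[of k] by simp
    moreover have "((l * a k)\<^sup>2 + (S k)\<^sup>2) / (2 * (l * a k)) = l / 2 * a k + 1 / (2 * l) * ((S k)\<^sup>2 / a k)"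
      using l a[of k] by (simp add: add_divide_distrib power2_eq_square)
    ultimately show "S k \<le> l / 2 * a k + 1 / (2 * l) * ((S k)\<^sup>2 / a k)" by simp
  qed
  also have "\<dots> = l / 2 * (\<Sum>k\<in>F. a k) + 1 / (2 * l) * (\<Sum>k\<in>F. (S k)\<^sup>2 / a k)"
    by (simp only: sum.distrib sum_distrib_left)
  also have "\<dots> \<le> l / 2 * (c / (2 * l)) + 1 / (2 * l) * B'"
  proof (intro add_mono mult_left_mono)
    show "(\<Sum>k\<in>F. a k) \<le> c / (2 * l)" using F(3) by (simp add: a_def)
    have "(\<Sum>k\<in>F. (S k)\<^sup>2 / a k) \<le> (\<Sum>k\<in>{..N} \<times> snd ` F. (S k)\<^sup>2 / a k)"
    proof (rule sum_mono2)
      show "F \<subseteq> {..N} \<times> snd ` F"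
      proof
        fix k assume "k \<in> F"
        then have "fst k \<in> {..N}" "snd k \<in> snd ` F" using N by auto
        then show "k \<in> {..N} \<times> snd ` F" by (simp add: mem_Times_iff)
      qed
    next
      fix k show "0 \<le> (S k)\<^sup>2 / a k" using a[of k] by simp
    qed (use F(1) in auto)
    also have "\<dots> = (\<Sum>j\<le>N. \<Sum>i\<in>snd ` F. (\<Sum>p\<in>{p \<in> P. cell j (t p) = i}. q p)\<^sup>2 / ((1 / 2) ^ j) powr s)"
      by (simp add: sum.cartesian_product' S_def a_def)
    also have "\<dots> = (\<Sum>j\<le>N. (\<Sum>i\<in>snd ` F. (\<Sum>p\<in>{p \<in> P. cell j (t p) = i}. q p)\<^sup>2) / ((1 / 2) ^ j) powr s)"
      by (simp only: sum_divide_distrib)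
    also have "\<dots> \<le> (\<Sum>j\<le>N. B * ((1 / 2) ^ j) powr w / ((1 / 2) ^ j) powr s)"
    proof (intro sum_mono divide_right_mono)
      fix j assume "j \<in> {..N}"
      then have "j \<le> N" by simp
      have "(\<Sum>i\<in>snd ` F. (\<Sum>p\<in>{p \<in> P. cell j (t p) = i}. q p)\<^sup>2)
        \<le> (\<Sum>p\<in>P. \<Sum>p'\<in>P. q p * q p' * (if cell j (t p) = cell j (t p') then 1 else 0))"
        by (rule sum_square_fibres_le[OF P(1) finite_imageI[OF F(1)] P(2)])
      also have "\<dots> \<le> B * ((1 / 2) ^ j) powr w" by (rule P(5)[OF \<open>j \<le> N\<close>])
      finally show "(\<Sum>i\<in>snd ` F. (\<Sum>p\<in>{p \<in> P. cell j (t p) = i}. q p)\<^sup>2) \<le> B * ((1 / 2) ^ j) powr w" .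
    qed simp
    also have "\<dots> = (\<Sum>j\<le>N. B * g ^ j)"
    proof (rule sum.cong[OF refl])
      fix j
      have "((1 / 2) ^ j) powr w / ((1 / 2) ^ j) powr s = ((1 / 2 :: real) ^ j) powr (w - s)" by (simp add: powr_diff)
      also have "\<dots> = ((1 / 2) powr real j) powr (w - s)" by (simp add: powr_realpow)
      also have "\<dots> = g powr real j" by (simp add: g_def powr_powr mult.commute)
      also have "\<dots> = g ^ j" using g by (simp add: powr_realpow)
      finally have "((1 / 2) ^ j) powr w / ((1 / 2) ^ j) powr s = g ^ j" .
      then show "B * ((1 / 2) ^ j) powr w / ((1 / 2) ^ j) powr s = B * g ^ j"
        by (simp only: times_divide_eq_right[symmetric])
    qed
    also have "\<dots> = B * (\<Sum>j<Suc N. g ^ j)" by (simp add: sum_distrib_left lessThan_Suc_atMost)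
    also have "\<dots> \<le> B * (1 / (1 - g))"
    proof (rule mult_left_mono[OF _ B])
      have "(\<Sum>j<Suc N. g ^ j) = (1 - g ^ Suc N) / (1 - g)" using g by (subst sum_gp_strict) auto
      also have "\<dots> \<le> 1 / (1 - g)" using g by (intro divide_right_mono) auto
      finally show "(\<Sum>j<Suc N. g ^ j) \<le> 1 / (1 - g)" .
    qed
    finally show "(\<Sum>k\<in>F. (S k)\<^sup>2 / a k) \<le> B'" by (simp add: B'_def)
  qed (use l in auto)
  also have "\<dots> \<le> c / 4 + c / 4"
  proof (intro add_mono)
    show "l / 2 * (c / (2 * l)) \<le> c / 4" using l by simp
    have "1 / (2 * l) * B' = c / 4 * (B' / (B' + 1))" using c B' by (simp add: l_def)
    also have "\<dots> \<le> c / 4 * 1" using c B' by (intro mult_left_mono) auto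
    finally show "1 / (2 * l) * B' \<le> c / 4" by simp
  qed
  finally show False using c by simp
qed

text \<open>At the endpoint \<open>w = 1\<close> a single level is used, so no series over levels
  arises. If \<open>D\<close> were null, the cells of a fine level that meet \<open>D\<close> would
  lie in an open set of measure at most \<open>e\<close>, so that their number times
  \<open>(1 / 2) ^ N\<close> is at most \<open>e\<close>. Cauchy-Schwarz gives
  \<open>c^2 \<le> B * e\<close>, which contradicts the choice of \<open>e\<close>.\<close>

lemma measure_pos_of_energy:
  assumes "compact D" and E: "energy_family D 1"
  shows "0 < emeasure lebesgue D"
proof (rule ccontr)
  assume "\<not> 0 < emeasure lebesgue D"
  then have z: "emeasure lebesgue D = 0" by simp
  obtain c B where c: "0 < c" and B: "0 \<le> B" and fam: "\<And>N. \<exists>(P :: (real \<times> real) set) q t. finite P \<and> (\<forall>p\<in>P. 0 \<le> q p \<and> t p \<in> D) \<and>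
     c \<le> (\<Sum>p\<in>P. q p) \<and>
     (\<forall>j\<le>N. (\<Sum>p\<in>P. \<Sum>p'\<in>P. q p * q p' * (if cell j (t p) = cell j (t p') then 1 else 0)) \<le> B * ((1 / 2) ^ j) powr (1::real))"
    using E unfolding energy_family_def by blast
  define e where "e = c\<^sup>2 / (2 * (B + 1))"
  have e: "0 < e" using c B by (simp add: e_def)
  have Dm: "D \<in> sets lebesgue" using assms(1) by (simp add: borel_compact)
  obtain V where V: "open V" "D \<subseteq> V" "emeasure lebesgue V \<le> ennreal e"
  proof -
    obtain V where V: "open V" "D \<subseteq> V" "V - D \<in> lmeasurable" "emeasure lebesgue (V - D) < ennreal e"
      using sets_lebesgue_outer_open[OF Dm e] by blast
    have "emeasure lebesgue V \<le> emeasure lebesgue (D \<union> (V - D))"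
      using V Dm by (intro emeasure_mono) auto
    also have "\<dots> \<le> emeasure lebesgue D + emeasure lebesgue (V - D)"
      by (rule emeasure_subadditive[OF Dm fmeasurableD[OF V(3)]])
    also have "\<dots> \<le> ennreal e" using z V(4) by simp
    finally show ?thesis using that V by blast
  qed
  obtain d where d: "0 < d" "(\<Union>x\<in>D. ball x d) \<subseteq> V"
    using compact_subset_open_imp_ball_epsilon_subset[OF assms(1) V(1,2)] by blast
  obtain N where N: "(1 / 2) ^ N < d" using real_arch_pow_inv[of d "1 / 2"] d by auto
  define S where "S = cell N ` D"
  have S: "finite S" unfolding S_def by (rule finite_cell_image[OF compact_imp_bounded[OF assms(1)]])
  define I where "I k = {of_int k / 2 ^ N..<(of_int k + 1) / 2 ^ N :: real}" for k :: int
  have I: "x \<in> I k \<longleftrightarrow> cell N x = k" for x k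
    by (simp add: I_def cell_def floor_eq_iff field_simps)
  have em: "emeasure lebesgue (I k) = ennreal ((1 / 2) ^ N)" for k
  proof -
    have "(of_int k + 1) / 2 ^ N - of_int k / 2 ^ N = ((1 / 2) ^ N :: real)"
      by (simp add: diff_divide_distrib[symmetric] power_divide)
    then show ?thesis unfolding I_def by (simp add: divide_right_mono)
  qed
  have "(\<Union>k\<in>S. I k) \<subseteq> V"
  proof
    fix x assume "x \<in> (\<Union>k\<in>S. I k)"
    then obtain y where y: "y \<in> D" "cell N y = cell N x" by (auto simp: S_def I)
    then have "dist y x < d" using cell_dist[OF y(2)] N by (simp add: dist_real_def)
    then have "x \<in> ball y d" by simp
    then show "x \<in> V" using d(2) y(1) by blast
  qed
  then have "emeasure lebesgue (\<Union>k\<in>S. I k) \<le> ennreal e"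
  proof -
    assume "(\<Union>k\<in>S. I k) \<subseteq> V"
    then have "emeasure lebesgue (\<Union>k\<in>S. I k) \<le> emeasure lebesgue V"
      by (rule emeasure_mono) (simp add: sets_completionI_sets V(1))
    then show ?thesis using V(3) by (rule order_trans)
  qed
  moreover have "emeasure lebesgue (\<Union>k\<in>S. I k) = (\<Sum>k\<in>S. emeasure lebesgue (I k))"
  proof (rule sum_emeasure[symmetric, OF _ _ S])
    show "disjoint_family_on I S" by (auto simp: disjoint_family_on_def I)
  qed (auto simp: I_def)
  ultimately have "of_nat (card S) * ennreal ((1 / 2) ^ N) \<le> ennreal e" by (simp add: em)
  then have card: "real (card S) * (1 / 2) ^ N \<le> e"
    using e by (simp add: ennreal_of_nat_eq_real_of_nat ennreal_mult[symmetric] ennreal_le_iff)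
  obtain P :: "(real \<times> real) set" and q t where P: "finite P" "\<And>p. p \<in> P \<Longrightarrow> 0 \<le> q p" "\<And>p. p \<in> P \<Longrightarrow> t p \<in> D"
    "c \<le> (\<Sum>p\<in>P. q p)"
    "\<And>j. j \<le> N \<Longrightarrow> (\<Sum>p\<in>P. \<Sum>p'\<in>P. q p * q p' * (if cell j (t p) = cell j (t p') then 1 else 0)) \<le> B * ((1 / 2) ^ j) powr (1::real)"
    using fam[of N] by blast
  define T where "T k = (\<Sum>p\<in>{p \<in> P. cell N (t p) = k}. q p)" for k
  have "c \<le> (\<Sum>k\<in>S. T k)"
  proof -
    have "\<exists>k\<in>S. cell N (t p) = k" if "p \<in> P" for p using P(3)[OF that] by (simp add: S_def)
    then have "(\<Sum>p\<in>P. q p) \<le> (\<Sum>k\<in>S. T k)"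
      unfolding T_def by (intro sum_fibres_ge P(1,2) S) auto
    then show ?thesis using P(4) by linarith
  qed
  then have "c\<^sup>2 \<le> (\<Sum>k\<in>S. T k)\<^sup>2" using c by (intro power_mono) auto
  also have "\<dots> \<le> (\<Sum>k\<in>S. 1\<^sup>2) * (\<Sum>k\<in>S. (T k)\<^sup>2)"
    using Cauchy_Schwarz_ineq_sum[of "\<lambda>_. 1" T S] by simp
  also have "\<dots> \<le> real (card S) * (B * ((1 / 2) ^ N) powr 1)"
  proof -
    have "(\<Sum>k\<in>S. (T k)\<^sup>2) \<le> B * ((1 / 2) ^ N) powr 1"
      unfolding T_def by (rule order_trans[OF sum_square_fibres_le[OF P(1) S P(2)] P(5)]) auto
    then have "real (card S) * (\<Sum>k\<in>S. (T k)\<^sup>2) \<le> real (card S) * (B * ((1 / 2) ^ N) powr 1)"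
      by (intro mult_left_mono) auto
    then show ?thesis by simp
  qed
  also have "\<dots> = B * (real (card S) * (1 / 2) ^ N)" by simp
  also have "\<dots> \<le> B * e" using card B by (intro mult_left_mono) auto
  also have "\<dots> = c\<^sup>2 / 2 * (B / (B + 1))" using B by (simp add: e_def)
  also have "\<dots> \<le> c\<^sup>2 / 2 * 1" using B by (intro mult_left_mono) auto
  finally show False using c by simp
qed

section \<open>Smooth functions on the plane\<close>

lemma C_infinity_on_continuous: "C_infinity_on S f \<Longrightarrow> continuous_on S f"
  unfolding C_infinity_on_def using C_k_on.simps(1) by blast

lemma C_infinity_on_pd:
  assumes "C_infinity_on S f"
  shows "C_infinity_on S (pd_x f)" "C_infinity_on S (pd_y f)"
  using assms unfolding C_infinity_on_def by (metis C_k_on.simps(2))+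

lemma C_infinity_on_DERIV:
  assumes f: "C_infinity_on S f" and "(x, y) \<in> S"
  shows "((\<lambda>s. f (s, y)) has_real_derivative pd_x f (x, y)) (at x)"
    and "((\<lambda>t. f (x, t)) has_real_derivative pd_y f (x, y)) (at y)"
proof -
  have "C_k_on (Suc 0) S f" using f unfolding C_infinity_on_def by blast
  then have "(\<lambda>s. f (s, y)) differentiable (at x)" "(\<lambda>t. f (x, t)) differentiable (at y)"
    using assms(2) unfolding C_k_on.simps(2) by auto
  then show "((\<lambda>s. f (s, y)) has_real_derivative pd_x f (x, y)) (at x)"
    "((\<lambda>t. f (x, t)) has_real_derivative pd_y f (x, y)) (at y)"
    by (simp_all add: DERIV_deriv_iff_real_differentiable pd_x_def pd_y_def)
qed

lemma mean_value:
  fixes g :: "real \<Rightarrow> real"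
  assumes "x \<in> {a..b}" "x' \<in> {a..b}" "\<And>x. x \<in> {a..b} \<Longrightarrow> (g has_real_derivative g' x) (at x)"
  obtains z where "z \<in> {a..b}" "g x - g x' = g' z * (x - x')"
proof -
  have *: "\<exists>z\<in>{a..b}. g x' - g x = g' z * (x' - x)" if "x < x'" "x \<in> {a..b}" "x' \<in> {a..b}" for x x'
  proof -
    have "\<exists>t>x. t < x' \<and> g x' - g x = (x' - x) * g' t"
      by (rule MVT2[OF \<open>x < x'\<close>]) (use assms(3) that in auto)
    then obtain t where "x < t" "t < x'" "g x' - g x = (x' - x) * g' t" by blast
    then show ?thesis using that by (intro bexI[of _ t]) auto
  qed
  consider "x < x'" | "x = x'" | "x' < x" by linarith
  then show thesis
  proof cases
    case 1
    then obtain z where z: "z \<in> {a..b}" "g x' - g x = g' z * (x' - x)" using * assms by blast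
    then have "g x - g x' = g' z * (x - x')" by (simp add: algebra_simps)
    then show thesis using that z(1) by blast
  next
    case 2
    then show thesis using that[of x] assms(1) by simp
  next
    case 3
    then obtain z where "z \<in> {a..b}" "g x - g x' = g' z * (x - x')" using * assms by blast
    then show thesis using that by blast
  qed
qed

lemma open_contains_square:
  fixes S :: "(real \<times> real) set"
  assumes "open S" "(x, y) \<in> S"
  obtains e where "0 < e" "{x - e..x + e} \<times> {y - e..y + e} \<subseteq> S"
proof -
  obtain A B where AB: "open A" "open B" "x \<in> A" "y \<in> B" "A \<times> B \<subseteq> S"
    using assms open_prod_elim by (metis mem_Sigma_iff)
  obtain d1 where d1: "0 < d1" "cball x d1 \<subseteq> A" using AB open_contains_cball by blast
  obtain d2 where d2: "0 < d2" "cball y d2 \<subseteq> B" using AB open_contains_cball by blast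
  show thesis
  proof (rule that[of "min d1 d2"])
    show "{x - min d1 d2..x + min d1 d2} \<times> {y - min d1 d2..y + min d1 d2} \<subseteq> S"
      using AB(5) d1(2) d2(2) by (force simp: cball_eq_atLeastAtMost)
  qed (use d1 d2 in simp)
qed

text \<open>The second difference of \<open>f\<close> over a small square is evaluated by the mean
  value theorem in both orders of the variables. The symmetry serves the exchange of the variables,
  which turns \<open>pd_xy f\<close> into \<open>pd_y (pd_x f)\<close>.\<close>

lemma mixed_partials_eq:
  assumes S: "open S" and f: "C_infinity_on S f" and p: "p \<in> S"
  shows "pd_y (pd_x f) p = pd_x (pd_y f) p"
proof -
  obtain a b where p_eq: "p = (a, b)" by (cases p)
  note fx = C_infinity_on_pd(1)[OF f] and fy = C_infinity_on_pd(2)[OF f]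
  have "\<bar>pd_y (pd_x f) p - pd_x (pd_y f) p\<bar> \<le> 0 + e" if e: "0 < e" for e
  proof -
    define U where "U = {q \<in> S. \<bar>pd_y (pd_x f) q - pd_y (pd_x f) p\<bar> < e / 2 \<and> \<bar>pd_x (pd_y f) q - pd_x (pd_y f) p\<bar> < e / 2}"
    have "open U"
    proof -
      have o: "open {q \<in> S. \<bar>h q - h p\<bar> < e / 2}" if "continuous_on S h" for h :: "real \<times> real \<Rightarrow> real"
      proof -
        have "{q \<in> S. \<bar>h q - h p\<bar> < e / 2} = S \<inter> h -` ball (h p) (e / 2)"
          by (auto simp: dist_real_def abs_minus_commute)
        then show ?thesis using continuous_open_preimage[OF that S open_ball] by simp
      qed
      have "open ({q \<in> S. \<bar>pd_y (pd_x f) q - pd_y (pd_x f) p\<bar> < e / 2}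
          \<inter> {q \<in> S. \<bar>pd_x (pd_y f) q - pd_x (pd_y f) p\<bar> < e / 2})"
        by (intro open_Int o C_infinity_on_continuous C_infinity_on_pd fx fy)
      moreover have "U = {q \<in> S. \<bar>pd_y (pd_x f) q - pd_y (pd_x f) p\<bar> < e / 2}
          \<inter> {q \<in> S. \<bar>pd_x (pd_y f) q - pd_x (pd_y f) p\<bar> < e / 2}"
        by (auto simp: U_def)
      ultimately show ?thesis by simp
    qed
    moreover have "(a, b) \<in> U" using p e by (simp add: U_def p_eq)
    ultimately obtain h where h: "0 < h" "{a - h..a + h} \<times> {b - h..b + h} \<subseteq> U"
      by (rule open_contains_square)
    have U: "(s, t) \<in> U" if "s \<in> {a - h..a + h}" "t \<in> {b - h..b + h}" for s t using h(2) that by blast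
    have US: "(s, t) \<in> S" if "s \<in> {a - h..a + h}" "t \<in> {b - h..b + h}" for s t using U[OF that] by (simp add: U_def)
    have I: "a \<in> {a - h..a + h}" "a + h \<in> {a - h..a + h}" "b \<in> {b - h..b + h}" "b + h \<in> {b - h..b + h}" using h by auto
    define D where "D = (f (a + h, b + h) - f (a + h, b)) - (f (a, b + h) - f (a, b))"
    obtain s where s: "s \<in> {a - h..a + h}" "D = (pd_x f (s, b + h) - pd_x f (s, b)) * h"
    proof -
      obtain s where "s \<in> {a - h..a + h}" "(f (a + h, b + h) - f (a + h, b)) - (f (a, b + h) - f (a, b))
         = (pd_x f (s, b + h) - pd_x f (s, b)) * (a + h - a)"
        by (rule mean_value[OF I(2,1), where g = "\<lambda>s. f (s, b + h) - f (s, b)" and g' = "\<lambda>s. pd_x f (s, b + h) - pd_x f (s, b)"])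
          (intro DERIV_diff C_infinity_on_DERIV[OF f] US I; assumption)
      then show ?thesis using that by (simp add: D_def)
    qed
    obtain t where t: "t \<in> {b - h..b + h}" "D = pd_y (pd_x f) (s, t) * h * h"
    proof -
      obtain t where "t \<in> {b - h..b + h}" "pd_x f (s, b + h) - pd_x f (s, b) = pd_y (pd_x f) (s, t) * (b + h - b)"
        by (rule mean_value[OF I(4,3), where g = "\<lambda>t. pd_x f (s, t)" and g' = "\<lambda>t. pd_y (pd_x f) (s, t)"])
          (intro C_infinity_on_DERIV[OF fx] US s; assumption)
      then show ?thesis using that s by simp
    qed
    obtain t' where t': "t' \<in> {b - h..b + h}" "D = (pd_y f (a + h, t') - pd_y f (a, t')) * h"
    proof -
      obtain t where "t \<in> {b - h..b + h}" "(f (a + h, b + h) - f (a, b + h)) - (f (a + h, b) - f (a, b))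
         = (pd_y f (a + h, t) - pd_y f (a, t)) * (b + h - b)"
        by (rule mean_value[OF I(4,3), where g = "\<lambda>t. f (a + h, t) - f (a, t)" and g' = "\<lambda>t. pd_y f (a + h, t) - pd_y f (a, t)"])
          (intro DERIV_diff C_infinity_on_DERIV[OF f] US I; assumption)
      then show ?thesis using that by (simp add: D_def)
    qed
    obtain s' where s': "s' \<in> {a - h..a + h}" "D = pd_x (pd_y f) (s', t') * h * h"
    proof -
      obtain s where "s \<in> {a - h..a + h}" "pd_y f (a + h, t') - pd_y f (a, t') = pd_x (pd_y f) (s, t') * (a + h - a)"
        by (rule mean_value[OF I(2,1), where g = "\<lambda>s. pd_y f (s, t')" and g' = "\<lambda>s. pd_x (pd_y f) (s, t')"])
          (intro C_infinity_on_DERIV[OF fy] US t'; assumption)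
      then show ?thesis using that t' by simp
    qed
    have "pd_y (pd_x f) (s, t) = pd_x (pd_y f) (s', t')" using t(2) s'(2) h(1) by simp
    moreover have "\<bar>pd_y (pd_x f) (s, t) - pd_y (pd_x f) p\<bar> < e / 2" "\<bar>pd_x (pd_y f) (s', t') - pd_x (pd_y f) p\<bar> < e / 2"
      using U[OF s(1) t(1)] U[OF s'(1) t'(1)] by (auto simp: U_def)
    ultimately show ?thesis by linarith
  qed
  then have "\<bar>pd_y (pd_x f) p - pd_x (pd_y f) p\<bar> \<le> 0" by (rule field_le_epsilon)
  then show ?thesis by simp
qed

text \<open>All bounds except the one on the curvature follow from continuity at one point, applied
  to a finite set \<open>H\<close> of functions. For the curvature, the increments of
  \<open>f\<close> and of \<open>eta = 1 / rho\<close> are written as linear forms in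
  \<open>x - x'\<close> and \<open>y - y'\<close>. Their determinant is close to a nonzero number,
  so a small increment of \<open>f\<close> forces an increment of \<open>eta\<close> comparable to
  \<open>\<bar>x - x'\<bar>\<close>.\<close>

lemma web_exists:
  assumes \<Omega>: "open \<Omega>" and f: "C_infinity_on \<Omega> f" and p: "(x0, y0) \<in> \<Omega> - bad_set \<Omega> f"
  obtains e L where "0 < e" "web (\<lambda>x y. f (x, y)) (\<lambda>x y. pd_x f (x, y)) (\<lambda>x y. pd_y f (x, y)) (\<lambda>x y. pd_xy f (x, y))
    (\<lambda>x y. pd_y (pd_y f) (x, y)) (x0 - e) (x0 + e) (y0 - e) (y0 + e) L"
proof -
  define p0 where "p0 = (x0, y0)"
  define fx where "fx = pd_x f"
  define fy where "fy = pd_y f"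
  define fxy where "fxy = pd_x fy"
  define fyy where "fyy = pd_y fy"
  define fxx where "fxx = pd_x fx"
  define fyx where "fyx = pd_y fx"
  define fyyx where "fyyx = pd_x fyy"
  define fxyx where "fxyx = pd_x fxy"
  define fxyy where "fxyy = pd_y fxy"
  have fxy_eq: "pd_xy f = fxy" by (simp add: pd_xy_def fxy_def fy_def)
  have p0: "p0 \<in> \<Omega>" "fx p0 \<noteq> 0" "fy p0 \<noteq> 0" "fxy p0 \<noteq> 0" "kappa f p0 \<noteq> 0"
    using p by (auto simp: bad_set_def p0_def fx_def fy_def fxy_eq)
  have Cfx: "C_infinity_on \<Omega> fx" and Cfy: "C_infinity_on \<Omega> fy"
    unfolding fx_def fy_def using C_infinity_on_pd[OF f] by auto
  have Cfxy: "C_infinity_on \<Omega> fxy" and Cfyy: "C_infinity_on \<Omega> fyy"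
    unfolding fxy_def fyy_def using C_infinity_on_pd[OF Cfy] by auto
  have Cfxx: "C_infinity_on \<Omega> fxx" and Cfyx: "C_infinity_on \<Omega> fyx"
    unfolding fxx_def fyx_def using C_infinity_on_pd[OF Cfx] by auto
  have Cfyyx: "C_infinity_on \<Omega> fyyx" unfolding fyyx_def using C_infinity_on_pd[OF Cfyy] by auto
  have Cfxyx: "C_infinity_on \<Omega> fxyx" and Cfxyy: "C_infinity_on \<Omega> fxyy"
    unfolding fxyx_def fxyy_def using C_infinity_on_pd[OF Cfxy] by auto
  define \<Omega>' where "\<Omega>' = {q \<in> \<Omega>. fx q * fy q \<noteq> 0}"
  have \<Omega>': "open \<Omega>'"
  proof -
    have "\<Omega>' = \<Omega> \<inter> (\<lambda>q. fx q * fy q) -` (- {0})" by (auto simp: \<Omega>'_def)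
    moreover have "continuous_on \<Omega> (\<lambda>q. fx q * fy q)"
      by (intro continuous_intros C_infinity_on_continuous Cfx Cfy)
    moreover have "open (- {0 :: real})" by (simp add: open_Compl)
    ultimately show ?thesis using continuous_open_preimage[OF _ \<Omega>] by blast
  qed
  have sub: "\<Omega>' \<subseteq> \<Omega>" and p0': "p0 \<in> \<Omega>'" using p0 by (auto simp: \<Omega>'_def)
  define eta where "eta q = fxy q / (fx q * fy q)" for q
  define ex where "ex q = (fxyx q * (fx q * fy q) - fxy q * (fxx q * fy q + fxy q * fx q)) / ((fx q * fy q) * (fx q * fy q))" for q
  define ey where "ey q = (fxyy q * (fx q * fy q) - fxy q * (fyx q * fy q + fyy q * fx q)) / ((fx q * fy q) * (fx q * fy q))" for q
  have Dx: "((\<lambda>s. f (s, y)) has_real_derivative fx (x, y)) (at x)"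
    "((\<lambda>s. fx (s, y)) has_real_derivative fxx (x, y)) (at x)"
    "((\<lambda>s. fy (s, y)) has_real_derivative fxy (x, y)) (at x)"
    "((\<lambda>s. fxy (s, y)) has_real_derivative fxyx (x, y)) (at x)"
    "((\<lambda>s. fyy (s, y)) has_real_derivative fyyx (x, y)) (at x)"
    if "(x, y) \<in> \<Omega>" for x y
    using C_infinity_on_DERIV(1)[OF f that] C_infinity_on_DERIV(1)[OF Cfx that] C_infinity_on_DERIV(1)[OF Cfy that]
      C_infinity_on_DERIV(1)[OF Cfxy that] C_infinity_on_DERIV(1)[OF Cfyy that]
    by (simp_all add: fx_def fxx_def fxy_def fxyx_def fyyx_def)
  have Dy: "((\<lambda>t. f (x, t)) has_real_derivative fy (x, y)) (at y)"
    "((\<lambda>t. fx (x, t)) has_real_derivative fyx (x, y)) (at y)"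
    "((\<lambda>t. fy (x, t)) has_real_derivative fyy (x, y)) (at y)"
    "((\<lambda>t. fxy (x, t)) has_real_derivative fxyy (x, y)) (at y)"
    if "(x, y) \<in> \<Omega>" for x y
    using C_infinity_on_DERIV(2)[OF f that] C_infinity_on_DERIV(2)[OF Cfx that] C_infinity_on_DERIV(2)[OF Cfy that]
      C_infinity_on_DERIV(2)[OF Cfxy that]
    by (simp_all add: fy_def fyx_def fyy_def fxyy_def)
  have nz': "fx q * fy q \<noteq> 0" if "q \<in> \<Omega>'" for q using that by (simp add: \<Omega>'_def)
  have Dex: "((\<lambda>s. eta (s, y)) has_real_derivative ex (x, y)) (at x)" if q: "(x, y) \<in> \<Omega>'" for x y
  proof -
    have q': "(x, y) \<in> \<Omega>" using q sub by blast
    show ?thesis unfolding eta_def ex_def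
      by (rule DERIV_divide[OF Dx(4)[OF q'] DERIV_mult[OF Dx(2)[OF q'] Dx(3)[OF q']] nz'[OF q]])
  qed
  have Dey: "((\<lambda>t. eta (x, t)) has_real_derivative ey (x, y)) (at y)" if q: "(x, y) \<in> \<Omega>'" for x y
  proof -
    have q': "(x, y) \<in> \<Omega>" using q sub by blast
    show ?thesis unfolding eta_def ey_def
      by (rule DERIV_divide[OF Dy(4)[OF q'] DERIV_mult[OF Dy(2)[OF q'] Dy(3)[OF q']] nz'[OF q]])
  qed
  \<comment> \<open>Since \<open>eta\<close> is the reciprocal of \<open>rho f\<close>, this is
    \<open>kappa f p0 / (rho f p0)^2\<close>.\<close>
  define k where "k = ex p0 * fy p0 - ey p0 * fx p0"
  have k: "k \<noteq> 0"
  proof -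
    have eta_rho: "eta = (\<lambda>q. inverse (rho f q))" by (rule ext) (simp add: eta_def rho_def fx_def fy_def fxy_eq)
    have rho0: "rho f p0 \<noteq> 0" using p0 by (simp add: rho_def fx_def fy_def fxy_eq)
    have "(\<lambda>s. rho f (s, y0)) differentiable (at x0)" "(\<lambda>t. rho f (x0, t)) differentiable (at y0)"
    proof -
      have q: "(x0, y0) \<in> \<Omega>" "fxy (x0, y0) \<noteq> 0" using p0 by (auto simp: p0_def)
      have r: "rho f q = fx q * fy q / fxy q" for q by (simp add: rho_def fx_def fy_def fxy_eq)
      show "(\<lambda>s. rho f (s, y0)) differentiable (at x0)"
        unfolding r real_differentiable_def
        using DERIV_divide[OF DERIV_mult[OF Dx(2)[OF q(1)] Dx(3)[OF q(1)]] Dx(4)[OF q(1)] q(2)] by blast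
      show "(\<lambda>t. rho f (x0, t)) differentiable (at y0)"
        unfolding r real_differentiable_def
        using DERIV_divide[OF DERIV_mult[OF Dy(2)[OF q(1)] Dy(3)[OF q(1)]] Dy(4)[OF q(1)] q(2)] by blast
    qed
    then have Dr: "((\<lambda>s. rho f (s, y0)) has_real_derivative pd_x (rho f) p0) (at x0)"
       "((\<lambda>t. rho f (x0, t)) has_real_derivative pd_y (rho f) p0) (at y0)"
      by (simp_all add: DERIV_deriv_iff_real_differentiable pd_x_def pd_y_def p0_def)
    have r0: "rho f (x0, y0) \<noteq> 0" using rho0 by (simp add: p0_def)
    have De: "((\<lambda>s. eta (s, y0)) has_real_derivative - (inverse (rho f (x0, y0)) * pd_x (rho f) p0 * inverse (rho f (x0, y0)))) (at x0)"
      "((\<lambda>t. eta (x0, t)) has_real_derivative - (inverse (rho f (x0, y0)) * pd_y (rho f) p0 * inverse (rho f (x0, y0)))) (at y0)"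
      unfolding eta_rho by (rule DERIV_inverse'[OF Dr(1) r0], rule DERIV_inverse'[OF Dr(2) r0])
    have q0: "(x0, y0) \<in> \<Omega>'" using p0' by (simp add: p0_def)
    have "ex p0 = - (inverse (rho f p0) * pd_x (rho f) p0 * inverse (rho f p0))"
      "ey p0 = - (inverse (rho f p0) * pd_y (rho f) p0 * inverse (rho f p0))"
      using DERIV_unique[OF Dex[OF q0] De(1)] DERIV_unique[OF Dey[OF q0] De(2)] by (simp_all only: p0_def)
    then have "k = inverse (rho f p0) * inverse (rho f p0) * kappa f p0"
      unfolding k_def kappa_def by (simp add: fx_def fy_def algebra_simps)
    then show ?thesis using rho0 p0(5) by simp
  qed
  define H where "H = {fx, fy, fxy, fyy, fxx, fyx, fyyx, eta, ex, ey}"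
  have cH: "continuous_on \<Omega>' h" if "h \<in> H" for h
  proof -
    have c: "continuous_on \<Omega>' fx" "continuous_on \<Omega>' fy" "continuous_on \<Omega>' fxy" "continuous_on \<Omega>' fyy"
      "continuous_on \<Omega>' fxx" "continuous_on \<Omega>' fyx" "continuous_on \<Omega>' fyyx" "continuous_on \<Omega>' fxyx" "continuous_on \<Omega>' fxyy"
      by (rule continuous_on_subset[OF C_infinity_on_continuous sub], rule Cfx Cfy Cfxy Cfyy Cfxx Cfyx Cfyyx Cfxyx Cfxyy)+
    have nz: "\<forall>q\<in>\<Omega>'. fx q * fy q \<noteq> 0" "\<forall>q\<in>\<Omega>'. (fx q * fy q) * (fx q * fy q) \<noteq> 0" by (auto simp: \<Omega>'_def)
    have "continuous_on \<Omega>' eta"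
      unfolding eta_def[abs_def] by (intro continuous_on_divide[OF _ _ nz(1)] continuous_on_mult c)
    moreover have "continuous_on \<Omega>' ex" "continuous_on \<Omega>' ey"
      unfolding ex_def[abs_def] ey_def[abs_def]
      by (intro continuous_on_divide[OF _ _ nz(2)] continuous_on_diff continuous_on_mult continuous_on_add c)+
    ultimately show ?thesis using that c unfolding H_def by (elim insertE emptyE) simp_all
  qed
  define M where "M = 1 + (\<Sum>h\<in>H. \<bar>h p0\<bar>)"
  have finH: "finite H" by (simp add: H_def)
  have M1: "1 \<le> M" unfolding M_def by (simp add: sum_nonneg)
  \<comment> \<open>The bounds by \<open>\<bar>fx p0\<bar> / 2\<close> and
    \<open>\<bar>fy p0\<bar> / 2\<close> keep the two derivatives away from 0 and of constant sign.
    The bound by \<open>\<bar>k\<bar> / (8 * M)\<close> keeps the determinant above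
    \<open>\<bar>k\<bar> / 2\<close> in absolute value: each of its two products moves by at most
    \<open>2 * M * \<tau>\<close>.\<close>
  define \<tau> where "\<tau> = min 1 (min (\<bar>fx p0\<bar> / 2) (min (\<bar>fy p0\<bar> / 2) (\<bar>k\<bar> / (8 * M))))"
  have \<tau>: "0 < \<tau>" "\<tau> \<le> 1" "\<tau> \<le> \<bar>fx p0\<bar> / 2" "\<tau> \<le> \<bar>fy p0\<bar> / 2" "\<tau> \<le> \<bar>k\<bar> / (8 * M)"
    using p0 k M1 by (simp_all add: \<tau>_def min_le_iff_disj)
  define U where "U = \<Omega>' \<inter> (\<Inter>h\<in>H. {q \<in> \<Omega>'. \<bar>h q - h p0\<bar> < \<tau>})"
  have "open U"
    unfolding U_def
  proof (intro open_Int \<Omega>' open_INT finH ballI)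
    fix h assume "h \<in> H"
    have "{q \<in> \<Omega>'. \<bar>h q - h p0\<bar> < \<tau>} = \<Omega>' \<inter> h -` ball (h p0) \<tau>"
      by (auto simp: dist_real_def abs_minus_commute)
    then show "open {q \<in> \<Omega>'. \<bar>h q - h p0\<bar> < \<tau>}"
      using continuous_open_preimage[OF cH[OF \<open>h \<in> H\<close>] \<Omega>' open_ball] by simp
  qed
  moreover have "(x0, y0) \<in> U" using p0' \<tau> by (auto simp: U_def p0_def)
  ultimately obtain e0 where e0: "0 < e0" "{x0 - e0..x0 + e0} \<times> {y0 - e0..y0 + e0} \<subseteq> U"
    by (rule open_contains_square)
  define L where "L = M + 2 / \<bar>fx p0\<bar> + 2 / \<bar>fy p0\<bar> + 4 * M / \<bar>k\<bar>"
  have L: "M \<le> L" "2 / \<bar>fx p0\<bar> \<le> L" "2 / \<bar>fy p0\<bar> \<le> L" "4 * M / \<bar>k\<bar> \<le> L"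
    using M1 by (simp_all add: L_def add_nonneg_nonneg)
  have L1: "1 \<le> L" using L M1 by linarith
  define e where "e = min e0 (min (1 / 2) (1 / (4000 * L ^ 20)))"
  have L20: "0 < L ^ 20" using L1 by simp
  have e: "0 < e" "e \<le> e0" "e \<le> 1 / 2" "e \<le> 1 / (4000 * L ^ 20)" using e0 L20 by (auto simp: e_def)
  have eL: "2000 * L ^ 20 * (2 * e) \<le> 1" using e(4) L20 by (simp add: field_simps)
  define I where "I = {x0 - e..x0 + e}"
  define J where "J = {y0 - e..y0 + e}"
  have U: "(x, y) \<in> U" if "x \<in> I" "y \<in> J" for x y
    using e0(2) that e(2) by (auto simp: I_def J_def)
  have in\<Omega>': "(x, y) \<in> \<Omega>'" and in\<Omega>: "(x, y) \<in> \<Omega>" if "x \<in> I" "y \<in> J" for x y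
    using U[OF that] sub by (auto simp: U_def)
  have near: "\<bar>h (x, y) - h p0\<bar> < \<tau>" if "h \<in> H" "x \<in> I" "y \<in> J" for h x y
    using U[OF that(2,3)] that(1) by (auto simp: U_def)
  have le_M: "\<bar>h (x, y)\<bar> \<le> M" if "h \<in> H" "x \<in> I" "y \<in> J" for h x y
  proof -
    have "\<bar>h p0\<bar> \<le> (\<Sum>h\<in>H. \<bar>h p0\<bar>)" using that(1) finH by (intro member_le_sum) auto
    then show ?thesis using near[OF that] \<tau>(2) unfolding M_def by linarith
  qed
  have le_M0: "\<bar>h p0\<bar> \<le> M" if "h \<in> H" for h
    using le_M[OF that, of x0 y0] e(1) by (simp add: I_def J_def p0_def)
  have inH: "fx \<in> H" "fy \<in> H" "fxy \<in> H" "fyy \<in> H" "fxx \<in> H" "fyx \<in> H" "fyyx \<in> H" "eta \<in> H" "ex \<in> H" "ey \<in> H"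
    by (auto simp: H_def)
  have ge: "1 / L \<le> \<bar>h (x, y)\<bar>" "0 < h (x, y) * h p0"
    if h: "h \<in> H" "h p0 \<noteq> 0" "2 / \<bar>h p0\<bar> \<le> L" "\<tau> \<le> \<bar>h p0\<bar> / 2" and xy: "x \<in> I" "y \<in> J" for h x y
  proof -
    have n: "\<bar>h (x, y) - h p0\<bar> < \<bar>h p0\<bar> / 2" using near[OF h(1) xy] h(4) by linarith
    then have "\<bar>h p0\<bar> / 2 \<le> \<bar>h (x, y)\<bar>" by linarith
    moreover have "1 / L \<le> \<bar>h p0\<bar> / 2" using h(2,3) L1 by (simp add: field_simps)
    ultimately show "1 / L \<le> \<bar>h (x, y)\<bar>" by linarith
    show "0 < h (x, y) * h p0"
    proof (cases "0 < h p0")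
      case True
      then have "0 < h (x, y)" using n by linarith
      then show ?thesis using True by simp
    next
      case False
      then have "h p0 < 0" using h(2) by simp
      then have "h (x, y) < 0" using n by linarith
      then show ?thesis using \<open>h p0 < 0\<close> by (simp add: mult_neg_neg)
    qed
  qed
  have ex_le: "\<bar>a\<bar> \<le> M" if "h \<in> H" "\<exists>x1\<in>I. \<exists>y1\<in>J. a = h (x1, y1)" for a h
    using le_M[OF that(1)] that(2) by auto
  have ex_near: "\<bar>a - h p0\<bar> \<le> \<tau>" if "h \<in> H" "\<exists>x1\<in>I. \<exists>y1\<in>J. a = h (x1, y1)" for a h
    using near[OF that(1)] that(2) by (auto intro: less_imp_le)
  \<comment> \<open>The increment along a horizontal and then a vertical segment. The two
    coefficients are taken at different points, which is why the determinants below are compared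
    with their value at \<open>p0\<close>.\<close>
  have path: "\<exists>a b. (\<exists>x1\<in>I. \<exists>y1\<in>J. a = hx (x1, y1)) \<and> (\<exists>x1\<in>I. \<exists>y1\<in>J. b = hy (x1, y1)) \<and> h (x, y) - h (x', y') = a * (x - x') + b * (y - y')"
    if xy: "x \<in> I" "y \<in> J" "x' \<in> I" "y' \<in> J"
      and D: "\<And>x y. x \<in> I \<Longrightarrow> y \<in> J \<Longrightarrow> ((\<lambda>s. h (s, y)) has_real_derivative hx (x, y)) (at x)"
      "\<And>x y. x \<in> I \<Longrightarrow> y \<in> J \<Longrightarrow> ((\<lambda>t. h (x, t)) has_real_derivative hy (x, y)) (at y)" for h hx hy x y x' y'
  proof -
    obtain x1 where x1: "x1 \<in> I" "h (x, y) - h (x', y) = hx (x1, y) * (x - x')"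
      using mean_value[of x "x0 - e" "x0 + e" x' "\<lambda>s. h (s, y)" "\<lambda>s. hx (s, y)"] xy D(1) unfolding I_def by blast
    obtain y1 where y1: "y1 \<in> J" "h (x', y) - h (x', y') = hy (x', y1) * (y - y')"
      using mean_value[of y "y0 - e" "y0 + e" y' "\<lambda>t. h (x', t)" "\<lambda>t. hy (x', t)"] xy D(2) unfolding J_def by blast
    have "h (x, y) - h (x', y') = hx (x1, y) * (x - x') + hy (x', y1) * (y - y')" using x1 y1 by simp
    then show ?thesis using x1(1) y1(1) xy by blast
  qed
  have "web (\<lambda>x y. f (x, y)) (\<lambda>x y. fx (x, y)) (\<lambda>x y. fy (x, y)) (\<lambda>x y. fxy (x, y))
    (\<lambda>x y. fyy (x, y)) (x0 - e) (x0 + e) (y0 - e) (y0 + e) L"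
  proof (unfold_locales, unfold I_def[symmetric] J_def[symmetric])
    show "1 \<le> L" by (rule L1)
    show "y0 - e \<le> y0 + e" "y0 + e - (y0 - e) \<le> 1" using e by auto
    show "2000 * L ^ 20 * (x0 + e - (x0 - e)) \<le> 1" using eL by simp
    fix x y assume xy: "x \<in> I" "y \<in> J"
    show "((\<lambda>x. f (x, y)) has_real_derivative fx (x, y)) (at x)" "((\<lambda>x. fy (x, y)) has_real_derivative fxy (x, y)) (at x)"
      using Dx[OF in\<Omega>[OF xy]] by auto
    show "((\<lambda>y. f (x, y)) has_real_derivative fy (x, y)) (at y)" "((\<lambda>y. fy (x, y)) has_real_derivative fyy (x, y)) (at y)"
      using Dy[OF in\<Omega>[OF xy]] by auto
    show "1 / L \<le> \<bar>fx (x, y)\<bar>" by (rule ge(1)[OF inH(1) p0(2) L(2) \<tau>(3) xy])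
    show "1 / L \<le> \<bar>fy (x, y)\<bar>" by (rule ge(1)[OF inH(2) p0(3) L(3) \<tau>(4) xy])
    show "\<bar>fx (x, y)\<bar> \<le> L" "\<bar>fy (x, y)\<bar> \<le> L" "\<bar>fxy (x, y)\<bar> \<le> L" "\<bar>fyy (x, y)\<bar> \<le> L"
      using le_M[OF inH(1) xy] le_M[OF inH(2) xy] le_M[OF inH(3) xy] le_M[OF inH(4) xy] L(1) by linarith+
    show "\<bar>fxy (x, y) / (fx (x, y) * fy (x, y))\<bar> \<le> L"
      using le_M[OF inH(8) xy] L(1) by (simp add: eta_def)
    fix x' assume x': "x' \<in> I"
    have lip: "\<bar>h (x, y) - h (x', y)\<bar> \<le> L * \<bar>x - x'\<bar>" if "hx \<in> H" 
      "\<And>x. x \<in> I \<Longrightarrow> ((\<lambda>s. h (s, y)) has_real_derivative hx (x, y)) (at x)" for h hx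
    proof (rule lipschitz_real[of I x x' "\<lambda>s. h (s, y)" "\<lambda>s. hx (s, y)" L])
      fix t assume "t \<in> I"
      then show "\<bar>hx (t, y)\<bar> \<le> L" using le_M[OF that(1) _ xy(2)] L(1) by force
    qed (use that xy x' in \<open>auto simp: I_def\<close>)
    show "\<bar>fyy (x, y) - fyy (x', y)\<bar> \<le> L * \<bar>x - x'\<bar>"
      by (rule lip[OF inH(7)]) (rule Dx(5)[OF in\<Omega>[OF _ xy(2)]])
    show "\<bar>fxy (x, y) / (fx (x, y) * fy (x, y)) - fxy (x', y) / (fx (x', y) * fy (x', y))\<bar> \<le> L * \<bar>x - x'\<bar>"
      using lip[OF inH(9), of eta] Dex[OF in\<Omega>'[OF _ xy(2)]] by (simp add: eta_def)
    fix y' assume y': "y' \<in> J"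
    show "0 < fy (x, y) * fy (x', y')"
    proof -
      have "0 < (fy (x, y) * fy p0) * (fy (x', y') * fy p0)"
        by (rule mult_pos_pos[OF ge(2)[OF inH(2) p0(3) L(3) \<tau>(4) xy] ge(2)[OF inH(2) p0(3) L(3) \<tau>(4) x' y']])
      also have "\<dots> = (fy (x, y) * fy (x', y')) * (fy p0)\<^sup>2" by (simp add: power2_eq_square)
      finally show ?thesis using p0(3) by (simp add: zero_less_mult_iff)
    qed
    show "\<bar>fx (x, y) - fx (x', y')\<bar> \<le> L * (\<bar>x - x'\<bar> + \<bar>y - y'\<bar>)"
    proof -
      obtain a b where ab: "\<exists>x1\<in>I. \<exists>y1\<in>J. a = fxx (x1, y1)" "\<exists>x1\<in>I. \<exists>y1\<in>J. b = fyx (x1, y1)"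
        "fx (x, y) - fx (x', y') = a * (x - x') + b * (y - y')"
        using path[OF xy x' y', of fx fxx fyx] Dx(2)[OF in\<Omega>] Dy(2)[OF in\<Omega>] by blast
      have "\<bar>a\<bar> \<le> L" "\<bar>b\<bar> \<le> L" using ex_le[OF inH(5) ab(1)] ex_le[OF inH(6) ab(2)] L(1) by linarith+
      then have "\<bar>a\<bar> * \<bar>x - x'\<bar> + \<bar>b\<bar> * \<bar>y - y'\<bar> \<le> L * \<bar>x - x'\<bar> + L * \<bar>y - y'\<bar>"
        by (intro add_mono mult_right_mono) auto
      then show ?thesis unfolding ab(3) abs_mult[symmetric] distrib_left
        using abs_triangle_ineq[of "a * (x - x')" "b * (y - y')"] by linarith
    qed
    assume small: "\<bar>f (x, y) - f (x', y')\<bar> \<le> \<bar>x - x'\<bar> / L"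
    obtain a b where ab: "\<exists>x1\<in>I. \<exists>y1\<in>J. a = fx (x1, y1)" "\<exists>x1\<in>I. \<exists>y1\<in>J. b = fy (x1, y1)"
      "f (x, y) - f (x', y') = a * (x - x') + b * (y - y')"
      using path[OF xy x' y', of f fx fy] Dx(1)[OF in\<Omega>] Dy(1)[OF in\<Omega>] by blast
    obtain c d where cd: "\<exists>x1\<in>I. \<exists>y1\<in>J. c = ex (x1, y1)" "\<exists>x1\<in>I. \<exists>y1\<in>J. d = ey (x1, y1)"
      "eta (x, y) - eta (x', y') = c * (x - x') + d * (y - y')"
      using path[OF xy x' y', of eta ex ey] Dex[OF in\<Omega>'] Dey[OF in\<Omega>'] by blast
    have nr: "\<bar>a - fx p0\<bar> \<le> \<tau>" "\<bar>b - fy p0\<bar> \<le> \<tau>" "\<bar>c - ex p0\<bar> \<le> \<tau>" "\<bar>d - ey p0\<bar> \<le> \<tau>"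
      by (rule ex_near[OF inH(1) ab(1)] ex_near[OF inH(2) ab(2)] ex_near[OF inH(9) cd(1)] ex_near[OF inH(10) cd(2)])+
    have bM: "\<bar>b\<bar> \<le> M" "\<bar>d\<bar> \<le> M" "\<bar>a\<bar> \<le> M" 
      using ex_le[OF inH(1) ab(1)] ex_le[OF inH(2) ab(2)] ex_le[OF inH(10) cd(2)] by blast+
    have det: "\<bar>k\<bar> / 2 \<le> \<bar>c * b - d * a\<bar>"
    proof -
      have prod: "\<bar>u * v - u0 * v0\<bar> \<le> 2 * M * \<tau>" if "\<bar>u - u0\<bar> \<le> \<tau>" "\<bar>v - v0\<bar> \<le> \<tau>" "\<bar>v\<bar> \<le> M" "\<bar>u0\<bar> \<le> M" for u v u0 v0
      proof -
        have "u * v - u0 * v0 = (u - u0) * v + u0 * (v - v0)" by (simp add: algebra_simps)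
        then have "\<bar>u * v - u0 * v0\<bar> \<le> \<bar>u - u0\<bar> * \<bar>v\<bar> + \<bar>u0\<bar> * \<bar>v - v0\<bar>" by (metis abs_mult abs_triangle_ineq)
        also have "\<dots> \<le> \<tau> * M + M * \<tau>" using that \<tau> M1 by (intro add_mono mult_mono) auto
        finally show ?thesis by simp
      qed
      have "\<bar>c * b - ex p0 * fy p0\<bar> \<le> 2 * M * \<tau>" "\<bar>d * a - ey p0 * fx p0\<bar> \<le> 2 * M * \<tau>"
        using prod[OF nr(3) nr(2) bM(1) le_M0[OF inH(9)]] prod[OF nr(4) nr(1) bM(3) le_M0[OF inH(10)]] by blast+
      moreover have "2 * (2 * M * \<tau>) \<le> \<bar>ex p0 * fy p0 - ey p0 * fx p0\<bar> / 2"
        using \<tau>(5) M1 unfolding k_def[symmetric] by (simp add: field_simps)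
      moreover have "\<bar>u0 - v0\<bar> / 2 \<le> \<bar>u - v\<bar>" if "\<bar>u - u0\<bar> \<le> T" "\<bar>v - v0\<bar> \<le> T" "2 * T \<le> \<bar>u0 - v0\<bar> / 2"
        for u v u0 v0 T :: real
      proof -
        have "\<bar>u0 - v0\<bar> \<le> \<bar>u - v\<bar> + 2 * T"
          using that(1,2) by (simp only: abs_le_iff) arith
        then show ?thesis using that(3) by simp
      qed
      ultimately show ?thesis unfolding k_def by blast
    qed
    \<comment> \<open>Elimination of \<open>y - y'\<close> from the two increments.\<close>
    have "(c * b - d * a) * (x - x') = b * (eta (x, y) - eta (x', y')) - d * (f (x, y) - f (x', y'))"
      unfolding ab(3) cd(3) by (simp add: algebra_simps)
    then have "\<bar>c * b - d * a\<bar> * \<bar>x - x'\<bar> \<le> \<bar>b\<bar> * \<bar>eta (x, y) - eta (x', y')\<bar> + \<bar>d\<bar> * \<bar>f (x, y) - f (x', y')\<bar>"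
      by (metis abs_mult abs_triangle_ineq4)
    also have "\<dots> \<le> M * \<bar>eta (x, y) - eta (x', y')\<bar> + M * (\<bar>x - x'\<bar> / L)"
      using bM small M1 by (intro add_mono mult_mono) auto
    finally have 0: "\<bar>c * b - d * a\<bar> * \<bar>x - x'\<bar> \<le> M * \<bar>eta (x, y) - eta (x', y')\<bar> + M * (\<bar>x - x'\<bar> / L)" .
    have "M * (\<bar>x - x'\<bar> / L) \<le> \<bar>k\<bar> / 4 * \<bar>x - x'\<bar>"
    proof -
      have "M / L \<le> \<bar>k\<bar> / 4" using L(4) L1 k by (simp add: field_simps)
      then have "M / L * \<bar>x - x'\<bar> \<le> \<bar>k\<bar> / 4 * \<bar>x - x'\<bar>" by (intro mult_right_mono) auto
      then show ?thesis by simp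
    qed
    then have 1: "\<bar>c * b - d * a\<bar> * \<bar>x - x'\<bar> \<le> M * \<bar>eta (x, y) - eta (x', y')\<bar> + \<bar>k\<bar> / 4 * \<bar>x - x'\<bar>"
      using 0 by linarith
    have "\<bar>k\<bar> / 2 * \<bar>x - x'\<bar> \<le> \<bar>c * b - d * a\<bar> * \<bar>x - x'\<bar>" using det by (intro mult_right_mono) auto
    moreover have "v / 4 * t \<le> B" if "v / 2 * t \<le> A" "A \<le> B + v / 4 * t" for v t A B :: real
      using that by (simp add: field_simps)
    ultimately have "\<bar>k\<bar> / 4 * \<bar>x - x'\<bar> \<le> M * \<bar>eta (x, y) - eta (x', y')\<bar>" using 1 by blast
    then have "\<bar>x - x'\<bar> * (\<bar>k\<bar> / (4 * M)) \<le> \<bar>eta (x, y) - eta (x', y')\<bar>" using M1 by (simp add: field_simps)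
    moreover have "1 / L \<le> \<bar>k\<bar> / (4 * M)" using L(4) L1 k M1 by (simp add: field_simps)
    then have "\<bar>x - x'\<bar> * (1 / L) \<le> \<bar>x - x'\<bar> * (\<bar>k\<bar> / (4 * M))" by (intro mult_left_mono) auto
    ultimately show "\<bar>x - x'\<bar> / L \<le> \<bar>fxy (x, y) / (fx (x, y) * fy (x, y)) - fxy (x', y') / (fx (x', y') * fy (x', y'))\<bar>"
      by (simp add: eta_def)
  next
    fix x assume x: "x \<in> I"
    show "continuous_on J (\<lambda>y. fyy (x, y))"
      by (rule continuous_on_compose2[OF C_infinity_on_continuous[OF Cfyy]]) (use x in\<Omega> in \<open>auto intro!: continuous_intros\<close>)
  qed
  then show thesis using that e(1) by (simp add: fx_def fy_def fxy_eq fyy_def)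
qed

text \<open>A bounded set meets at most a multiple of \<open>2 ^ N\<close> cells of level
  \<open>N\<close>, of total weight a multiple of \<open>2 powr (N * (1 - s))\<close>, which tends
  to 0 for \<open>s > 1\<close>. Thus the dimensions of \<open>A\<close> and \<open>B\<close> are
  real numbers, and lowering them slightly brings them below 1, as the estimates for the weights
  require.\<close>

lemma hausdorff_dim_le_1:
  fixes A :: "real set"
  assumes A: "bounded A" shows "hausdorff_dim A \<le> 1"
proof (rule ccontr)
  assume "\<not> hausdorff_dim A \<le> 1"
  then have "ennreal 1 < hausdorff_dim A" by simp
  then obtain s' where s': "ennreal 1 < s'" "s' < hausdorff_dim A" using dense by blast
  then have "s' < top" by (auto intro: less_le_trans)
  then obtain s where s: "s' = ennreal s" "0 \<le> s" by (cases s') auto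
  have s1: "1 < s" using s' s by (simp add: ennreal_less_iff)
  have pos: "0 < hausdorff_content s A" by (rule hausdorff_content_pos) (use s s1 s' in auto)
  obtain a where a: "\<And>x. x \<in> A \<Longrightarrow> \<bar>x\<bar> \<le> a" "0 \<le> a"
  proof -
    obtain b where b: "\<forall>x\<in>A. norm x \<le> b" using A unfolding bounded_iff by blast
    have "\<bar>x\<bar> \<le> max b 0" if "x \<in> A" for x using bspec[OF b that] by simp
    then show ?thesis using that[of "max b 0"] by simp
  qed
  define g :: real where "g = (1 / 2) powr (s - 1)"
  have g: "0 < g" "g < 1" using s1 powr_less_mono'[of "1 / 2" 0 "s - 1"] by (auto simp: g_def)
  have "hausdorff_content s A \<le> 0 + ennreal e" if e: "0 < e" for e
  proof -
    obtain N where N: "g ^ N < e / (2 * a + 2)" using real_arch_pow_inv[of "e / (2 * a + 2)" g] g e a(2) by auto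
    have fin: "finite (cell N ` A)" by (rule finite_cell_image[OF A])
    have card: "real (card (cell N ` A)) \<le> (2 * a + 2) * 2 ^ N"
    proof -
      have sub: "cell N ` A \<subseteq> {\<lfloor>2 ^ N * (- a)\<rfloor>..\<lfloor>2 ^ N * a\<rfloor>}"
      proof
        fix i assume "i \<in> cell N ` A"
        then obtain x where x: "x \<in> A" "i = cell N x" by blast
        have "- a \<le> x" "x \<le> a" using a(1)[OF x(1)] by auto
        then have "2 ^ N * (- a) \<le> 2 ^ N * x" "2 ^ N * x \<le> 2 ^ N * a" by (intro mult_left_mono; simp)+
        then show "i \<in> {\<lfloor>2 ^ N * (- a)\<rfloor>..\<lfloor>2 ^ N * a\<rfloor>}"
          unfolding x(2) cell_def atLeastAtMost_iff by (intro conjI floor_mono)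
      qed
      have "card (cell N ` A) \<le> card {\<lfloor>2 ^ N * (- a)\<rfloor>..\<lfloor>2 ^ N * a\<rfloor>}" by (rule card_mono[OF _ sub]) simp
      also have "\<dots> = nat (\<lfloor>2 ^ N * a\<rfloor> - \<lfloor>2 ^ N * (- a)\<rfloor> + 1)" by simp
      finally have "real (card (cell N ` A)) \<le> real (nat (\<lfloor>2 ^ N * a\<rfloor> - \<lfloor>2 ^ N * (- a)\<rfloor> + 1))"
        by (simp only: of_nat_le_iff)
      also have "\<dots> = of_int (\<lfloor>2 ^ N * a\<rfloor> - \<lfloor>2 ^ N * (- a)\<rfloor> + 1)"
      proof -
        have "2 ^ N * (- a) \<le> 2 ^ N * a" using a(2) by (intro mult_left_mono) auto
        then have "\<lfloor>2 ^ N * (- a)\<rfloor> \<le> \<lfloor>2 ^ N * a\<rfloor>" by (rule floor_mono)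
        then show ?thesis by simp
      qed
      also have "\<dots> \<le> 2 ^ N * a + 2 ^ N * a + 2" by linarith
      also have "\<dots> \<le> (2 * a + 2) * 2 ^ N"
        using one_le_power[of "2::real" N] by (simp add: algebra_simps)
      finally show ?thesis .
    qed
    have "hausdorff_content s A \<le> hausdorff_content s (\<Union>i\<in>cell N ` A. A \<inter> {x. cell N x = i})"
      by (rule hausdorff_content_mono) auto
    also have "\<dots> \<le> (\<Sum>i\<in>cell N ` A. hausdorff_content s (A \<inter> {x. cell N x = i}))"
      by (rule hausdorff_content_UN[OF fin])
    also have "\<dots> \<le> (\<Sum>i\<in>cell N ` A. ennreal (((1 / 2) ^ N) powr s))"
      by (intro sum_mono hausdorff_content_cell[OF A]) (use s1 in simp)
    also have "\<dots> = ennreal (real (card (cell N ` A)) * ((1 / 2) ^ N) powr s)"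
      by (simp add: ennreal_mult ennreal_of_nat_eq_real_of_nat)
    also have "\<dots> \<le> ennreal e"
    proof (rule ennreal_leI)
      have "((1 / 2) ^ N) powr s = (1 / 2) ^ N * g ^ N"
      proof -
        have "((1 / 2 :: real) ^ N) powr (s - 1) = ((1 / 2) powr real N) powr (s - 1)" by (simp add: powr_realpow)
        also have "\<dots> = g powr real N" by (simp add: g_def powr_powr mult.commute)
        also have "\<dots> = g ^ N" using g by (simp add: powr_realpow)
        finally have 1: "((1 / 2 :: real) ^ N) powr (s - 1) = g ^ N" .
        have "((1 / 2 :: real) ^ N) powr s = ((1 / 2) ^ N) powr (1 + (s - 1))" by simp
        also have "\<dots> = ((1 / 2) ^ N) powr 1 * ((1 / 2) ^ N) powr (s - 1)" by (rule powr_add)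
        finally show ?thesis unfolding 1 by simp
      qed
      then have "real (card (cell N ` A)) * ((1 / 2) ^ N) powr s = real (card (cell N ` A)) * ((1 / 2) ^ N * g ^ N)"
        by (rule arg_cong)
      also have "\<dots> \<le> (2 * a + 2) * 2 ^ N * ((1 / 2) ^ N * g ^ N)"
        by (rule mult_right_mono[OF card]) (use g in simp)
      also have "\<dots> = (2 * a + 2) * g ^ N" by (simp add: power_divide)
      also have "\<dots> \<le> e" using N a(2) by (simp add: field_simps)
      finally show "real (card (cell N ` A)) * ((1 / 2) ^ N) powr s \<le> e" .
    qed
    finally show ?thesis by simp
  qed
  note small = this
  have "hausdorff_content s A \<le> 0" by (rule ennreal_le_epsilon) (rule small)
  then show False using pos by simp
qed

lemma frostman_mono_constant:
  assumes "frostman s C \<delta> X m" "C \<le> C'"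
  shows "frostman s C' \<delta> X m"
proof -
  have "C * l powr s \<le> C' * l powr s" for l using assms(2) by (intro mult_right_mono) auto
  then show ?thesis using assms(1) unfolding frostman_def by (meson order_trans)
qed

text \<open>The weights are products on \<open>X \<times> Y\<close> near a single point of
  \<open>A \<times> B\<close> at which both contents are locally positive, carried to the values by
  \<open>f\<close>. The ordering of the dimensions supplies the hypothesis \<open>s \<le> b\<close>
  of \<open>pair_count_bound\<close>.\<close>

lemma energy_family_Delta_ordered:
  fixes f :: "real \<times> real \<Rightarrow> real" and A B :: "real set"
  assumes \<Omega>: "open \<Omega>" and f: "C_infinity_on \<Omega> f" and A: "compact A" and B: "compact B"
    and dA: "0 < hausdorff_dim A" and dAB: "hausdorff_dim A \<le> hausdorff_dim B"
    and AB: "A \<times> B \<subseteq> \<Omega> - bad_set \<Omega> f"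
    and w: "0 < w" "w \<le> 1" and sum: "ennreal (2 / 3 + w) < hausdorff_dim A + hausdorff_dim B"
  shows "energy_family (Delta f A B) w"
proof -
  have le1: "hausdorff_dim A \<le> ennreal 1" "hausdorff_dim B \<le> ennreal 1"
    using hausdorff_dim_le_1 compact_imp_bounded A B by auto
  have "\<exists>a\<ge>0. d = ennreal a" if "d \<le> ennreal 1" for d
    using that by (cases d) (auto simp: top_unique)
  then obtain a b where a: "hausdorff_dim A = ennreal a" "0 \<le> a" and b: "hausdorff_dim B = ennreal b" "0 \<le> b"
    using le1 by metis
  have ab: "0 < a" "a \<le> b" "b \<le> 1" using dA dAB le1 unfolding a b using a(2) b(2) by (auto simp: ennreal_le_iff)
  have sum': "2 / 3 + w < a + b"
    using sum a(2) b(2) w unfolding a(1) b(1) by (simp add: ennreal_plus[symmetric] ennreal_less_iff del: ennreal_plus)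
  \<comment> \<open>Lowering both dimensions by at most a quarter of the gap keeps their sum above
    \<open>2 / 3 + w\<close>, and \<open>a / 2\<close> keeps the smaller one positive. As
    \<open>t\<close> is positive, the larger one falls below 1.\<close>
  define t where "t = min ((a + b - (2 / 3 + w)) / 4) (a / 2)"
  have t: "0 < t" "t \<le> (a + b - (2 / 3 + w)) / 4" "t \<le> a / 2"
  proof -
    show "0 < t" using ab sum' by (simp add: t_def)
  qed (unfold t_def, rule min.cobounded1, rule min.cobounded2)
  define \<alpha> where "\<alpha> = a - t"
  define \<beta> where "\<beta> = b - t"
  have \<alpha>\<beta>: "0 < \<alpha>" "\<alpha> \<le> \<beta>" "\<beta> < 1" "2 / 3 + w < \<alpha> + \<beta>" "\<alpha> < a" "\<beta> < b" "0 < \<beta>"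
    using t ab by (auto simp: \<alpha>_def \<beta>_def)
  have "0 < hausdorff_content \<alpha> A" "0 < hausdorff_content \<beta> B"
    using \<alpha>\<beta> a b by (auto intro!: hausdorff_content_pos simp: ennreal_less_iff)
  then obtain x0 y0 where x0: "x0 \<in> A" "\<And>e. 0 < e \<Longrightarrow> 0 < hausdorff_content \<alpha> (A \<inter> ball x0 e)"
    and y0: "y0 \<in> B" "\<And>e. 0 < e \<Longrightarrow> 0 < hausdorff_content \<beta> (B \<inter> ball y0 e)"
    using hausdorff_content_local_pos[OF A] hausdorff_content_local_pos[OF B] by metis
  have "(x0, y0) \<in> \<Omega> - bad_set \<Omega> f" using AB x0(1) y0(1) by blast
  then obtain e L where e: "0 < e" and W: "web (\<lambda>x y. f (x, y)) (\<lambda>x y. pd_x f (x, y)) (\<lambda>x y. pd_y f (x, y)) (\<lambda>x y. pd_xy f (x, y))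
    (\<lambda>x y. pd_y (pd_y f) (x, y)) (x0 - e) (x0 + e) (y0 - e) (y0 + e) L"
    by (rule web_exists[OF \<Omega> f])
  interpret web "\<lambda>x y. f (x, y)" "\<lambda>x y. pd_x f (x, y)" "\<lambda>x y. pd_y f (x, y)" "\<lambda>x y. pd_xy f (x, y)"
    "\<lambda>x y. pd_y (pd_y f) (x, y)" "x0 - e" "x0 + e" "y0 - e" "y0 + e" L by (rule W)
  define A' where "A' = A \<inter> ball x0 e"
  \<comment> \<open>Half the radius leaves the margin \<open>e / 2\<close> to the sides of the
    square, which the mollification and the lower bound on \<open>chi\<close> use.\<close>
  define B' where "B' = B \<inter> ball y0 (e / 2)"
  have bA': "bounded A'" and bB': "bounded B'" unfolding A'_def B'_def using A B compact_imp_bounded bounded_Int by blast+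
  have A'I: "A' \<subseteq> {x0 - e..x0 + e}" unfolding A'_def by (auto simp: dist_real_def)
  have B'J: "B' \<subseteq> {y0 - e + e / 2..y0 + e - e / 2}"
  proof
    fix y assume "y \<in> B'"
    then have "\<bar>y0 - y\<bar> < e / 2" by (simp add: B'_def dist_real_def)
    then show "y \<in> {y0 - e + e / 2..y0 + e - e / 2}" unfolding abs_less_iff atLeastAtMost_iff by linarith
  qed
  have pA: "0 < hausdorff_content \<alpha> A'" unfolding A'_def by (rule x0(2)[OF e])
  have pB: "0 < hausdorff_content \<beta> B'" unfolding B'_def by (rule y0(2)) (use e in simp)
  obtain C1 c1 where C1: "0 \<le> C1" "0 < c1" "\<And>N. \<exists>X m. X \<subseteq> A' \<and> frostman \<alpha> C1 ((1 / 2) ^ N) X m \<and> c1 \<le> (\<Sum>x\<in>X. m x)"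
    using discrete_frostman[OF bA' \<alpha>\<beta>(1) pA] by blast
  obtain C2 c2 where C2: "0 \<le> C2" "0 < c2" "\<And>N. \<exists>Y n. Y \<subseteq> B' \<and> frostman \<beta> C2 ((1 / 2) ^ N) Y n \<and> c2 \<le> (\<Sum>y\<in>Y. n y)"
    using discrete_frostman[OF bB' \<alpha>\<beta>(7) pB] by blast
  define C where "C = max C1 C2"
  have C: "0 \<le> C" "C1 \<le> C" "C2 \<le> C" using C1(1) by (auto simp: C_def)
  have e2: "0 < e / 2" using e by simp
  obtain K0 where "\<forall>X m Y n \<delta> j. frostman \<alpha> C \<delta> X m \<longrightarrow> X \<subseteq> {x0 - e..x0 + e} \<longrightarrow> frostman \<beta> C \<delta> Y n \<longrightarrow>
    Y \<subseteq> {y0 - e + e / 2..y0 + e - e / 2} \<longrightarrow> \<delta> \<le> ((1 / 2) ^ j)\<^sup>2 \<longrightarrow>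
    pair_count ((1 / 2) ^ j) X m Y n \<le> K0 * ((1 / 2) ^ j) powr (w - 1)"
    using pair_count_bound[OF \<alpha>\<beta>(1,2,3,4) w(2) e2 C(1)] by blast
  note K0 = this[rule_format]
  define K1 where "K1 = 4 * max 0 K0"
  show ?thesis
    unfolding energy_family_def
  proof (rule exI[of _ "c1 * c2"], rule conjI, rule_tac [2] exI[of _ K1], rule_tac [2] conjI, rule_tac [3] allI)
    show "0 < c1 * c2" "0 \<le> K1" using C1(2) C2(2) by (auto simp: K1_def)
    fix N
    \<comment> \<open>The resolution is \<open>(1 / 2) ^ (2 * N)\<close> so that it is at most the
      square of the scale at every level \<open>j \<le> N\<close>.\<close>
    obtain X m where X: "X \<subseteq> A'" "frostman \<alpha> C1 ((1 / 2) ^ (2 * N)) X m" "c1 \<le> (\<Sum>x\<in>X. m x)" using C1(3) by blast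
    obtain Y n where Y: "Y \<subseteq> B'" "frostman \<beta> C2 ((1 / 2) ^ (2 * N)) Y n" "c2 \<le> (\<Sum>y\<in>Y. n y)" using C2(3) by blast
    note FX = frostman_mono_constant[OF X(2) C(2)] and FY = frostman_mono_constant[OF Y(2) C(3)]
    note fX = frostmanD[OF FX] and fY = frostmanD[OF FY]
    define q where "q p = m (fst p) * n (snd p)" for p :: "real \<times> real"
    show "\<exists>(P :: (real \<times> real) set) q t. finite P \<and> (\<forall>p\<in>P. 0 \<le> q p \<and> t p \<in> Delta f A B) \<and> c1 * c2 \<le> (\<Sum>p\<in>P. q p) \<and>
      (\<forall>j\<le>N. (\<Sum>p\<in>P. \<Sum>p'\<in>P. q p * q p' * (if cell j (t p) = cell j (t p') then 1 else 0)) \<le> K1 * ((1 / 2) ^ j) powr w)"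
    proof (rule exI[of _ "X \<times> Y"], rule exI[of _ q], rule exI[of _ f], intro conjI allI impI ballI)
      show "finite (X \<times> Y)" using fX(3) fY(3) by simp
      fix p assume p: "p \<in> X \<times> Y"
      show "0 \<le> q p" using p fX(4) fY(4) by (auto simp: q_def)
      show "f p \<in> Delta f A B" using p X(1) Y(1) by (auto simp: Delta_def A'_def B'_def)
    next
      have "c1 * c2 \<le> (\<Sum>x\<in>X. m x) * (\<Sum>y\<in>Y. n y)" using X(3) Y(3) C1(2) C2(2) by (intro mult_mono) auto
      also have "\<dots> = (\<Sum>p\<in>X \<times> Y. q p)" by (simp add: q_def sum.cartesian_product' sum_product)
      finally show "c1 * c2 \<le> (\<Sum>p\<in>X \<times> Y. q p)" .
    next
      fix j assume j: "j \<le> N"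
      define r :: real where "r = (1 / 2) ^ j"
      have r: "0 < r" by (simp add: r_def)
      have \<delta>: "(1 / 2) ^ (2 * N) \<le> ((1 / 2 :: real) ^ j)\<^sup>2"
        using j by (simp add: power_mult[symmetric] power_even_eq[symmetric] mult.commute power_decreasing)
      \<comment> \<open>Two values in one cell are at distance at most \<open>r\<close>, where the
        bump is at least \<open>1 / 4\<close>; this is the 4 in \<open>K1\<close>.\<close>
      have ind: "(if cell j s = cell j t then 1 else 0) \<le> 4 * r * (bump ((s - t) / r) / r)" for s t
      proof (cases "cell j s = cell j t")
        case True
        then have "\<bar>s - t\<bar> \<le> r" unfolding r_def by (rule cell_dist)
        then have "\<bar>(s - t) / r\<bar> \<le> 1" using r by (simp add: abs_divide)
        then show ?thesis using True bump_ge[of "(s - t) / r"] r by simp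
      next
        case False
        then show ?thesis using bump_nonneg[of "(s - t) / r"] r by simp
      qed
      have "(\<Sum>p\<in>X \<times> Y. \<Sum>p'\<in>X \<times> Y. q p * q p' * (if cell j (f p) = cell j (f p') then 1 else 0))
         \<le> (\<Sum>p\<in>X \<times> Y. \<Sum>p'\<in>X \<times> Y. q p * q p' * (4 * r * (bump ((f p - f p') / r) / r)))"
        by (intro sum_mono mult_left_mono ind) (use fX(4) fY(4) in \<open>auto simp: q_def\<close>)
      also have "\<dots> = (\<Sum>x\<in>X. \<Sum>y\<in>Y. \<Sum>x'\<in>X. \<Sum>y'\<in>Y. q (x, y) * q (x', y') * (4 * r * (bump ((f (x, y) - f (x', y')) / r) / r)))"
        by (simp only: sum.cartesian_product')
      also have "\<dots> = (\<Sum>x\<in>X. \<Sum>x'\<in>X. \<Sum>y\<in>Y. \<Sum>y'\<in>Y. q (x, y) * q (x', y') * (4 * r * (bump ((f (x, y) - f (x', y')) / r) / r)))"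
        by (intro sum.cong refl sum.swap)
      also have "\<dots> = 4 * r * pair_count r X m Y n"
        unfolding pair_count_def sum.cartesian_product' sum_distrib_left
        by (intro sum.cong refl) (simp add: q_def)
      also have "\<dots> \<le> 4 * r * (K0 * r powr (w - 1))"
        using K0[OF FX order_trans[OF X(1) A'I] FY order_trans[OF Y(1) B'J] \<delta>] r
        unfolding r_def[symmetric] by (intro mult_left_mono) auto
      also have "\<dots> = 4 * K0 * r powr w" using r by (simp add: powr_diff)
      also have "\<dots> \<le> K1 * r powr w" by (intro mult_right_mono) (auto simp: K1_def)
      finally show "(\<Sum>p\<in>X \<times> Y. \<Sum>p'\<in>X \<times> Y. q p * q p' * (if cell j (f p) = cell j (f p') then 1 else 0)) \<le> K1 * ((1 / 2) ^ j) powr w"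
        by (simp only: r_def)
    qed
  qed
qed

section \<open>Exchanging the two variables\<close>

lemma pd_swap:
  "pd_x (f \<circ> prod.swap) = pd_y f \<circ> prod.swap" "pd_y (f \<circ> prod.swap) = pd_x f \<circ> prod.swap"
  by (auto simp: pd_x_def pd_y_def fun_eq_iff)

lemma C_k_on_swap: "C_k_on k S f \<Longrightarrow> C_k_on k (prod.swap ` S) (f \<circ> prod.swap)"
proof (induction k arbitrary: f)
  have c: "continuous_on (prod.swap ` S) (f \<circ> prod.swap)" if "continuous_on S f" for f
    unfolding o_def by (rule continuous_on_compose2[OF that continuous_on_swap]) auto
  {
    case 0
    then show ?case using c by simp
  next
    case (Suc k)
    have "\<forall>(x, y)\<in>prod.swap ` S. (\<lambda>s. (f \<circ> prod.swap) (s, y)) differentiable (at x) \<and>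
        (\<lambda>t. (f \<circ> prod.swap) (x, t)) differentiable (at y)"
      using Suc.prems by (auto simp: o_def)
    moreover have "continuous_on S f" "C_k_on k S (pd_x f)" "C_k_on k S (pd_y f)" using Suc.prems by auto
    ultimately show ?case unfolding C_k_on.simps(2) pd_swap by (intro conjI c Suc.IH)
  }
qed

lemma C_infinity_on_swap: "C_infinity_on S f \<Longrightarrow> C_infinity_on (prod.swap ` S) (f \<circ> prod.swap)"
  unfolding C_infinity_on_def using C_k_on_swap by blast

text \<open>The exchange interchanges the two first derivatives, fixes \<open>rho\<close> by the
  symmetry of the mixed derivatives, and changes the sign of \<open>kappa\<close>. The identity for
  \<open>rho\<close> is needed on a neighbourhood because \<open>kappa\<close> differentiates
  it.\<close>

lemma bad_set_swap:
  assumes S: "open S" and f: "C_infinity_on S f" and p: "p \<in> S" "p \<notin> bad_set S f"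
  shows "prod.swap p \<notin> bad_set (prod.swap ` S) (f \<circ> prod.swap)"
proof -
  obtain x y where xy: "p = (x, y)" by (cases p)
  have mixed: "pd_xy (f \<circ> prod.swap) (t, s) = pd_xy f (s, t)" if "(s, t) \<in> S" for s t
    using mixed_partials_eq[OF S f that] by (simp add: pd_xy_def pd_swap)
  have rho: "rho (f \<circ> prod.swap) (t, s) = rho f (s, t)" if "(s, t) \<in> S" for s t
    using mixed[OF that] by (simp add: rho_def pd_swap)
  obtain A B where AB: "open A" "open B" "x \<in> A" "y \<in> B" "A \<times> B \<subseteq> S"
    using open_prod_elim[OF S p(1)] xy by (metis mem_Sigma_iff)
  have "eventually (\<lambda>t. t \<in> B) (nhds y)" "eventually (\<lambda>s. s \<in> A) (nhds x)"
    using AB by (auto intro: eventually_nhds_in_open)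
  then have "eventually (\<lambda>t. rho (f \<circ> prod.swap) (t, x) = rho f (x, t)) (nhds y)"
    "eventually (\<lambda>s. rho (f \<circ> prod.swap) (y, s) = rho f (s, y)) (nhds x)"
    using AB(3,4,5) rho by (auto elim!: eventually_mono)
  then have "pd_x (rho (f \<circ> prod.swap)) (y, x) = pd_y (rho f) (x, y)"
    "pd_y (rho (f \<circ> prod.swap)) (y, x) = pd_x (rho f) (x, y)"
    by (auto simp: pd_x_def pd_y_def intro!: deriv_cong_ev)
  then have "kappa (f \<circ> prod.swap) (y, x) = - kappa f (x, y)" by (simp add: kappa_def pd_swap)
  then show ?thesis using p mixed[of x y] by (auto simp: bad_set_def xy pd_swap)
qed

lemma Delta_swap: "Delta (f \<circ> prod.swap) B A = Delta f A B"
  by (force simp: Delta_def)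

text \<open>
  The two variables do not play the same role in the argument: the weight of smaller dimension has
  to be the one that is not mollified.
\<close>

lemma energy_family_Delta:
  fixes f :: "real \<times> real \<Rightarrow> real" and A B :: "real set"
  assumes \<Omega>: "open \<Omega>" and f: "C_infinity_on \<Omega> f" and A: "compact A" and B: "compact B"
    and dA: "0 < hausdorff_dim A" and dB: "0 < hausdorff_dim B"
    and AB: "A \<times> B \<subseteq> \<Omega> - bad_set \<Omega> f"
    and w: "0 < w" "w \<le> 1" and sum: "ennreal (2 / 3 + w) < hausdorff_dim A + hausdorff_dim B"
  shows "energy_family (Delta f A B) w"
proof (cases "hausdorff_dim A \<le> hausdorff_dim B")
  case True
  then show ?thesis using energy_family_Delta_ordered[OF \<Omega> f A B dA _ AB w sum] by simp
next
  case False
  have op: "open (prod.swap ` \<Omega>)"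
  proof -
    have "prod.swap ` \<Omega> = prod.swap -` \<Omega>" by force
    moreover have "open (prod.swap -` \<Omega>)" using \<Omega> by (rule open_vimage) (rule continuous_on_swap)
    ultimately show ?thesis by simp
  qed
  have "B \<times> A \<subseteq> prod.swap ` \<Omega> - bad_set (prod.swap ` \<Omega>) (f \<circ> prod.swap)"
  proof
    fix p assume "p \<in> B \<times> A"
    then have "prod.swap p \<in> \<Omega> - bad_set \<Omega> f" using AB by (cases p) auto
    moreover from this have "prod.swap (prod.swap p) \<in> prod.swap ` \<Omega>" by (intro imageI) simp
    ultimately show "p \<in> prod.swap ` \<Omega> - bad_set (prod.swap ` \<Omega>) (f \<circ> prod.swap)"
      using bad_set_swap[OF \<Omega> f, of "prod.swap p"] by simp
  qed
  then have "energy_family (Delta (f \<circ> prod.swap) B A) w"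
    using energy_family_Delta_ordered[OF op C_infinity_on_swap[OF f] B A dB _ _ w] False sum by (simp add: add.commute)
  then show ?thesis by (simp add: Delta_swap)
qed

theorem theorem4p1:
  fixes \<Omega> :: "(real \<times> real) set" and f :: "real \<times> real \<Rightarrow> real" and A B :: "real set"
  assumes "open \<Omega>"
    and "C_infinity_on \<Omega> f"
    and "compact A" and "compact B"
    and "hausdorff_dim A > 0" and "hausdorff_dim B > 0"
    and "A \<times> B \<subseteq> \<Omega> - bad_set \<Omega> f"
  shows "(\<forall>u::real. 0 < u \<and> u < 1 \<longrightarrow>
            hausdorff_dim A + hausdorff_dim B > ennreal (2 / 3 + u) \<longrightarrow>
            hausdorff_dim (Delta f A B) \<ge> ennreal u) \<and>
         (hausdorff_dim A + hausdorff_dim B > ennreal (5 / 3) \<longrightarrow>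
            emeasure lebesgue (Delta f A B) > 0)"
proof -
  note energy = energy_family_Delta[OF assms]
  have cont: "continuous_on (A \<times> B) f"
    using continuous_on_subset[OF C_infinity_on_continuous[OF assms(2)]] assms(7) by blast
  have cD: "compact (Delta f A B)"
    unfolding Delta_def by (rule compact_continuous_image[OF cont compact_Times[OF assms(3,4)]])
  show ?thesis
  proof (intro conjI allI impI)
    fix u :: real
    assume u: "0 < u \<and> u < 1" and sum: "hausdorff_dim A + hausdorff_dim B > ennreal (2 / 3 + u)"
    have E: "energy_family (Delta f A B) u" using energy[OF _ _ sum] u by simp
    show "hausdorff_dim (Delta f A B) \<ge> ennreal u"
    proof (rule ccontr)
      assume "\<not> ennreal u \<le> hausdorff_dim (Delta f A B)"
      then have less: "hausdorff_dim (Delta f A B) < ennreal u" by simp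
      \<comment> \<open>The energy already gives positive content at the exponent
        \<open>u / 2\<close>, whereas the empty set has content 0.\<close>
      have "Delta f A B \<noteq> {}"
      proof
        assume "Delta f A B = {}"
        then have "hausdorff_content (u / 2) (Delta f A B) = 0" by simp
        then show False using content_pos_of_energy[OF cD _ _ E, of "u / 2"] u by simp
      qed
      then obtain s where "0 < s" "s < u" "hausdorff_content s (Delta f A B) = 0"
        using hausdorff_dim_less_content[OF less] u by blast
      then show False using content_pos_of_energy[OF cD _ _ E, of s] by simp
    qed
  next
    assume "hausdorff_dim A + hausdorff_dim B > ennreal (5 / 3)"
    \<comment> \<open>Here \<open>5 / 3 = 2 / 3 + 1\<close>: the energy bound includes the endpoint
      \<open>w = 1\<close>.\<close>
    then have "energy_family (Delta f A B) 1" using energy[of 1] by simp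
    then show "emeasure lebesgue (Delta f A B) > 0" by (rule measure_pos_of_energy[OF cD])
  qed
qed

end
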